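(* Let $0<K<H$. Let $X^H=(X^H_t)_{t\ge 0}$ and $Y^K=(Y^K_t)_{t\ge 0}$ be centred Gaussian processes, defined on a common probability space (not necessarily independent) and such that the sum $X^H+Y^K$ is again a Gaussian process. Assume that $X^H$ and $Y^K$ have a.s. càdlàg sample paths, that $X^H$ is $H$-self-similar and that $Y^K$ is $K$-self-similar. Assume further that (i) the covariance function of $X^H$ is non-negative, i.e. $\operatorname{cov}(X^H_s,X^H_t)\ge 0$ for all $s,t\ge 0$; (ii) the covariance function of $X^H+Y^K$ is non-negative, i.e. $\operatorname{cov}(X^H_s+Y^K_s,\,X^H_t+Y^K_t)\ge 0$ for all $s,t\ge 0$; (iii) the function $\tau\mapsto \operatorname{cov}(X^H_1, e^{-\tau H}X^H_{e^\tau})$, $\tau\in\mathbb{R}$ (the autocovariance function of the Lamperti transform of $X^H$), is continuous, integrable on $\mathbb{R}$ and not the zero function. Let $$\theta_X:=-\lim_{T\to\infty}\frac{\log \mathbb{P}\left(\sup_{t\in[0,T]}X^H_t\le 1\right)}{\log T}$$ be the persistence exponent of $X^H$ (this limit exists because $X^H$ is an $H$-self-similar centred Gaussian process with a.s. càdlàg sample paths and non-negative covariance function, and the autocovariance function $\tau\mapsto \operatorname{cov}(X^H_1, e^{-\tau H}X^H_{e^\tau})$ of its Lamperti transform is continuous, integrable on $\mathbb{R}$ and not the zero function). Then $$\mathbb{P}\left(\sup_{t\in[0,T]}\left(X^H_t+Y^K_t\right)\le 1\right)=T^{-\theta_X+o(1)},\qquad T\to\infty.$$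
   Context: For $H>0$, a process $(X_t)_{t\ge 0}$ is $H$-self-similar if for every $c>0$ the processes $(X_{ct})_{t\ge 0}$ and $(c^H X_t)_{t\ge 0}$ have the same finite-dimensional distributions. The Lamperti transform of an $H$-self-similar process $X^H$ is the stationary process $Z^H(\tau)=e^{-\tau H}X^H_{e^\tau}$, $\tau\in\mathbb{R}$. The notation $f(T)=T^{-\theta+o(1)}$ as $T\to\infty$ means $\lim_{T\to\infty}\log f(T)/\log T=-\theta$. *)

theory Defs
  imports "HOL-Probability.Probability"
begin

text \<open>
  A real-valued process with time set \<open>[0,\<infinity>)\<close> is a function
  \<open>X :: real \<Rightarrow> 'a \<Rightarrow> real\<close>; its values at negative times are never referred to.
\<close>

text \<open>Gaussian laws may be degenerate: \<open>normal_density\<close> only covers positive variance.\<close>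

definition gaussian_rv :: "'a measure \<Rightarrow> ('a \<Rightarrow> real) \<Rightarrow> bool" where
  "gaussian_rv M Z \<longleftrightarrow> Z \<in> borel_measurable M \<and>
     (\<exists>\<mu>. (AE \<omega> in M. Z \<omega> = \<mu>) \<or>
          (\<exists>\<sigma>>0. distributed M lborel Z (\<lambda>x. ennreal (normal_density \<mu> \<sigma> x))))"

definition gaussian_process :: "'a measure \<Rightarrow> (real \<Rightarrow> 'a \<Rightarrow> real) \<Rightarrow> bool" where
  "gaussian_process M X \<longleftrightarrow>
     (\<forall>J a. finite J \<longrightarrow> J \<subseteq> {0..} \<longrightarrow> gaussian_rv M (\<lambda>\<omega>. \<Sum>t\<in>J. a t * X t \<omega>))"

definition centred :: "'a measure \<Rightarrow> (real \<Rightarrow> 'a \<Rightarrow> real) \<Rightarrow> bool" where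
  "centred M X \<longleftrightarrow> (\<forall>t\<ge>0. integrable M (X t) \<and> integral\<^sup>L M (X t) = 0)"

definition covariance :: "'a measure \<Rightarrow> ('a \<Rightarrow> real) \<Rightarrow> ('a \<Rightarrow> real) \<Rightarrow> real" where
  "covariance M U V =
     (LINT \<omega>|M. (U \<omega> - integral\<^sup>L M U) * (V \<omega> - integral\<^sup>L M V))"

definition cadlag :: "(real \<Rightarrow> real) \<Rightarrow> bool" where
  "cadlag f \<longleftrightarrow> (\<forall>t\<ge>0. (f \<longlongrightarrow> f t) (at_right t)) \<and>
                (\<forall>t>0. \<exists>l. (f \<longlongrightarrow> l) (at_left t))"

definition same_fdd ::
    "'a measure \<Rightarrow> (real \<Rightarrow> 'a \<Rightarrow> real) \<Rightarrow> (real \<Rightarrow> 'a \<Rightarrow> real) \<Rightarrow> bool" where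
  "same_fdd M X Y \<longleftrightarrow> (\<forall>J. finite J \<longrightarrow> J \<subseteq> {0..} \<longrightarrow>
     distr M (\<Pi>\<^sub>M t\<in>J. borel) (\<lambda>\<omega>. \<lambda>t\<in>J. X t \<omega>) =
     distr M (\<Pi>\<^sub>M t\<in>J. borel) (\<lambda>\<omega>. \<lambda>t\<in>J. Y t \<omega>))"

definition self_similar :: "'a measure \<Rightarrow> real \<Rightarrow> (real \<Rightarrow> 'a \<Rightarrow> real) \<Rightarrow> bool" where
  "self_similar M H X \<longleftrightarrow> H > 0 \<and>
     (\<forall>c>0. same_fdd M (\<lambda>t. X (c * t)) (\<lambda>t \<omega>. c powr H * X t \<omega>))"

definition lamperti :: "real \<Rightarrow> (real \<Rightarrow> 'a \<Rightarrow> real) \<Rightarrow> real \<Rightarrow> 'a \<Rightarrow> real" where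
  "lamperti H X \<tau> \<omega> = exp (- \<tau> * H) * X (exp \<tau>) \<omega>"

text \<open>
  For a process whose paths are only almost surely cadlag, the event below is measurable
  only up to a null set, so its probability is taken in the completion. The supremum
  is formed in \<open>ereal\<close> because it may be infinite on that null set.
\<close>

definition persistence_prob :: "'a measure \<Rightarrow> (real \<Rightarrow> 'a \<Rightarrow> real) \<Rightarrow> real \<Rightarrow> real" where
  "persistence_prob M X T =
     measure (completion M) {\<omega> \<in> space M. (SUP t\<in>{0..T}. ereal (X t \<omega>)) \<le> 1}"

definition persistence_exponent :: "'a measure \<Rightarrow> (real \<Rightarrow> 'a \<Rightarrow> real) \<Rightarrow> real" where
  "persistence_exponent M X = - Lim at_top (\<lambda>T. ln (persistence_prob M X T) / ln T)"

text \<open>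
  \<open>f T = T\<^bsup>-\<theta>+o(1)\<^esup>\<close> as \<open>T \<rightarrow> \<infinity>\<close>. Positivity of \<open>f\<close> is spelled out because
  \<open>ln 0 = 0\<close>, so the limit alone would not exclude zeros of \<open>f\<close>.
\<close>

definition power_decay :: "(real \<Rightarrow> real) \<Rightarrow> real \<Rightarrow> bool" where
  "power_decay f \<theta> \<longleftrightarrow> (\<forall>\<^sub>F T in at_top. f T > 0) \<and>
     ((\<lambda>T. ln (f T) / ln T) \<longlongrightarrow> - \<theta>) at_top"

end

theory Submission
  imports Defs "HOL-Real_Asymp.Real_Asymp"
begin

text \<open>
  In logarithmic time \<open>\<tau> = ln t\<close> and scaled by \<open>exp (- H * \<tau>)\<close>, the process \<open>X\<close> becomes the stationary
  process \<open>Z\<close>, its Lamperti transform, whereas \<open>Y\<close> becomes a stationary process damped by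
  \<open>exp (- (H - K) * \<tau>)\<close>, and the level \<open>1\<close> becomes the barrier \<open>exp (- H * \<tau>)\<close>. Apart from an
  initial stretch, \<open>X + Y\<close> staying below \<open>1\<close> up to time \<open>exp N\<close> is therefore the event that \<open>Z\<close> stays
  below a level very close to \<open>0\<close> on an interval of length about \<open>N\<close>. The probability that \<open>Z \<le> 0\<close>
  on an interval of length \<open>N\<close> decays like \<open>exp (- \<theta> * N)\<close>, and three facts show that neither the
  perturbation nor the initial stretch changes the rate \<open>\<theta>\<close>.

  First, non-negative correlations make the events that a Gaussian process stays below a barrier on
  different time sets positively associated (\<open>slepian_countable\<close>). This gives the existence of
  \<open>\<theta>\<close> by subadditivity, and it allows the initial stretch to be split off from \<open>X + Y\<close> at the price of
  a factor that is bounded below geometrically in its length (\<open>survive_geometric_lower\<close>).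

  Second, the rate is continuous in the level (\<open>stationary_shift_bound\<close>). This is where the
  integrability of the autocovariance enters: the process can be shifted by \<open>\<delta>\<close> on an interval
  of length \<open>N\<close> along a direction of squared Cameron-Martin norm \<open>O(\<delta>\<^sup>2 * N)\<close>, so that lowering
  the level by \<open>\<delta>\<close> changes the exponential rate by an amount that vanishes with \<open>\<delta>\<close>.

  Third, the damped process exceeds \<open>\<delta>\<close> after logarithmic time \<open>sqrt N\<close> only with a probability
  that is superexponentially small in \<open>N\<close>. This follows from Fernique's theorem
  (\<open>fernique_tail\<close>), whose input is the boundedness of cadlag paths on compact sets.

  Cutting logarithmic time at \<open>sqrt N\<close> combines these facts (\<open>survive_rate\<close>). The resulting rate
  depends on \<open>X\<close> only, and the same theorem with \<open>Y = 0\<close> shows that it is the persistence exponent of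
  \<open>X\<close>.

  All suprema are taken over the countable set of times \<open>exp \<tau>\<close> with rational \<open>\<tau>\<close>, which suffices for
  cadlag paths. All identities in law come from the uniqueness of centred Gaussian laws with given
  second moments (\<open>gaussian_family_law_eq\<close>).
\<close>

section \<open>Joint characteristic functions determine finite-dimensional laws\<close>

text \<open>
  Levy's uniqueness theorem for finite measures: both measures have the same total mass (the
  transform at \<open>0\<close>) and can be normalised. Masses other than \<open>1\<close> occur below because
  measures are reweighted and restricted.
\<close>

lemma finite_measure_char_unique:
  fixes V :: "'a \<Rightarrow> real" and W :: "'b \<Rightarrow> real"
  assumes "finite_measure M" "finite_measure N"
    and [measurable]: "V \<in> borel_measurable M" "W \<in> borel_measurable N"
    and char_eq: "\<And>t. (CLINT \<omega>|M. iexp (t * V \<omega>)) = (CLINT \<omega>|N. iexp (t * W \<omega>))"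
    and [measurable]: "A \<in> sets borel"
  shows "measure M {\<omega>\<in>space M. V \<omega> \<in> A} = measure N {\<omega>\<in>space N. W \<omega> \<in> A}"
proof -
  interpret M: finite_measure M by fact
  interpret N: finite_measure N by fact
  define m where "m = measure M (space M)"
  have mN: "m = measure N (space N)"
    using char_eq[of 0] by (simp add: m_def)
  show ?thesis
  proof (cases "m = 0")
    case True
    have "measure M {\<omega>\<in>space M. V \<omega> \<in> A} \<le> m"
      unfolding m_def by (rule M.finite_measure_mono) auto
    moreover have "measure N {\<omega>\<in>space N. W \<omega> \<in> A} \<le> m"
      unfolding mN by (rule N.finite_measure_mono) auto
    ultimately show ?thesis using True measure_nonneg
      by (metis order_antisym)
  next
    case False
    then have m0: "m > 0" by (simp add: m_def order_less_le)
    define P where "P = distr (density M (\<lambda>_. ennreal (1/m))) borel V"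
    define Q where "Q = distr (density N (\<lambda>_. ennreal (1/m))) borel W"
    have pP: "prob_space P" unfolding P_def
      by (rule prob_space.prob_space_distr, rule prob_spaceI)
         (use m0 in \<open>auto simp: emeasure_density nn_integral_cmult M.emeasure_eq_measure m_def[symmetric] ennreal_mult[symmetric]\<close>)
    have pQ: "prob_space Q" unfolding Q_def
      by (rule prob_space.prob_space_distr, rule prob_spaceI)
         (use m0 in \<open>auto simp: emeasure_density nn_integral_cmult N.emeasure_eq_measure mN[symmetric] ennreal_mult[symmetric]\<close>)
    have "real_distribution P" "real_distribution Q"
      using pP pQ by (auto simp: real_distribution_def real_distribution_axioms_def P_def Q_def)
    moreover have "char P = char Q"
    proof
      fix t
      have "char P t = (1/m) *\<^sub>R (CLINT \<omega>|M. iexp (t * V \<omega>))"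
        unfolding char_def P_def
        by (subst integral_distr) (use m0 in \<open>auto simp: integral_density\<close>)
      moreover have "char Q t = (1/m) *\<^sub>R (CLINT \<omega>|N. iexp (t * W \<omega>))"
        unfolding char_def Q_def
        by (subst integral_distr) (use m0 in \<open>auto simp: integral_density\<close>)
      ultimately show "char P t = char Q t" using char_eq by simp
    qed
    ultimately have "P = Q" by (rule Levy_uniqueness)
    have "emeasure P A = ennreal (1/m) * emeasure M {\<omega>\<in>space M. V \<omega> \<in> A}"
      unfolding P_def by (subst emeasure_distr)
        (auto simp: emeasure_density nn_integral_cmult vimage_def Int_def conj_commute)
    moreover have "emeasure Q A = ennreal (1/m) * emeasure N {\<omega>\<in>space N. W \<omega> \<in> A}"
      unfolding Q_def by (subst emeasure_distr)
        (auto simp: emeasure_density nn_integral_cmult vimage_def Int_def conj_commute)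
    ultimately have "ennreal (1/m) * ennreal (measure M {\<omega>\<in>space M. V \<omega> \<in> A})
       = ennreal (1/m) * ennreal (measure N {\<omega>\<in>space N. W \<omega> \<in> A})"
      using \<open>P = Q\<close> by (simp add: M.emeasure_eq_measure N.emeasure_eq_measure)
    then show ?thesis using m0 by (simp add: ennreal_mult[symmetric])
  qed
qed

lemma finite_measure_integrable_iexp:
  assumes "finite_measure M" and [measurable]: "f \<in> borel_measurable M"
  shows "integrable M (\<lambda>\<omega>. iexp (f \<omega>))"
proof -
  interpret finite_measure M by fact
  show ?thesis by (rule integrable_const_bound[of _ 1]) auto
qed

text \<open>
  The weight \<open>1 + cos (S + \<alpha>)\<close> is non-negative, yet its product with a character is a
  combination of characters. So a measure reweighted in this way has a transform that is known from
  the joint characteristic function.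
\<close>

lemma integral_cos_shift_iexp:
  assumes "finite_measure M" and [measurable]: "S \<in> borel_measurable M" "V \<in> borel_measurable M"
  shows "(CLINT \<omega>|M. (1 + cos (S \<omega> + \<alpha>)) *\<^sub>R iexp (t * V \<omega>)) =
     (CLINT \<omega>|M. iexp (t * V \<omega>)) + iexp \<alpha> / 2 * (CLINT \<omega>|M. iexp (t * V \<omega> + S \<omega>))
      + iexp (-\<alpha>) / 2 * (CLINT \<omega>|M. iexp (t * V \<omega> - S \<omega>))"
proof -
  have *: "(1 + cos (s + \<alpha>)) *\<^sub>R iexp v = iexp v + iexp \<alpha> / 2 * iexp (v + s) + iexp (-\<alpha>) / 2 * iexp (v - s)"
    for s v
  proof -
    have "(1 + cos (s + \<alpha>)) *\<^sub>R iexp v = iexp v + complex_of_real (cos (s + \<alpha>)) * iexp v"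
      by (simp add: scaleR_conv_of_real algebra_simps)
    also have "complex_of_real (cos (s + \<alpha>)) = (iexp (s+\<alpha>) + iexp (-(s+\<alpha>))) / 2"
      by (simp only: cos_of_real[symmetric] cos_exp_eq of_real_minus mult_minus_right)
    also have "\<dots> * iexp v = iexp \<alpha> / 2 * iexp (v + s) + iexp (-\<alpha>) / 2 * iexp (v - s)"
      by (simp add: add_divide_distrib distrib_left distrib_right exp_add[symmetric] algebra_simps)
    finally show ?thesis by (simp add: add.assoc)
  qed
  show ?thesis unfolding *
    by (rule has_bochner_integral_integral_eq)
      (intro has_bochner_integral_add has_bochner_integral_mult_right has_bochner_integral_integrable
        finite_measure_integrable_iexp[OF assms(1)]; measurable)
qed

lemma measure_density_one_plus_cos:
  assumes "finite_measure M" and [measurable]: "S \<in> borel_measurable M" "B \<in> sets M"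
  shows "finite_measure (density M (\<lambda>\<omega>. ennreal (1 + cos (S \<omega>))))"
    and "measure (density M (\<lambda>\<omega>. ennreal (1 + cos (S \<omega>)))) B = measure M B + (\<integral>\<omega>. indicator B \<omega> * cos (S \<omega>) \<partial>M)"
proof -
  interpret finite_measure M by fact
  have w: "0 \<le> 1 + cos (S \<omega>)" "\<bar>1 + cos (S \<omega>)\<bar> \<le> 2" for \<omega>
    using cos_ge_minus_one[of "S \<omega>"] cos_le_one[of "S \<omega>"] unfolding abs_le_iff by linarith+
  have "integrable M (\<lambda>\<omega>. 1 + cos (S \<omega>))"
    by (rule integrable_const_bound[of _ 2]) (use w in auto)
  then show "finite_measure (density M (\<lambda>\<omega>. ennreal (1 + cos (S \<omega>))))"
    using w by (auto intro!: finite_measureI simp: emeasure_density nn_integral_eq_integral)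
  have "measure (density M (\<lambda>\<omega>. ennreal (1 + cos (S \<omega>)))) B = (\<integral>\<omega>. indicator B \<omega> * (1 + cos (S \<omega>)) \<partial>M)"
    using w by (subst measure_def, subst emeasure_density, simp, simp, subst integral_eq_nn_integral)
       (auto simp: ennreal_mult ennreal_indicator mult.commute)
  also have "\<dots> = (\<integral>\<omega>. indicator B \<omega> + indicator B \<omega> * cos (S \<omega>) \<partial>M)"
    by (simp add: algebra_simps)
  also have "\<dots> = measure M B + (\<integral>\<omega>. indicator B \<omega> * cos (S \<omega>) \<partial>M)"
    by (subst Bochner_Integration.integral_add)
      (auto intro!: integrable_const_bound[of _ 1] simp: emeasure_eq_measure indicator_def abs_mult)
  finally show "measure (density M (\<lambda>\<omega>. ennreal (1 + cos (S \<omega>)))) B = measure M B + (\<integral>\<omega>. indicator B \<omega> * cos (S \<omega>) \<partial>M)" .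
qed

lemma integral_restricted_iexp:
  assumes "finite_measure M" and [measurable]: "S \<in> borel_measurable M" "B \<in> sets M"
  shows "(CLINT \<omega>|density M (indicator B). iexp (S \<omega>)) =
     complex_of_real (\<integral>\<omega>. indicator B \<omega> * cos (S \<omega> + 0) \<partial>M)
     + \<i> * complex_of_real (\<integral>\<omega>. indicator B \<omega> * cos (S \<omega> + (- (pi / 2))) \<partial>M)"
proof -
  interpret finite_measure M by fact
  have e: "iexp x = complex_of_real (cos (x + 0)) + \<i> * complex_of_real (cos (x + (- (pi/2))))" for x
    using cos_minus[of "x - pi/2"] sin_cos_eq[of x] by (simp add: exp_Euler cos_of_real sin_of_real)
  have "(CLINT \<omega>|density M (indicator B). iexp (S \<omega>)) = (CLINT \<omega>|M. indicator B \<omega> *\<^sub>R iexp (S \<omega>))"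
    by (subst integral_density[of _ M "indicator B", unfolded ennreal_indicator]) auto
  also have "\<dots> = (CLINT \<omega>|M. complex_of_real (indicator B \<omega> * cos (S \<omega> + 0))
      + \<i> * complex_of_real (indicator B \<omega> * cos (S \<omega> + (-(pi/2)))))"
    unfolding e by (simp add: scaleR_conv_of_real algebra_simps)
  also have "\<dots> = complex_of_real (\<integral>\<omega>. indicator B \<omega> * cos (S \<omega> + 0) \<partial>M)
      + \<i> * complex_of_real (\<integral>\<omega>. indicator B \<omega> * cos (S \<omega> + (-(pi/2))) \<partial>M)"
    by (subst Bochner_Integration.integral_add)
       (auto intro!: integrable_const_bound[of _ 1] simp: indicator_def abs_mult norm_mult simp del: of_real_mult)
  finally show ?thesis .
qed

text \<open>
  Induction on the number of coordinates. Restricting both measures to an event of the first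
  coordinate keeps the joint characteristic functions of the remaining coordinates equal: the
  integrals of \<open>cos (S + \<alpha>)\<close> over that event are obtained from the one-dimensional uniqueness
  theorem, applied with the weights \<open>1 + cos (S + \<alpha>)\<close> and \<open>1\<close>. The values \<open>\<alpha> = 0\<close> and
  \<open>\<alpha> = - pi / 2\<close> give the cosine and the sine.
\<close>

lemma joint_char_unique:
  fixes V :: "'i \<Rightarrow> 'a \<Rightarrow> real" and W :: "'i \<Rightarrow> 'b \<Rightarrow> real"
  assumes "finite J" "finite_measure M" "finite_measure N"
    and V: "\<And>j. V j \<in> borel_measurable M" and W: "\<And>j. W j \<in> borel_measurable N"
    and char_eq: "\<And>a. (CLINT \<omega>|M. iexp (\<Sum>j\<in>J. a j * V j \<omega>)) = (CLINT \<omega>|N. iexp (\<Sum>j\<in>J. a j * W j \<omega>))"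
    and A: "\<And>j. A j \<in> sets borel"
  shows "measure M {\<omega>\<in>space M. \<forall>j\<in>J. V j \<omega> \<in> A j} = measure N {\<omega>\<in>space N. \<forall>j\<in>J. W j \<omega> \<in> A j}"
  using assms
proof (induction J arbitrary: M N rule: finite_induct)
  case empty
  from empty(5)[of "\<lambda>_. 0"] show ?case by simp
next
  case (insert k J)
  interpret M: finite_measure M by fact
  interpret N: finite_measure N by fact
  note [measurable] = insert.prems(3,4,6)
  define BM where "BM = {\<omega>\<in>space M. V k \<omega> \<in> A k}"
  define BN where "BN = {\<omega>\<in>space N. W k \<omega> \<in> A k}"
  have [measurable]: "BM \<in> sets M" "BN \<in> sets N" by (auto simp: BM_def BN_def)
  let ?M = "density M (indicator BM)" and ?N = "density N (indicator BN)"
  have split: "(CLINT \<omega>|M. iexp (t * V k \<omega> + (\<Sum>j\<in>J. a j * V j \<omega>)))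
     = (CLINT \<omega>|N. iexp (t * W k \<omega> + (\<Sum>j\<in>J. a j * W j \<omega>)))" for t a
  proof -
    have "(\<Sum>j\<in>J. (a(k := t)) j * x j) = (\<Sum>j\<in>J. a j * x j)" for x :: "'i \<Rightarrow> real"
      using insert.hyps by (intro sum.cong) auto
    then show ?thesis
      using insert.prems(5)[of "a(k := t)"] insert.hyps by simp
  qed
  have split_neg: "(CLINT \<omega>|M. iexp (t * V k \<omega> - (\<Sum>j\<in>J. a j * V j \<omega>)))
     = (CLINT \<omega>|N. iexp (t * W k \<omega> - (\<Sum>j\<in>J. a j * W j \<omega>)))" for t a
    using split[of t "\<lambda>j. - a j"] by (simp add: sum_negf)
  have split0: "(CLINT \<omega>|M. iexp (t * V k \<omega>)) = (CLINT \<omega>|N. iexp (t * W k \<omega>))" for t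
    using split[of t "\<lambda>j. 0"] by simp
  have eq1: "measure M BM = measure N BN"
    unfolding BM_def BN_def
    by (rule finite_measure_char_unique) (use split0 in \<open>auto intro: M.finite_measure_axioms N.finite_measure_axioms\<close>)
  have wt: "(\<integral>\<omega>. indicator BM \<omega> * cos ((\<Sum>j\<in>J. a j * V j \<omega>) + \<alpha>) \<partial>M) =
      (\<integral>\<omega>. indicator BN \<omega> * cos ((\<Sum>j\<in>J. a j * W j \<omega>) + \<alpha>) \<partial>N)" for a \<alpha>
  proof -
    define SM where "SM \<omega> = (\<Sum>j\<in>J. a j * V j \<omega>) + \<alpha>" for \<omega>
    define SN where "SN \<omega> = (\<Sum>j\<in>J. a j * W j \<omega>) + \<alpha>" for \<omega>
    have [measurable]: "SM \<in> borel_measurable M" "SN \<in> borel_measurable N"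
      unfolding SM_def SN_def by measurable
    have nn: "0 \<le> 1 + cos (x :: real)" for x using cos_ge_minus_one[of x] by linarith
    let ?M' = "density M (\<lambda>\<omega>. ennreal (1 + cos (SM \<omega>)))" and ?N' = "density N (\<lambda>\<omega>. ennreal (1 + cos (SN \<omega>)))"
    have "measure ?M' {\<omega>\<in>space ?M'. V k \<omega> \<in> A k} = measure ?N' {\<omega>\<in>space ?N'. W k \<omega> \<in> A k}"
    proof (rule finite_measure_char_unique)
      show "finite_measure ?M'"
        by (rule measure_density_one_plus_cos(1)[OF insert.prems(1), of _ BM]) measurable
      show "finite_measure ?N'"
        by (rule measure_density_one_plus_cos(1)[OF insert.prems(2), of _ BN]) measurable
      fix t
      have "(CLINT \<omega>|?M'. iexp (t * V k \<omega>)) = (CLINT \<omega>|M. (1 + cos (SM \<omega>)) *\<^sub>R iexp (t * V k \<omega>))"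
        using nn by (subst integral_density) auto
      also have "\<dots> = (CLINT \<omega>|N. (1 + cos (SN \<omega>)) *\<^sub>R iexp (t * W k \<omega>))"
        unfolding SM_def SN_def
        by (subst integral_cos_shift_iexp[OF insert.prems(1)], measurable,
            subst integral_cos_shift_iexp[OF insert.prems(2)], measurable)
          (simp only: split split0 split_neg)
      also have "\<dots> = (CLINT \<omega>|?N'. iexp (t * W k \<omega>))"
        using nn by (subst integral_density) auto
      finally show "(CLINT \<omega>|?M'. iexp (t * V k \<omega>)) = (CLINT \<omega>|?N'. iexp (t * W k \<omega>))" .
    qed auto
    then have "measure ?M' BM = measure ?N' BN" by (simp add: BM_def BN_def)
    moreover have "measure ?M' BM = measure M BM + (\<integral>\<omega>. indicator BM \<omega> * cos (SM \<omega>) \<partial>M)"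
      by (rule measure_density_one_plus_cos(2)[OF insert.prems(1)]) measurable
    moreover have "measure ?N' BN = measure N BN + (\<integral>\<omega>. indicator BN \<omega> * cos (SN \<omega>) \<partial>N)"
      by (rule measure_density_one_plus_cos(2)[OF insert.prems(2)]) measurable
    ultimately show ?thesis using eq1 by (simp add: SM_def SN_def)
  qed
  have "measure ?M {\<omega>\<in>space ?M. \<forall>j\<in>J. V j \<omega> \<in> A j} = measure ?N {\<omega>\<in>space ?N. \<forall>j\<in>J. W j \<omega> \<in> A j}"
  proof (rule insert.IH)
    show "finite_measure ?M" "finite_measure ?N"
      by (auto intro!: finite_measureI simp: emeasure_restricted M.emeasure_eq_measure N.emeasure_eq_measure)
    fix a
    show "(CLINT \<omega>|?M. iexp (\<Sum>j\<in>J. a j * V j \<omega>)) = (CLINT \<omega>|?N. iexp (\<Sum>j\<in>J. a j * W j \<omega>))"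
      by (subst integral_restricted_iexp[OF insert.prems(1)], measurable,
          subst integral_restricted_iexp[OF insert.prems(2)], measurable) (simp only: wt)
  qed (use insert.hyps in auto)
  moreover have "measure ?M {\<omega>\<in>space ?M. \<forall>j\<in>J. V j \<omega> \<in> A j} = measure M {\<omega>\<in>space M. \<forall>j\<in>insert k J. V j \<omega> \<in> A j}"
    using insert.hyps by (subst measure_restricted) (auto simp: BM_def intro!: arg_cong[where f="measure M"])
  moreover have "measure ?N {\<omega>\<in>space ?N. \<forall>j\<in>J. W j \<omega> \<in> A j} = measure N {\<omega>\<in>space N. \<forall>j\<in>insert k J. W j \<omega> \<in> A j}"
    using insert.hyps by (subst measure_restricted) (auto simp: BN_def intro!: arg_cong[where f="measure N"])
  ultimately show ?case by simp
qed

section \<open>Centred Gaussian families\<close>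

text \<open>
  Stating Gaussianity through characteristic functions makes the notion stable under linear maps and
  independent unions, and covers degenerate laws. The index set is a whole type, so that auxiliary
  variables are adjoined by passing to a sum or option type.
\<close>

definition gaussian_family :: "'a measure \<Rightarrow> ('i \<Rightarrow> 'a \<Rightarrow> real) \<Rightarrow> bool" where
  "gaussian_family M V \<longleftrightarrow> prob_space M \<and>
     (\<forall>i. V i \<in> borel_measurable M \<and> integrable M (\<lambda>\<omega>. (V i \<omega>)\<^sup>2) \<and> (\<integral>\<omega>. V i \<omega> \<partial>M) = 0) \<and>
     (\<forall>J a. finite J \<longrightarrow> (CLINT \<omega>|M. iexp (\<Sum>j\<in>J. a j * V j \<omega>)) =
        complex_of_real (exp (- (\<integral>\<omega>. (\<Sum>j\<in>J. a j * V j \<omega>)\<^sup>2 \<partial>M) / 2)))"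

abbreviation path_space :: "('i \<Rightarrow> real) measure" where
  "path_space \<equiv> (\<Pi>\<^sub>M i\<in>UNIV. borel)"

lemma space_path_space [simp]: "space path_space = UNIV"
  by (simp add: space_PiM)

lemma measurable_path_map:
  "(\<And>i. V i \<in> borel_measurable M) \<Longrightarrow> (\<lambda>\<omega> i. V i \<omega>) \<in> M \<rightarrow>\<^sub>M path_space"
  by (rule measurable_PiM_single') auto

lemma gaussian_familyD:
  assumes "gaussian_family M V"
  shows "prob_space M" "V i \<in> borel_measurable M" "integrable M (\<lambda>\<omega>. (V i \<omega>)\<^sup>2)" "(\<integral>\<omega>. V i \<omega> \<partial>M) = 0"
    "finite J \<Longrightarrow> (CLINT \<omega>|M. iexp (\<Sum>j\<in>J. a j * V j \<omega>)) =
        complex_of_real (exp (- (\<integral>\<omega>. (\<Sum>j\<in>J. a j * V j \<omega>)\<^sup>2 \<partial>M) / 2))"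
  using assms unfolding gaussian_family_def by auto

lemma integrable_mult_of_squares:
  fixes f g :: "'a \<Rightarrow> real"
  assumes [measurable]: "f \<in> borel_measurable M" "g \<in> borel_measurable M"
    and "integrable M (\<lambda>x. (f x)\<^sup>2)" "integrable M (\<lambda>x. (g x)\<^sup>2)"
  shows "integrable M (\<lambda>x. f x * g x)"
proof (rule Bochner_Integration.integrable_bound)
  show "integrable M (\<lambda>x. (f x)\<^sup>2 + (g x)\<^sup>2)" using assms by auto
  show "AE x in M. norm (f x * g x) \<le> norm ((f x)\<^sup>2 + (g x)\<^sup>2)"
  proof (rule AE_I2)
    fix x
    have "2 * (\<bar>f x\<bar> * \<bar>g x\<bar>) \<le> (f x)\<^sup>2 + (g x)\<^sup>2"
      using sum_squares_bound[of "\<bar>f x\<bar>" "\<bar>g x\<bar>"] by simp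
    moreover have "0 \<le> \<bar>f x\<bar> * \<bar>g x\<bar>" by (intro mult_nonneg_nonneg) auto
    ultimately have "\<bar>f x\<bar> * \<bar>g x\<bar> \<le> (f x)\<^sup>2 + (g x)\<^sup>2" by linarith
    then show "norm (f x * g x) \<le> norm ((f x)\<^sup>2 + (g x)\<^sup>2)"
      by (simp add: abs_mult)
  qed
qed auto

lemma gaussian_family_integrable_mult:
  assumes "gaussian_family M V"
  shows "integrable M (\<lambda>\<omega>. V i \<omega> * V j \<omega>)"
  using assms by (intro integrable_mult_of_squares) (auto dest: gaussian_familyD)

lemma gaussian_family_integrable:
  assumes "gaussian_family M V"
  shows "integrable M (V i)"
proof -
  interpret prob_space M using assms by (rule gaussian_familyD)
  from integrable_mult_of_squares[of "V i" M "\<lambda>_. 1"] gaussian_familyD[OF assms]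
  show ?thesis by simp
qed

lemma gaussian_family_bilinear:
  assumes "gaussian_family M V"
  shows "(\<integral>\<omega>. (\<Sum>i\<in>I. a i * V i \<omega>) * (\<Sum>j\<in>J. b j * V j \<omega>) \<partial>M)
    = (\<Sum>i\<in>I. \<Sum>j\<in>J. a i * b j * (\<integral>\<omega>. V i \<omega> * V j \<omega> \<partial>M))"
proof -
  have "(\<Sum>i\<in>I. a i * V i \<omega>) * (\<Sum>j\<in>J. b j * V j \<omega>) =
      (\<Sum>i\<in>I. \<Sum>j\<in>J. a i * b j * (V i \<omega> * V j \<omega>))" for \<omega>
    by (simp add: sum_product mult_ac)
  then show ?thesis
    by (simp add: gaussian_family_integrable_mult[OF assms])
qed

lemma gaussian_family_square_integrable_sum:
  assumes "gaussian_family M V"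
  shows "integrable M (\<lambda>\<omega>. (\<Sum>i\<in>I. a i * V i \<omega>)\<^sup>2)"
proof -
  have "(\<Sum>i\<in>I. a i * V i \<omega>)\<^sup>2 =
      (\<Sum>i\<in>I. \<Sum>j\<in>I. a i * a j * (V i \<omega> * V j \<omega>))" for \<omega>
    by (simp add: sum_product power2_eq_square mult_ac)
  then show ?thesis
    by (simp add: gaussian_family_integrable_mult[OF assms])
qed

lemma gaussian_family_linear:
  fixes V :: "'i \<Rightarrow> 'a \<Rightarrow> real" and A :: "'k \<Rightarrow> 'i set"
  assumes V: "gaussian_family M V" and fin: "\<And>k. finite (A k)"
  shows "gaussian_family M (\<lambda>k \<omega>. \<Sum>i\<in>A k. c k i * V i \<omega>)"
  unfolding gaussian_family_def
proof (intro conjI allI impI)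
  note [measurable] = gaussian_familyD(2)[OF V]
  show "prob_space M" by (rule gaussian_familyD[OF V])
  fix k
  show "(\<lambda>\<omega>. \<Sum>i\<in>A k. c k i * V i \<omega>) \<in> borel_measurable M" by measurable
  show "integrable M (\<lambda>\<omega>. (\<Sum>i\<in>A k. c k i * V i \<omega>)\<^sup>2)"
    by (rule gaussian_family_square_integrable_sum[OF V])
  show "(\<integral>\<omega>. (\<Sum>i\<in>A k. c k i * V i \<omega>) \<partial>M) = 0"
    by (simp add: gaussian_family_integrable[OF V] gaussian_familyD[OF V])
next
  fix J :: "'k set" and a :: "'k \<Rightarrow> real"
  assume J: "finite J"
  define I where "I = (\<Union>k\<in>J. A k)"
  have I: "finite I" using J fin by (auto simp: I_def)
  define b where "b i = (\<Sum>k\<in>J. if i \<in> A k then a k * c k i else 0)" for i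
  have "(\<Sum>k\<in>J. a k * (\<Sum>i\<in>A k. c k i * x i)) = (\<Sum>i\<in>I. b i * x i)" for x :: "'i \<Rightarrow> real"
  proof -
    have "(\<Sum>k\<in>J. a k * (\<Sum>i\<in>A k. c k i * x i)) = (\<Sum>k\<in>J. \<Sum>i\<in>I. (if i \<in> A k then a k * c k i else 0) * x i)"
    proof (intro sum.cong refl)
      fix k assume "k \<in> J"
      then have "A k \<subseteq> I" by (auto simp: I_def)
      then have "(\<Sum>i\<in>A k. c k i * x i) = (\<Sum>i\<in>I. if i \<in> A k then c k i * x i else 0)"
        using I by (simp add: sum.inter_restrict[symmetric] Int_absorb1)
      then show "a k * (\<Sum>i\<in>A k. c k i * x i) = (\<Sum>i\<in>I. (if i \<in> A k then a k * c k i else 0) * x i)"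
        by (auto simp: sum_distrib_left intro!: sum.cong)
    qed
    also have "\<dots> = (\<Sum>i\<in>I. b i * x i)"
      by (subst sum.swap) (simp add: b_def sum_distrib_right)
    finally show ?thesis .
  qed
  then show "(CLINT \<omega>|M. iexp (\<Sum>j\<in>J. a j * (\<Sum>i\<in>A j. c j i * V i \<omega>))) =
    complex_of_real (exp (- (\<integral>\<omega>. (\<Sum>j\<in>J. a j * (\<Sum>i\<in>A j. c j i * V i \<omega>))\<^sup>2 \<partial>M) / 2))"
    using gaussian_familyD(5)[OF V I, of b] by simp
qed

lemma (in pair_sigma_finite)
  fixes f :: "'a \<Rightarrow> 'c :: {real_normed_field, banach, second_countable_topology}"
  assumes f: "integrable M1 f" and g: "integrable M2 g"
  shows integrable_prod: "integrable (M1 \<Otimes>\<^sub>M M2) (\<lambda>z. f (fst z) * g (snd z))"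
    and integral_prod: "(\<integral>z. f (fst z) * g (snd z) \<partial>(M1 \<Otimes>\<^sub>M M2)) = (\<integral>x. f x \<partial>M1) * (\<integral>y. g y \<partial>M2)"
proof -
  show i: "integrable (M1 \<Otimes>\<^sub>M M2) (\<lambda>z. f (fst z) * g (snd z))"
    using f g by (intro Fubini_integrable) (auto simp: norm_mult)
  show "(\<integral>z. f (fst z) * g (snd z) \<partial>(M1 \<Otimes>\<^sub>M M2)) = (\<integral>x. f x \<partial>M1) * (\<integral>y. g y \<partial>M2)"
    using f g by (subst integral_fst'[symmetric, OF i]) simp
qed

text \<open>
  Two independent families, realised on the product space; the indices are the disjoint union.
\<close>

lemma gaussian_family_pair:
  fixes V :: "'i \<Rightarrow> 'a \<Rightarrow> real" and W :: "'j \<Rightarrow> 'b \<Rightarrow> real"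
  assumes V: "gaussian_family M V" and W: "gaussian_family N W"
  defines "U \<equiv> case_sum (\<lambda>i z. V i (fst z)) (\<lambda>j z. W j (snd z))"
  shows "gaussian_family (M \<Otimes>\<^sub>M N) U"
    and "(\<integral>z. U (Inl i) z * U (Inl i') z \<partial>(M \<Otimes>\<^sub>M N)) = (\<integral>\<omega>. V i \<omega> * V i' \<omega> \<partial>M)"
    and "(\<integral>z. U (Inr j) z * U (Inr j') z \<partial>(M \<Otimes>\<^sub>M N)) = (\<integral>\<omega>. W j \<omega> * W j' \<omega> \<partial>N)"
    and "(\<integral>z. U (Inl i) z * U (Inr j) z \<partial>(M \<Otimes>\<^sub>M N)) = 0"
    and "(\<integral>z. U (Inr j) z * U (Inl i) z \<partial>(M \<Otimes>\<^sub>M N)) = 0"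
proof -
  interpret M: prob_space M by (rule gaussian_familyD[OF V])
  interpret N: prob_space N by (rule gaussian_familyD[OF W])
  interpret P: pair_prob_space M N ..
  note [measurable] = gaussian_familyD(2)[OF V] gaussian_familyD(2)[OF W]
  have int1: "integrable (M \<Otimes>\<^sub>M N) (\<lambda>z. f (fst z))" "(\<integral>z. f (fst z) \<partial>(M \<Otimes>\<^sub>M N)) = (\<integral>x. f x \<partial>M)"
    if f: "integrable M f" for f :: "'a \<Rightarrow> real"
    using P.integrable_prod[of f "\<lambda>_. 1"] P.integral_prod[of f "\<lambda>_. 1"] f by (simp_all add: N.prob_space)
  have int2: "integrable (M \<Otimes>\<^sub>M N) (\<lambda>z. f (snd z))" "(\<integral>z. f (snd z) \<partial>(M \<Otimes>\<^sub>M N)) = (\<integral>x. f x \<partial>N)"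
    if f: "integrable N f" for f :: "'b \<Rightarrow> real"
    using P.integrable_prod[of "\<lambda>_. 1" f] P.integral_prod[of "\<lambda>_. 1" f] f by (simp_all add: M.prob_space)
  note int12 = P.integrable_prod P.integral_prod
  note iV = gaussian_family_integrable[OF V] and iW = gaussian_family_integrable[OF W]
  note mV = gaussian_family_integrable_mult[OF V] and mW = gaussian_family_integrable_mult[OF W]
  show "(\<integral>z. U (Inl i) z * U (Inl i') z \<partial>(M \<Otimes>\<^sub>M N)) = (\<integral>\<omega>. V i \<omega> * V i' \<omega> \<partial>M)"
    unfolding U_def using int1(2)[OF mV[of i i']] by simp
  show "(\<integral>z. U (Inr j) z * U (Inr j') z \<partial>(M \<Otimes>\<^sub>M N)) = (\<integral>\<omega>. W j \<omega> * W j' \<omega> \<partial>N)"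
    unfolding U_def using int2(2)[OF mW[of j j']] by simp
  show "(\<integral>z. U (Inl i) z * U (Inr j) z \<partial>(M \<Otimes>\<^sub>M N)) = 0"
    unfolding U_def using int12(2)[OF iV[of i] iW[of j]] by (simp add: gaussian_familyD[OF V])
  then show "(\<integral>z. U (Inr j) z * U (Inl i) z \<partial>(M \<Otimes>\<^sub>M N)) = 0"
    by (simp add: mult.commute)
  show "gaussian_family (M \<Otimes>\<^sub>M N) U"
    unfolding gaussian_family_def
  proof (intro conjI allI impI)
    show "prob_space (M \<Otimes>\<^sub>M N)"
      by (rule prob_space_pair) (rule M.prob_space_axioms N.prob_space_axioms)+
    fix k
    show "U k \<in> borel_measurable (M \<Otimes>\<^sub>M N)"
      unfolding U_def by (cases k) auto
    show "integrable (M \<Otimes>\<^sub>M N) (\<lambda>\<omega>. (U k \<omega>)\<^sup>2)"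
      unfolding U_def by (cases k) (auto intro!: int1 int2 gaussian_familyD[OF V] gaussian_familyD[OF W])
    show "integral\<^sup>L (M \<Otimes>\<^sub>M N) (U k) = 0"
      unfolding U_def using int1(2)[OF iV] int2(2)[OF iW]
      by (cases k) (auto simp: gaussian_familyD[OF V] gaussian_familyD[OF W])
  next
    fix J :: "('i + 'j) set" and a :: "'i + 'j \<Rightarrow> real"
    assume J: "finite J"
    define J1 where "J1 = Inl -` J"
    define J2 where "J2 = Inr -` J"
    have J12: "J = Inl ` J1 \<union> Inr ` J2"
      unfolding J1_def J2_def
    proof (intro set_eqI)
      fix x show "x \<in> J \<longleftrightarrow> x \<in> Inl ` (Inl -` J) \<union> Inr ` (Inr -` J)" by (cases x) auto
    qed
    have fin: "finite J1" "finite J2"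
      using J unfolding J1_def J2_def by (auto intro: finite_vimageI)
    define S1 where "S1 x = (\<Sum>i\<in>J1. a (Inl i) * V i x)" for x
    define S2 where "S2 y = (\<Sum>j\<in>J2. a (Inr j) * W j y)" for y
    have [measurable]: "S1 \<in> borel_measurable M" "S2 \<in> borel_measurable N"
      unfolding S1_def S2_def by measurable
    have S: "(\<Sum>k\<in>J. a k * U k z) = S1 (fst z) + S2 (snd z)" for z
      unfolding J12 using fin
      by (subst sum.union_disjoint) (auto simp: U_def S1_def S2_def sum.reindex)
    have i1: "integrable M S1" "(\<integral>x. S1 x \<partial>M) = 0" "integrable M (\<lambda>x. (S1 x)\<^sup>2)"
      unfolding S1_def by (auto simp: iV gaussian_familyD[OF V] gaussian_family_square_integrable_sum[OF V])
    have i2: "integrable N S2" "(\<integral>x. S2 x \<partial>N) = 0" "integrable N (\<lambda>x. (S2 x)\<^sup>2)"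
      unfolding S2_def by (auto simp: iW gaussian_familyD[OF W] gaussian_family_square_integrable_sum[OF W])
    have "(\<integral>z. (\<Sum>k\<in>J. a k * U k z)\<^sup>2 \<partial>(M \<Otimes>\<^sub>M N)) =
        (\<integral>z. (S1 (fst z))\<^sup>2 + ((S2 (snd z))\<^sup>2 + 2 * (S1 (fst z) * S2 (snd z))) \<partial>(M \<Otimes>\<^sub>M N))"
      unfolding S by (intro Bochner_Integration.integral_cong refl) (auto simp: power2_eq_square algebra_simps)
    also have "\<dots> = (\<integral>x. (S1 x)\<^sup>2 \<partial>M) + ((\<integral>y. (S2 y)\<^sup>2 \<partial>N) + 2 * 0)"
      using int1[OF i1(3)] int2[OF i2(3)] int12[OF i1(1) i2(1)] i1(2) by simp
    finally have sq: "(\<integral>z. (\<Sum>k\<in>J. a k * U k z)\<^sup>2 \<partial>(M \<Otimes>\<^sub>M N)) = (\<integral>x. (S1 x)\<^sup>2 \<partial>M) + (\<integral>y. (S2 y)\<^sup>2 \<partial>N)"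
      by simp
    have e1: "integrable M (\<lambda>x. iexp (S1 x))" and e2: "integrable N (\<lambda>x. iexp (S2 x))"
      by (auto intro!: finite_measure_integrable_iexp M.finite_measure_axioms N.finite_measure_axioms)
    have "(CLINT z|M \<Otimes>\<^sub>M N. iexp (\<Sum>k\<in>J. a k * U k z)) = (CLINT z|M \<Otimes>\<^sub>M N. iexp (S1 (fst z)) * iexp (S2 (snd z)))"
      unfolding S by (simp add: exp_add distrib_left)
    also have "\<dots> = (CLINT x|M. iexp (S1 x)) * (CLINT y|N. iexp (S2 y))"
      by (rule int12(2)[OF e1 e2])
    also have "\<dots> = complex_of_real (exp (- (\<integral>x. (S1 x)\<^sup>2 \<partial>M) / 2)) * complex_of_real (exp (- (\<integral>y. (S2 y)\<^sup>2 \<partial>N) / 2))"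
      unfolding S1_def S2_def using gaussian_familyD(5)[OF V] gaussian_familyD(5)[OF W] fin by simp
    also have "\<dots> = complex_of_real (exp (- (\<integral>z. (\<Sum>k\<in>J. a k * U k z)\<^sup>2 \<partial>(M \<Otimes>\<^sub>M N)) / 2))"
      unfolding sq by (simp add: exp_add[symmetric] of_real_mult[symmetric] add_divide_distrib del: of_real_mult)
    finally show "(CLINT z|M \<Otimes>\<^sub>M N. iexp (\<Sum>k\<in>J. a k * U k z)) =
      complex_of_real (exp (- (\<integral>z. (\<Sum>k\<in>J. a k * U k z)\<^sup>2 \<partial>(M \<Otimes>\<^sub>M N)) / 2))" .
  qed
qed

text \<open>
  A centred Gaussian law is determined by its second moments. This is how every identity in law below
  is obtained: rotation invariance, stability under sums, independence of uncorrelated parts, and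
  stationarity.
\<close>

lemma gaussian_family_law_eq:
  fixes V :: "'i \<Rightarrow> 'a \<Rightarrow> real" and W :: "'i \<Rightarrow> 'b \<Rightarrow> real"
  assumes V: "gaussian_family M V" and W: "gaussian_family N W"
    and cov: "\<And>i j. (\<integral>\<omega>. V i \<omega> * V j \<omega> \<partial>M) = (\<integral>\<omega>. W i \<omega> * W j \<omega> \<partial>N)"
  shows "distr M path_space (\<lambda>\<omega> i. V i \<omega>) = distr N path_space (\<lambda>\<omega> i. W i \<omega>)"
proof (rule measure_eqI_PiM_infinite)
  interpret M: prob_space M by (rule gaussian_familyD[OF V])
  interpret N: prob_space N by (rule gaussian_familyD[OF W])
  note [measurable] = gaussian_familyD(2)[OF V] gaussian_familyD(2)[OF W]
  have [measurable]: "(\<lambda>\<omega> i. V i \<omega>) \<in> M \<rightarrow>\<^sub>M path_space" "(\<lambda>\<omega> i. W i \<omega>) \<in> N \<rightarrow>\<^sub>M path_space"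
    by (auto intro!: measurable_path_map)
  show "finite_measure (distr M path_space (\<lambda>\<omega> i. V i \<omega>))"
    by (intro prob_space.finite_measure M.prob_space_distr) measurable
  fix A :: "'i \<Rightarrow> real set" and J :: "'i set"
  assume J: "finite J" and A: "\<And>i. i \<in> J \<Longrightarrow> A i \<in> sets borel"
  define B where "B i = (if i \<in> J then A i else UNIV)" for i
  have [measurable]: "B i \<in> sets borel" for i using A by (auto simp: B_def)
  have emb: "prod_emb UNIV (\<lambda>_. borel) J (Pi\<^sub>E J A) = {x. \<forall>i\<in>J. x i \<in> B i}"
    by (auto simp: prod_emb_def B_def PiE_iff)
  have sets: "prod_emb UNIV (\<lambda>_. borel) J (Pi\<^sub>E J A) \<in> sets path_space"
    using J A by (intro sets_PiM_I) auto
  have "measure M {\<omega>\<in>space M. \<forall>j\<in>J. V j \<omega> \<in> B j} = measure N {\<omega>\<in>space N. \<forall>j\<in>J. W j \<omega> \<in> B j}"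
  proof (rule joint_char_unique[OF J])
    fix a
    have "(\<integral>\<omega>. (\<Sum>j\<in>J. a j * V j \<omega>)\<^sup>2 \<partial>M) = (\<integral>\<omega>. (\<Sum>j\<in>J. a j * W j \<omega>)\<^sup>2 \<partial>N)"
      unfolding power2_eq_square gaussian_family_bilinear[OF V] gaussian_family_bilinear[OF W] cov ..
    then show "(CLINT \<omega>|M. iexp (\<Sum>j\<in>J. a j * V j \<omega>)) = (CLINT \<omega>|N. iexp (\<Sum>j\<in>J. a j * W j \<omega>))"
      using gaussian_familyD(5)[OF V J, of a] gaussian_familyD(5)[OF W J, of a] by simp
  qed (auto intro: M.finite_measure_axioms N.finite_measure_axioms)
  then show "emeasure (distr M path_space (\<lambda>\<omega> i. V i \<omega>)) (prod_emb UNIV (\<lambda>_. borel) J (Pi\<^sub>E J A))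
     = emeasure (distr N path_space (\<lambda>\<omega> i. W i \<omega>)) (prod_emb UNIV (\<lambda>_. borel) J (Pi\<^sub>E J A))"
    using sets unfolding emb
    by (simp add: emeasure_distr M.emeasure_eq_measure N.emeasure_eq_measure vimage_def Int_def conj_commute)
qed auto

lemma gaussian_family_integral_eq:
  fixes V :: "'i \<Rightarrow> 'a \<Rightarrow> real" and W :: "'i \<Rightarrow> 'b \<Rightarrow> real"
    and F :: "('i \<Rightarrow> real) \<Rightarrow> real"
  assumes "gaussian_family M V" "gaussian_family N W"
    and "\<And>i j. (\<integral>\<omega>. V i \<omega> * V j \<omega> \<partial>M) = (\<integral>\<omega>. W i \<omega> * W j \<omega> \<partial>N)"
    and "F \<in> borel_measurable path_space"
  shows "(\<integral>\<omega>. F (\<lambda>i. V i \<omega>) \<partial>M) = (\<integral>\<omega>. F (\<lambda>i. W i \<omega>) \<partial>N)"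
proof -
  have "(\<integral>\<omega>. F (\<lambda>i. V i \<omega>) \<partial>M) = (\<integral>x. F x \<partial>distr M path_space (\<lambda>\<omega> i. V i \<omega>))"
    using assms(4) by (intro integral_distr[symmetric] measurable_path_map gaussian_familyD(2)[OF assms(1)])
  also have "\<dots> = (\<integral>x. F x \<partial>distr N path_space (\<lambda>\<omega> i. W i \<omega>))"
    by (subst gaussian_family_law_eq[OF assms(1-3)]) rule
  also have "\<dots> = (\<integral>\<omega>. F (\<lambda>i. W i \<omega>) \<partial>N)"
    using assms(4) by (intro integral_distr measurable_path_map gaussian_familyD(2)[OF assms(2)])
  finally show ?thesis .
qed

lemma gaussian_family_prob_eq:
  fixes V :: "'i \<Rightarrow> 'a \<Rightarrow> real" and W :: "'i \<Rightarrow> 'b \<Rightarrow> real"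
  assumes V: "gaussian_family M V" and W: "gaussian_family N W"
    and "\<And>i j. (\<integral>\<omega>. V i \<omega> * V j \<omega> \<partial>M) = (\<integral>\<omega>. W i \<omega> * W j \<omega> \<partial>N)"
    and Q: "Measurable.pred path_space Q"
  shows "measure M {\<omega>\<in>space M. Q (\<lambda>i. V i \<omega>)} = measure N {\<omega>\<in>space N. Q (\<lambda>i. W i \<omega>)}"
proof -
  have Q': "{x. Q x} \<in> sets path_space" using Q by (simp add: pred_def)
  have "measure M {\<omega>\<in>space M. Q (\<lambda>i. V i \<omega>)} = measure (distr M path_space (\<lambda>\<omega> i. V i \<omega>)) {x. Q x}"
    using Q' gaussian_familyD(2)[OF V]
    by (subst measure_distr) (auto simp: measurable_path_map vimage_def Int_def conj_commute)
  also have "\<dots> = measure (distr N path_space (\<lambda>\<omega> i. W i \<omega>)) {x. Q x}"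
    by (subst gaussian_family_law_eq[OF assms(1-3)]) rule
  also have "\<dots> = measure N {\<omega>\<in>space N. Q (\<lambda>i. W i \<omega>)}"
    using Q' gaussian_familyD(2)[OF W]
    by (subst measure_distr) (auto simp: measurable_path_map vimage_def Int_def conj_commute)
  finally show ?thesis .
qed

lemma gaussian_family_std_normal:
  assumes V: "gaussian_family M V" and one: "(\<integral>\<omega>. (V i \<omega>)\<^sup>2 \<partial>M) = 1"
  shows "distr M borel (V i) = std_normal_distribution"
proof (rule Levy_uniqueness)
  interpret M: prob_space M by (rule gaussian_familyD[OF V])
  note [measurable] = gaussian_familyD(2)[OF V]
  show "real_distribution (distr M borel (V i))"
    by (rule M.real_distribution_distr) measurable
  show "real_distribution std_normal_distribution" by (rule real_dist_normal_dist)
  show "char (distr M borel (V i)) = char std_normal_distribution"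
  proof
    fix t
    have "char (distr M borel (V i)) t = (CLINT \<omega>|M. iexp (\<Sum>j\<in>{i}. t * V j \<omega>))"
      unfolding char_def by (subst integral_distr) auto
    also have "\<dots> = complex_of_real (exp (- (t\<^sup>2) / 2))"
      using one by (subst gaussian_familyD(5)[OF V]) (auto simp: power_mult_distrib)
    finally show "char (distr M borel (V i)) t = char std_normal_distribution t"
      by (simp add: char_std_normal_distribution)
  qed
qed

section \<open>Association of non-negatively correlated Gaussian variables\<close>

text \<open>
  Test functions of finitely many coordinates that are decreasing with a quantitative first order
  expansion: \<open>- l j\<close> is the partial derivative in direction \<open>j\<close>, and \<open>c\<close> bounds the derivatives, the
  Lipschitz constant and the quadratic remainder. Carrying \<open>l\<close> and \<open>c\<close> explicitly makes the class
  closed under averaging with the same constant.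
\<close>

definition smooth_decreasing ::
  "'i set \<Rightarrow> real \<Rightarrow> (('i \<Rightarrow> real) \<Rightarrow> real) \<Rightarrow> ('i \<Rightarrow> ('i \<Rightarrow> real) \<Rightarrow> real) \<Rightarrow> bool" where
  "smooth_decreasing J c f l \<longleftrightarrow>
     f \<in> borel_measurable path_space \<and> (\<forall>j. l j \<in> borel_measurable path_space) \<and>
     (\<forall>x. 0 \<le> f x \<and> f x \<le> 1) \<and> (\<forall>j\<in>J. \<forall>x. 0 \<le> l j x \<and> l j x \<le> c) \<and>
     (\<forall>x y. \<bar>f (\<lambda>i. x i + y i) - f x\<bar> \<le> c * (\<Sum>j\<in>J. \<bar>y j\<bar>)) \<and>
     (\<forall>x y. \<bar>f (\<lambda>i. x i + y i) - f x + (\<Sum>j\<in>J. l j x * y j)\<bar> \<le> c * (\<Sum>j\<in>J. \<bar>y j\<bar>)\<^sup>2)"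

lemma smooth_decreasingD:
  assumes "smooth_decreasing J c f l"
  shows "f \<in> borel_measurable path_space" "l j \<in> borel_measurable path_space"
    "0 \<le> f x" "f x \<le> 1" "j \<in> J \<Longrightarrow> 0 \<le> l j x" "j \<in> J \<Longrightarrow> l j x \<le> c"
    "\<bar>f (\<lambda>i. x i + y i) - f x\<bar> \<le> c * (\<Sum>j\<in>J. \<bar>y j\<bar>)"
    "\<bar>f (\<lambda>i. x i + y i) - f x + (\<Sum>j\<in>J. l j x * y j)\<bar> \<le> c * (\<Sum>j\<in>J. \<bar>y j\<bar>)\<^sup>2"
  using assms unfolding smooth_decreasing_def by auto

lemma measurable_path_add:
  assumes [measurable]: "\<And>i. V i \<in> borel_measurable M"
  shows "(\<lambda>z i. fst z i + V i (snd z)) \<in> path_space \<Otimes>\<^sub>M M \<rightarrow>\<^sub>M path_space"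
  by (rule measurable_path_map) measurable

lemma smooth_decreasing_translate:
  assumes sd: "smooth_decreasing J c f l"
  shows "smooth_decreasing J c (\<lambda>x. f (\<lambda>i. a i + x i)) (\<lambda>j x. l j (\<lambda>i. a i + x i))"
proof -
  have m: "(\<lambda>x i. a i + x i) \<in> path_space \<rightarrow>\<^sub>M path_space"
    by (rule measurable_path_map) measurable
  show ?thesis
    unfolding smooth_decreasing_def
    using smooth_decreasingD[OF sd] smooth_decreasingD(7,8)[OF sd, of "\<lambda>i. a i + x i" for x]
    by (auto intro!: measurable_compose[OF m] simp: add.assoc[symmetric])
qed

lemma smooth_decreasing_average:
  assumes sd: "smooth_decreasing J c f l" and "prob_space M" and V: "\<And>i. V i \<in> borel_measurable M"
    and J: "finite J"
  shows "smooth_decreasing J c (\<lambda>y. \<integral>\<omega>. f (\<lambda>i. y i + V i \<omega>) \<partial>M) (\<lambda>j y. if j \<in> J then \<integral>\<omega>. l j (\<lambda>i. y i + V i \<omega>) \<partial>M else 0)"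
proof -
  interpret prob_space M by fact
  note m2 = measurable_path_add[of V M, OF V]
  have m1: "(\<lambda>\<omega> i. y i + V i \<omega>) \<in> M \<rightarrow>\<^sub>M path_space" for y :: "'a \<Rightarrow> real"
    using V by (intro measurable_path_map) measurable
  have fi: "integrable M (\<lambda>\<omega>. f (\<lambda>i. y i + V i \<omega>))" for y
    using smooth_decreasingD(3,4)[OF sd]
    by (intro integrable_const_bound[of _ 1] measurable_compose[OF m1] smooth_decreasingD(1)[OF sd]) auto
  have li: "integrable M (\<lambda>\<omega>. l j (\<lambda>i. y i + V i \<omega>))" if "j \<in> J" for y j
    using smooth_decreasingD(5,6)[OF sd that]
    by (intro integrable_const_bound[of _ c] measurable_compose[OF m1] smooth_decreasingD(2)[OF sd]) auto
  have comm: "(\<lambda>i. x i + y i + V i \<omega>) = (\<lambda>i. (x i + V i \<omega>) + y i)" for x y \<omega>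
    by (auto simp: add_ac)
  have meas: "(\<lambda>y. \<integral>\<omega>. F (\<lambda>i. y i + V i \<omega>) \<partial>M) \<in> borel_measurable path_space"
    if "F \<in> borel_measurable path_space" for F :: "('a \<Rightarrow> real) \<Rightarrow> real"
    using measurable_compose[OF m2 that] by (intro borel_measurable_lebesgue_integral) (simp add: split_beta')
  show ?thesis
    unfolding smooth_decreasing_def
  proof (intro conjI allI ballI)
    show "(\<lambda>y. \<integral>\<omega>. f (\<lambda>i. y i + V i \<omega>) \<partial>M) \<in> borel_measurable path_space"
      by (rule meas[OF smooth_decreasingD(1)[OF sd]])
    show "(\<lambda>y. if j \<in> J then \<integral>\<omega>. l j (\<lambda>i. y i + V i \<omega>) \<partial>M else 0) \<in> borel_measurable path_space" for j
      using meas[OF smooth_decreasingD(2)[OF sd]] by (cases "j \<in> J") auto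
    fix x :: "'a \<Rightarrow> real"
    show "0 \<le> (\<integral>\<omega>. f (\<lambda>i. x i + V i \<omega>) \<partial>M)"
      by (intro integral_nonneg_AE AE_I2 smooth_decreasingD(3)[OF sd])
    show "(\<integral>\<omega>. f (\<lambda>i. x i + V i \<omega>) \<partial>M) \<le> 1"
      by (intro integral_le_const fi AE_I2 smooth_decreasingD(4)[OF sd])
    show "0 \<le> (if j \<in> J then \<integral>\<omega>. l j (\<lambda>i. x i + V i \<omega>) \<partial>M else 0)"
         "(if j \<in> J then \<integral>\<omega>. l j (\<lambda>i. x i + V i \<omega>) \<partial>M else 0) \<le> c" if "j \<in> J" for j
      using that by (auto intro!: integral_nonneg_AE integral_le_const li AE_I2 smooth_decreasingD(5,6)[OF sd])
    fix y :: "'a \<Rightarrow> real"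
    have "\<bar>(\<integral>\<omega>. f (\<lambda>i. x i + y i + V i \<omega>) \<partial>M) - (\<integral>\<omega>. f (\<lambda>i. x i + V i \<omega>) \<partial>M)\<bar>
      = \<bar>\<integral>\<omega>. f (\<lambda>i. (x i + V i \<omega>) + y i) - f (\<lambda>i. x i + V i \<omega>) \<partial>M\<bar>"
      using fi[of "\<lambda>i. x i + y i"] fi[of x] unfolding comm by simp
    also have "\<dots> \<le> (\<integral>\<omega>. \<bar>f (\<lambda>i. (x i + V i \<omega>) + y i) - f (\<lambda>i. x i + V i \<omega>)\<bar> \<partial>M)"
      by (rule integral_abs_bound)
    also have "\<dots> \<le> c * (\<Sum>j\<in>J. \<bar>y j\<bar>)"
      using fi[of "\<lambda>i. x i + y i"] fi[of x] unfolding comm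
      by (intro integral_le_const AE_I2 smooth_decreasingD(7)[OF sd]) auto
    finally show "\<bar>(\<integral>\<omega>. f (\<lambda>i. x i + y i + V i \<omega>) \<partial>M) - (\<integral>\<omega>. f (\<lambda>i. x i + V i \<omega>) \<partial>M)\<bar>
       \<le> c * (\<Sum>j\<in>J. \<bar>y j\<bar>)" .
    have *: "(\<Sum>j\<in>J. (if j \<in> J then \<integral>\<omega>. l j (\<lambda>i. x i + V i \<omega>) \<partial>M else 0) * y j)
       = (\<integral>\<omega>. (\<Sum>j\<in>J. l j (\<lambda>i. x i + V i \<omega>) * y j) \<partial>M)"
      using li by (subst Bochner_Integration.integral_sum) (auto intro!: sum.cong)
    have "\<bar>(\<integral>\<omega>. f (\<lambda>i. x i + y i + V i \<omega>) \<partial>M) - (\<integral>\<omega>. f (\<lambda>i. x i + V i \<omega>) \<partial>M)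
        + (\<Sum>j\<in>J. (if j \<in> J then \<integral>\<omega>. l j (\<lambda>i. x i + V i \<omega>) \<partial>M else 0) * y j)\<bar>
      = \<bar>\<integral>\<omega>. f (\<lambda>i. (x i + V i \<omega>) + y i) - f (\<lambda>i. x i + V i \<omega>) + (\<Sum>j\<in>J. l j (\<lambda>i. x i + V i \<omega>) * y j) \<partial>M\<bar>"
      using fi[of "\<lambda>i. x i + y i"] fi[of x] li unfolding comm * by simp
    also have "\<dots> \<le> (\<integral>\<omega>. \<bar>f (\<lambda>i. (x i + V i \<omega>) + y i) - f (\<lambda>i. x i + V i \<omega>) + (\<Sum>j\<in>J. l j (\<lambda>i. x i + V i \<omega>) * y j)\<bar> \<partial>M)"
      by (rule integral_abs_bound)
    also have "\<dots> \<le> c * (\<Sum>j\<in>J. \<bar>y j\<bar>)\<^sup>2"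
      using fi[of "\<lambda>i. x i + y i"] fi[of x] li unfolding comm
      by (intro integral_le_const AE_I2 smooth_decreasingD(8)[OF sd]) auto
    finally show "\<bar>(\<integral>\<omega>. f (\<lambda>i. x i + y i + V i \<omega>) \<partial>M) - (\<integral>\<omega>. f (\<lambda>i. x i + V i \<omega>) \<partial>M)
        + (\<Sum>j\<in>J. (if j \<in> J then \<integral>\<omega>. l j (\<lambda>i. x i + V i \<omega>) \<partial>M else 0) * y j)\<bar>
       \<le> c * (\<Sum>j\<in>J. \<bar>y j\<bar>)\<^sup>2" .
  qed
qed

lemma gaussian_family_integrable_cube:
  assumes V: "gaussian_family M V"
  shows "integrable M (\<lambda>\<omega>. \<bar>V i \<omega>\<bar> ^ 3)"
proof -
  interpret prob_space M by (rule gaussian_familyD[OF V])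
  note [measurable] = gaussian_familyD(2)[OF V]
  define v where "v = (\<integral>\<omega>. (V i \<omega>)\<^sup>2 \<partial>M)"
  have v0: "v \<ge> 0" by (simp add: v_def)
  show ?thesis
  proof (cases "v = 0")
    case True
    then have "AE \<omega> in M. V i \<omega> = 0"
      using integral_nonneg_eq_0_iff_AE[of M "\<lambda>\<omega>. (V i \<omega>)\<^sup>2"] gaussian_familyD(3)[OF V, of i] by (simp add: v_def)
    then have "integrable M (\<lambda>\<omega>. \<bar>V i \<omega>\<bar> ^ 3) \<longleftrightarrow> integrable M (\<lambda>\<omega>. 0::real)"
      by (intro integrable_cong_AE) auto
    then show ?thesis by simp
  next
    case False
    then have v: "v > 0" using v0 by simp
    define W where "W = (\<lambda>(_::unit) \<omega>. \<Sum>j\<in>{i}. (1 / sqrt v) * V j \<omega>)"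
    have W: "gaussian_family M W"
      unfolding W_def by (rule gaussian_family_linear[OF V]) auto
    have "(\<integral>\<omega>. (W () \<omega>)\<^sup>2 \<partial>M) = 1"
      using v by (simp add: W_def power_divide v_def[symmetric])
    then have d: "distr M borel (W ()) = std_normal_distribution"
      by (rule gaussian_family_std_normal[OF W])
    have "integrable std_normal_distribution (\<lambda>x. \<bar>x\<bar> ^ 3)"
      by (auto simp: normal_density_nonneg integrable_std_normal_moment_abs integrable_density)
    then have "integrable M (\<lambda>\<omega>. \<bar>W () \<omega>\<bar> ^ 3)"
      unfolding d[symmetric] by (subst (asm) integrable_distr_eq) (auto simp: gaussian_familyD[OF W])
    then have "integrable M (\<lambda>\<omega>. sqrt v ^ 3 * \<bar>W () \<omega>\<bar> ^ 3)" by simp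
    moreover have "sqrt v ^ 3 * \<bar>W () \<omega>\<bar> ^ 3 = \<bar>V i \<omega>\<bar> ^ 3" for \<omega>
      using v by (simp add: W_def abs_mult power_divide)
    ultimately show ?thesis by simp
  qed
qed

lemma sum_cube_le:
  fixes a :: "'i \<Rightarrow> real"
  assumes "finite J" "\<And>j. a j \<ge> 0"
  shows "(\<Sum>j\<in>J. a j) ^ 3 \<le> card J ^ 3 * (\<Sum>j\<in>J. a j ^ 3)"
proof (cases "J = {}")
  case False
  define m where "m = Max (a ` J)"
  have mJ: "m \<in> a ` J" unfolding m_def using assms False by (intro Max_in) auto
  have "(\<Sum>j\<in>J. a j) \<le> card J * m"
    using sum_bounded_above[of J a m] assms by (simp add: m_def)
  then have "(\<Sum>j\<in>J. a j) ^ 3 \<le> (card J * m) ^ 3"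
    using assms by (intro power_mono sum_nonneg) auto
  also have "\<dots> = card J ^ 3 * m ^ 3" by (simp add: power_mult_distrib)
  also have "m ^ 3 \<le> (\<Sum>j\<in>J. a j ^ 3)"
    using mJ assms by (auto intro!: member_le_sum)
  finally show ?thesis by (simp add: mult_left_mono)
qed simp

text \<open>
  For small noise \<open>h * X\<close>, the covariance of two decreasing functions is \<open>h\<^sup>2\<close> times a combination of
  covariances of \<open>X\<close> with non-negative coefficients, up to an error of order \<open>h\<^sup>3\<close>. The constant is
  uniform over the class of test functions.
\<close>

lemma covariance_step:
  assumes X: "gaussian_family M X" and J: "finite J"
    and cov: "\<And>i j. i \<in> J \<Longrightarrow> j \<in> J \<Longrightarrow> (\<integral>\<omega>. X i \<omega> * X j \<omega> \<partial>M) \<ge> 0"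
    and c: "c \<ge> 0"
  shows "\<exists>\<kappa>. \<forall>f l g k h. smooth_decreasing J c f l \<longrightarrow> smooth_decreasing J c g k \<longrightarrow> 0 \<le> h \<longrightarrow> h \<le> 1 \<longrightarrow>
     (\<integral>\<omega>. f (\<lambda>i. h * X i \<omega>) * g (\<lambda>i. h * X i \<omega>) \<partial>M) \<ge>
     (\<integral>\<omega>. f (\<lambda>i. h * X i \<omega>) \<partial>M) * (\<integral>\<omega>. g (\<lambda>i. h * X i \<omega>) \<partial>M) - \<kappa> * h ^ 3"
proof -
  interpret prob_space M by (rule gaussian_familyD[OF X])
  note [measurable] = gaussian_familyD(2)[OF X]
  define s where "s \<omega> = (\<Sum>j\<in>J. \<bar>X j \<omega>\<bar>)" for \<omega>
  have [measurable]: "s \<in> borel_measurable M" unfolding s_def by measurable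
  have s0: "s \<omega> \<ge> 0" for \<omega> unfolding s_def by (intro sum_nonneg) auto
  have s2: "integrable M (\<lambda>\<omega>. (s \<omega>)\<^sup>2)"
  proof -
    have "(s \<omega>)\<^sup>2 = (\<Sum>i\<in>J. \<Sum>j\<in>J. \<bar>X i \<omega> * X j \<omega>\<bar>)" for \<omega>
      by (simp add: s_def power2_eq_square sum_product abs_mult)
    then show ?thesis by (simp add: gaussian_family_integrable_mult[OF X])
  qed
  have s3: "integrable M (\<lambda>\<omega>. s \<omega> ^ 3)"
  proof (rule Bochner_Integration.integrable_bound)
    show "integrable M (\<lambda>\<omega>. card J ^ 3 * (\<Sum>j\<in>J. \<bar>X j \<omega>\<bar> ^ 3))"
      by (simp add: gaussian_family_integrable_cube[OF X])
    show "AE \<omega> in M. norm (s \<omega> ^ 3) \<le> norm (card J ^ 3 * (\<Sum>j\<in>J. \<bar>X j \<omega>\<bar> ^ 3))"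
      using sum_cube_le[OF J, of "\<lambda>j. \<bar>X j \<omega>\<bar>" for \<omega>] s0
      by (intro AE_I2) (auto simp: s_def[symmetric] abs_mult sum_nonneg)
  qed auto
  define A where "A = (\<integral>\<omega>. (s \<omega>)\<^sup>2 \<partial>M)"
  define B where "B = (\<integral>\<omega>. s \<omega> ^ 3 \<partial>M)"
  have A0: "A \<ge> 0" by (simp add: A_def)
  show ?thesis
  proof (rule exI[of _ "2 * c\<^sup>2 * B + c\<^sup>2 * A\<^sup>2"], intro allI impI)
    fix f l g k and h :: real
    assume f: "smooth_decreasing J c f l" and g: "smooth_decreasing J c g k" and h: "0 \<le> h" "h \<le> 1"
    define F where "F \<omega> = f (\<lambda>i. h * X i \<omega>)" for \<omega>
    define G where "G \<omega> = g (\<lambda>i. h * X i \<omega>)" for \<omega>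
    define F0 where "F0 = f (\<lambda>_. 0)"
    define G0 where "G0 = g (\<lambda>_. 0)"
    define F1 where "F1 \<omega> = (\<Sum>j\<in>J. l j (\<lambda>_. 0) * X j \<omega>)" for \<omega>
    define G1 where "G1 \<omega> = (\<Sum>j\<in>J. k j (\<lambda>_. 0) * X j \<omega>)" for \<omega>
    have mX: "(\<lambda>\<omega> i. h * X i \<omega>) \<in> M \<rightarrow>\<^sub>M path_space"
      by (rule measurable_path_map) measurable
    have [measurable]: "F \<in> borel_measurable M" "G \<in> borel_measurable M"
      unfolding F_def G_def
      by (rule measurable_compose[OF mX smooth_decreasingD(1)[OF f]] measurable_compose[OF mX smooth_decreasingD(1)[OF g]])+
    have Fb: "0 \<le> F \<omega>" "F \<omega> \<le> 1" "0 \<le> G \<omega>" "G \<omega> \<le> 1" for \<omega>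
      unfolding F_def G_def using smooth_decreasingD(3,4)[OF f] smooth_decreasingD(3,4)[OF g] by auto
    have iF: "integrable M F" and iG: "integrable M G"
      using Fb by (auto intro!: integrable_const_bound[of _ 1])
    have iFG: "integrable M (\<lambda>\<omega>. F \<omega> * G \<omega>)"
      using Fb by (intro integrable_const_bound[of _ 1]) (auto simp: abs_mult intro!: mult_le_one)
    have iF1: "integrable M F1" "(\<integral>\<omega>. F1 \<omega> \<partial>M) = 0" and iG1: "integrable M G1" "(\<integral>\<omega>. G1 \<omega> \<partial>M) = 0"
      unfolding F1_def G1_def by (simp_all add: gaussian_family_integrable[OF X] gaussian_familyD[OF X])
    have hs: "(\<Sum>j\<in>J. \<bar>h * X j \<omega>\<bar>) = h * s \<omega>" for \<omega>
      using h by (simp add: s_def abs_mult sum_distrib_left)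
    have RF: "\<bar>F \<omega> - F0 + h * F1 \<omega>\<bar> \<le> c * (h * s \<omega>)\<^sup>2" and RG: "\<bar>G \<omega> - G0 + h * G1 \<omega>\<bar> \<le> c * (h * s \<omega>)\<^sup>2" for \<omega>
      using smooth_decreasingD(8)[OF f, of "\<lambda>_. 0" "\<lambda>i. h * X i \<omega>"] smooth_decreasingD(8)[OF g, of "\<lambda>_. 0" "\<lambda>i. h * X i \<omega>"]
      unfolding hs by (simp_all add: F_def F0_def F1_def G_def G0_def G1_def sum_distrib_left mult_ac)
    have LG: "\<bar>G \<omega> - G0\<bar> \<le> c * (h * s \<omega>)" for \<omega>
      using smooth_decreasingD(7)[OF g, of "\<lambda>_. 0" "\<lambda>i. h * X i \<omega>"]
      unfolding hs by (simp add: G_def G0_def)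
    have F1b: "\<bar>F1 \<omega>\<bar> \<le> c * s \<omega>" for \<omega>
    proof -
      have "\<bar>F1 \<omega>\<bar> \<le> (\<Sum>j\<in>J. \<bar>l j (\<lambda>_. 0) * X j \<omega>\<bar>)" unfolding F1_def by (rule sum_abs)
      also have "\<dots> \<le> (\<Sum>j\<in>J. c * \<bar>X j \<omega>\<bar>)"
        using smooth_decreasingD(5,6)[OF f] by (intro sum_mono) (auto simp: abs_mult intro!: mult_right_mono)
      finally show ?thesis by (simp add: s_def sum_distrib_left)
    qed
    have iF1G1: "integrable M (\<lambda>\<omega>. F1 \<omega> * G1 \<omega>)"
      unfolding F1_def G1_def
      by (intro integrable_mult_of_squares gaussian_family_square_integrable_sum[OF X]) measurable
    have pos: "(\<integral>\<omega>. F1 \<omega> * G1 \<omega> \<partial>M) \<ge> 0"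
      unfolding F1_def G1_def gaussian_family_bilinear[OF X]
      using cov smooth_decreasingD(5)[OF f] smooth_decreasingD(5)[OF g]
      by (intro sum_nonneg mult_nonneg_nonneg) auto
    have pt: "(F \<omega> - F0) * (G \<omega> - G0) \<ge> h\<^sup>2 * (F1 \<omega> * G1 \<omega>) - 2 * c\<^sup>2 * h ^ 3 * s \<omega> ^ 3" for \<omega>
    proof -
      define R where "R = F \<omega> - F0 + h * F1 \<omega>"
      define R' where "R' = G \<omega> - G0 + h * G1 \<omega>"
      have "(F \<omega> - F0) * (G \<omega> - G0) = h\<^sup>2 * (F1 \<omega> * G1 \<omega>) + (R * (G \<omega> - G0) - h * F1 \<omega> * R')"
        by (simp add: R_def R'_def algebra_simps power2_eq_square)
      moreover have "\<bar>R * (G \<omega> - G0)\<bar> \<le> (c * (h * s \<omega>)\<^sup>2) * (c * (h * s \<omega>))"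
        unfolding abs_mult R_def using c h s0 by (intro mult_mono RF LG) auto
      moreover have "\<bar>h * F1 \<omega> * R'\<bar> \<le> (h * (c * s \<omega>)) * (c * (h * s \<omega>)\<^sup>2)"
        unfolding abs_mult R'_def using c h s0 F1b by (intro mult_mono RG) auto
      moreover have "(c * (h * s \<omega>)\<^sup>2) * (c * (h * s \<omega>)) = c\<^sup>2 * h ^ 3 * s \<omega> ^ 3"
        "(h * (c * s \<omega>)) * (c * (h * s \<omega>)\<^sup>2) = c\<^sup>2 * h ^ 3 * s \<omega> ^ 3"
        by (simp_all add: power2_eq_square power3_eq_cube)
      ultimately show ?thesis by linarith
    qed
    have iprod: "integrable M (\<lambda>\<omega>. (F \<omega> - F0) * (G \<omega> - G0))"
      unfolding left_diff_distrib right_diff_distrib using iF iG iFG by simp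
    have "(\<integral>\<omega>. (F \<omega> - F0) * (G \<omega> - G0) \<partial>M) \<ge> (\<integral>\<omega>. h\<^sup>2 * (F1 \<omega> * G1 \<omega>) - 2 * c\<^sup>2 * h ^ 3 * s \<omega> ^ 3 \<partial>M)"
      using iF1G1 s3 iprod pt by (intro integral_mono) auto
    also have "(\<integral>\<omega>. h\<^sup>2 * (F1 \<omega> * G1 \<omega>) - 2 * c\<^sup>2 * h ^ 3 * s \<omega> ^ 3 \<partial>M) = h\<^sup>2 * (\<integral>\<omega>. F1 \<omega> * G1 \<omega> \<partial>M) - 2 * c\<^sup>2 * h ^ 3 * B"
      using iF1G1 s3 by (simp add: B_def)
    also have "\<dots> \<ge> - (2 * c\<^sup>2 * h ^ 3 * B)" using pos by simp
    finally have main: "(\<integral>\<omega>. (F \<omega> - F0) * (G \<omega> - G0) \<partial>M) \<ge> - (2 * c\<^sup>2 * h ^ 3 * B)" by simp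
    have mean: "\<bar>(\<integral>\<omega>. P \<omega> \<partial>M) - P0\<bar> \<le> c * h\<^sup>2 * A"
      if "integrable M P" "integrable M P1" "(\<integral>\<omega>. P1 \<omega> \<partial>M) = 0" "\<And>\<omega>. \<bar>P \<omega> - P0 + h * P1 \<omega>\<bar> \<le> c * (h * s \<omega>)\<^sup>2"
      for P P1 and P0 :: real
    proof -
      have "(\<integral>\<omega>. P \<omega> \<partial>M) - P0 = (\<integral>\<omega>. P \<omega> - P0 + h * P1 \<omega> \<partial>M)"
        using that(1-3) by (simp add: prob_space)
      also have "\<bar>\<dots>\<bar> \<le> (\<integral>\<omega>. \<bar>P \<omega> - P0 + h * P1 \<omega>\<bar> \<partial>M)" by (rule integral_abs_bound)
      also have "\<dots> \<le> (\<integral>\<omega>. c * h\<^sup>2 * (s \<omega>)\<^sup>2 \<partial>M)"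
        using that s2 by (intro integral_mono) (auto simp: power_mult_distrib mult.assoc)
      finally show ?thesis by (simp add: A_def)
    qed
    have "\<bar>((\<integral>\<omega>. F \<omega> \<partial>M) - F0) * ((\<integral>\<omega>. G \<omega> \<partial>M) - G0)\<bar> \<le> (c * h\<^sup>2 * A) * (c * h\<^sup>2 * A)"
      unfolding abs_mult using c A0
      by (intro mult_mono mean[of F F1] mean[of G G1] iF iG iF1 iG1 RF RG) auto
    also have "\<dots> = c\<^sup>2 * A\<^sup>2 * h ^ 3 * h" by (simp add: power2_eq_square power3_eq_cube)
    also have "\<dots> \<le> c\<^sup>2 * A\<^sup>2 * h ^ 3 * 1" using h by (intro mult_left_mono) auto
    finally have mm: "((\<integral>\<omega>. F \<omega> \<partial>M) - F0) * ((\<integral>\<omega>. G \<omega> \<partial>M) - G0) \<le> c\<^sup>2 * A\<^sup>2 * h ^ 3" by linarith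
    have "(\<integral>\<omega>. (F \<omega> - F0) * (G \<omega> - G0) \<partial>M) = (\<integral>\<omega>. F \<omega> * G \<omega> \<partial>M) - F0 * (\<integral>\<omega>. G \<omega> \<partial>M) - (\<integral>\<omega>. F \<omega> \<partial>M) * G0 + F0 * G0"
      unfolding left_diff_distrib right_diff_distrib using iF iG iFG by (simp add: prob_space)
    then have "(\<integral>\<omega>. F \<omega> * G \<omega> \<partial>M) - (\<integral>\<omega>. F \<omega> \<partial>M) * (\<integral>\<omega>. G \<omega> \<partial>M)
        = (\<integral>\<omega>. (F \<omega> - F0) * (G \<omega> - G0) \<partial>M) - ((\<integral>\<omega>. F \<omega> \<partial>M) - F0) * ((\<integral>\<omega>. G \<omega> \<partial>M) - G0)"
      by (simp add: algebra_simps)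
    also have "\<dots> \<ge> - (2 * c\<^sup>2 * h ^ 3 * B) - c\<^sup>2 * A\<^sup>2 * h ^ 3" using main mm by linarith
    finally show "(\<integral>\<omega>. f (\<lambda>i. h * X i \<omega>) * g (\<lambda>i. h * X i \<omega>) \<partial>M) \<ge>
     (\<integral>\<omega>. f (\<lambda>i. h * X i \<omega>) \<partial>M) * (\<integral>\<omega>. g (\<lambda>i. h * X i \<omega>) \<partial>M) - (2 * c\<^sup>2 * B + c\<^sup>2 * A\<^sup>2) * h ^ 3"
      unfolding F_def G_def by (simp add: algebra_simps)
  qed
qed

text \<open>
  The semigroup property of Gaussian laws.
\<close>

lemma gaussian_family_stable:
  fixes X :: "'i \<Rightarrow> 'a \<Rightarrow> real" and F :: "('i \<Rightarrow> real) \<Rightarrow> real"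
  assumes X: "gaussian_family M X" and F: "F \<in> borel_measurable path_space" and c: "c\<^sup>2 = a\<^sup>2 + b\<^sup>2"
  shows "(\<integral>\<omega>. F (\<lambda>i. c * X i \<omega>) \<partial>M) = (\<integral>z. F (\<lambda>i. a * X i (fst z) + b * X i (snd z)) \<partial>(M \<Otimes>\<^sub>M M))"
proof -
  define U where "U = case_sum (\<lambda>i z. X i (fst z)) (\<lambda>j z. X j (snd z :: 'a))"
  note U = gaussian_family_pair[OF X X, folded U_def]
  define W1 where "W1 i \<omega> = (\<Sum>k\<in>{i}. c * X k \<omega>)" for i \<omega>
  define W2 where "W2 i z = (\<Sum>k\<in>{Inl i, Inr i}. (case k of Inl _ \<Rightarrow> a | Inr _ \<Rightarrow> b) * U k z)" for i z
  have W1: "gaussian_family M W1"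
    unfolding W1_def by (rule gaussian_family_linear[OF X]) auto
  have W2: "gaussian_family (M \<Otimes>\<^sub>M M) W2"
    unfolding W2_def by (rule gaussian_family_linear[OF U(1)]) auto
  have c1: "(\<integral>\<omega>. W1 i \<omega> * W1 j \<omega> \<partial>M) = c\<^sup>2 * (\<integral>\<omega>. X i \<omega> * X j \<omega> \<partial>M)" for i j
    unfolding W1_def gaussian_family_bilinear[OF X] by (simp add: power2_eq_square)
  have c2: "(\<integral>z. W2 i z * W2 j z \<partial>(M \<Otimes>\<^sub>M M)) = (a\<^sup>2 + b\<^sup>2) * (\<integral>\<omega>. X i \<omega> * X j \<omega> \<partial>M)" for i j
    unfolding W2_def gaussian_family_bilinear[OF U(1)]
    by (simp add: U(2,3,4,5) power2_eq_square distrib_right)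
  have "(\<integral>\<omega>. F (\<lambda>i. W1 i \<omega>) \<partial>M) = (\<integral>z. F (\<lambda>i. W2 i z) \<partial>(M \<Otimes>\<^sub>M M))"
    by (rule gaussian_family_integral_eq[OF W1 W2]) (simp_all add: c1 c2 c F)
  then show ?thesis by (simp add: W1_def W2_def U_def)
qed

text \<open>
  A sum of \<open>n\<close> independent copies of \<open>h * X\<close> has the law of \<open>h * sqrt n * X\<close>. Conditioning on one copy
  replaces the test functions by averaged ones from the same class, so that the covariance deficits
  of the single steps add up.
\<close>

lemma covariance_iterate:
  fixes X :: "'i \<Rightarrow> 'a \<Rightarrow> real"
  assumes X: "gaussian_family M X" and J: "finite J"
    and step: "\<And>f l g k. smooth_decreasing J c f l \<Longrightarrow> smooth_decreasing J c g k \<Longrightarrow>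
     (\<integral>\<omega>. f (\<lambda>i. h * X i \<omega>) * g (\<lambda>i. h * X i \<omega>) \<partial>M) \<ge>
     (\<integral>\<omega>. f (\<lambda>i. h * X i \<omega>) \<partial>M) * (\<integral>\<omega>. g (\<lambda>i. h * X i \<omega>) \<partial>M) - e"
    and f: "smooth_decreasing J c f l" and g: "smooth_decreasing J c g k"
  shows "(\<integral>\<omega>. f (\<lambda>i. h * sqrt (real n) * X i \<omega>) * g (\<lambda>i. h * sqrt (real n) * X i \<omega>) \<partial>M) \<ge>
     (\<integral>\<omega>. f (\<lambda>i. h * sqrt (real n) * X i \<omega>) \<partial>M) * (\<integral>\<omega>. g (\<lambda>i. h * sqrt (real n) * X i \<omega>) \<partial>M) - real n * e"
  using f g
proof (induction n arbitrary: f l g k)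
  case 0
  interpret prob_space M by (rule gaussian_familyD[OF X])
  show ?case by (simp add: prob_space)
next
  case (Suc n)
  interpret prob_space M by (rule gaussian_familyD[OF X])
  interpret P: pair_prob_space M M ..
  note [measurable] = gaussian_familyD(2)[OF X]
  note f = Suc.prems(1) and g = Suc.prems(2)
  define r where "r = h * sqrt (real n)"
  have r: "(h * sqrt (real (Suc n)))\<^sup>2 = h\<^sup>2 + r\<^sup>2"
    by (simp add: r_def power_mult_distrib algebra_simps)
  define fa where "fa y = (\<integral>\<omega>. f (\<lambda>i. y i + r * X i \<omega>) \<partial>M)" for y
  define ga where "ga y = (\<integral>\<omega>. g (\<lambda>i. y i + r * X i \<omega>) \<partial>M)" for y
  have rX: "(\<lambda>\<omega>. r * X i \<omega>) \<in> borel_measurable M" for i by measurable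
  have fa: "\<exists>l. smooth_decreasing J c fa l" and ga: "\<exists>l. smooth_decreasing J c ga l"
    using smooth_decreasing_average[where V="\<lambda>i \<omega>. r * X i \<omega>", OF f prob_space_axioms rX J]
      smooth_decreasing_average[where V="\<lambda>i \<omega>. r * X i \<omega>", OF g prob_space_axioms rX J]
    unfolding fa_def ga_def by blast+
  have mp: "(\<lambda>z i. h * X i (fst z) + r * X i (snd z)) \<in> M \<Otimes>\<^sub>M M \<rightarrow>\<^sub>M path_space"
    by (rule measurable_path_map) measurable
  have mh: "(\<lambda>\<omega> i. h * X i \<omega>) \<in> M \<rightarrow>\<^sub>M path_space"
    by (rule measurable_path_map) measurable
  have split: "(\<integral>\<omega>. F (\<lambda>i. h * sqrt (real (Suc n)) * X i \<omega>) \<partial>M)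
      = (\<integral>x. (\<integral>\<omega>. F (\<lambda>i. h * X i x + r * X i \<omega>) \<partial>M) \<partial>M)"
      "integrable M (\<lambda>x. \<integral>\<omega>. F (\<lambda>i. h * X i x + r * X i \<omega>) \<partial>M)"
    if F: "F \<in> borel_measurable path_space" "\<And>x. 0 \<le> F x" "\<And>x. F x \<le> 1" for F :: "('i \<Rightarrow> real) \<Rightarrow> real"
  proof -
    have i: "integrable (M \<Otimes>\<^sub>M M) (\<lambda>z. F (\<lambda>i. h * X i (fst z) + r * X i (snd z)))"
      using F by (intro P.integrable_const_bound[of _ 1] measurable_compose[OF mp]) auto
    show "(\<integral>\<omega>. F (\<lambda>i. h * sqrt (real (Suc n)) * X i \<omega>) \<partial>M)
      = (\<integral>x. (\<integral>\<omega>. F (\<lambda>i. h * X i x + r * X i \<omega>) \<partial>M) \<partial>M)"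
      unfolding gaussian_family_stable[OF X F(1) r] using P.integral_fst'[OF i] by simp
    show "integrable M (\<lambda>x. \<integral>\<omega>. F (\<lambda>i. h * X i x + r * X i \<omega>) \<partial>M)"
      using P.integrable_fst'[OF i] by simp
  qed
  note fD = smooth_decreasingD[OF f] and gD = smooth_decreasingD[OF g]
  have fg: "(\<lambda>x. f x * g x) \<in> borel_measurable path_space" "0 \<le> f x * g x" "f x * g x \<le> 1" for x
    using fD(1,3,4) gD(1,3,4) by (auto intro!: mult_le_one)
  have inner: "fa (\<lambda>i. h * X i x) * ga (\<lambda>i. h * X i x) - real n * e
     \<le> (\<integral>\<omega>. f (\<lambda>i. h * X i x + r * X i \<omega>) * g (\<lambda>i. h * X i x + r * X i \<omega>) \<partial>M)" for x
    using Suc.IH[OF smooth_decreasing_translate[OF f, of "\<lambda>i. h * X i x"] smooth_decreasing_translate[OF g, of "\<lambda>i. h * X i x"]]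
    by (simp add: fa_def ga_def r_def)
  obtain fl gl where fl: "smooth_decreasing J c fa fl" and gl: "smooth_decreasing J c ga gl"
    using fa ga by blast
  have ifg: "integrable M (\<lambda>x. fa (\<lambda>i. h * X i x) * ga (\<lambda>i. h * X i x))"
    using smooth_decreasingD(1,3,4)[OF fl] smooth_decreasingD(1,3,4)[OF gl]
    by (intro integrable_const_bound[of _ 1] borel_measurable_times measurable_compose[OF mh])
       (auto simp: abs_mult intro!: mult_le_one)
  have "(\<integral>\<omega>. f (\<lambda>i. h * sqrt (real (Suc n)) * X i \<omega>) \<partial>M) * (\<integral>\<omega>. g (\<lambda>i. h * sqrt (real (Suc n)) * X i \<omega>) \<partial>M) - real (Suc n) * e
    = (\<integral>x. fa (\<lambda>i. h * X i x) \<partial>M) * (\<integral>x. ga (\<lambda>i. h * X i x) \<partial>M) - e - real n * e"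
    using split(1)[OF fD(1,3,4)] split(1)[OF gD(1,3,4)] by (simp add: fa_def ga_def algebra_simps)
  also have "\<dots> \<le> (\<integral>x. fa (\<lambda>i. h * X i x) * ga (\<lambda>i. h * X i x) \<partial>M) - real n * e"
    using step[OF fl gl] by simp
  also have "\<dots> = (\<integral>x. fa (\<lambda>i. h * X i x) * ga (\<lambda>i. h * X i x) - real n * e \<partial>M)"
    using ifg by (simp add: prob_space)
  also have "\<dots> \<le> (\<integral>x. (\<integral>\<omega>. f (\<lambda>i. h * X i x + r * X i \<omega>) * g (\<lambda>i. h * X i x + r * X i \<omega>) \<partial>M) \<partial>M)"
    using ifg split(2)[OF fg] by (intro integral_mono inner) auto
  also have "\<dots> = (\<integral>\<omega>. f (\<lambda>i. h * sqrt (real (Suc n)) * X i \<omega>) * g (\<lambda>i. h * sqrt (real (Suc n)) * X i \<omega>) \<partial>M)"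
    using split(1)[OF fg] by simp
  finally show ?case by simp
qed

text \<open>
  With \<open>n\<close> steps of size \<open>h = 1 / sqrt n\<close> the total deficit is of order \<open>n * h\<^sup>3 = 1 / sqrt n\<close>, and it
  disappears in the limit. This is a discrete form of the interpolation
  argument of Pitt and Slepian that works with first order expansions of the test functions only.
\<close>

lemma gaussian_association_smooth:
  fixes X :: "'i \<Rightarrow> 'a \<Rightarrow> real"
  assumes X: "gaussian_family M X" and J: "finite J"
    and cov: "\<And>i j. i \<in> J \<Longrightarrow> j \<in> J \<Longrightarrow> (\<integral>\<omega>. X i \<omega> * X j \<omega> \<partial>M) \<ge> 0"
    and c: "c \<ge> 0"
    and f: "smooth_decreasing J c f l" and g: "smooth_decreasing J c g k"
  shows "(\<integral>\<omega>. f (\<lambda>i. X i \<omega>) * g (\<lambda>i. X i \<omega>) \<partial>M) \<ge>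
     (\<integral>\<omega>. f (\<lambda>i. X i \<omega>) \<partial>M) * (\<integral>\<omega>. g (\<lambda>i. X i \<omega>) \<partial>M)"
proof -
  obtain \<kappa> where \<kappa>: "(\<integral>\<omega>. f (\<lambda>i. h * X i \<omega>) * g (\<lambda>i. h * X i \<omega>) \<partial>M) \<ge>
     (\<integral>\<omega>. f (\<lambda>i. h * X i \<omega>) \<partial>M) * (\<integral>\<omega>. g (\<lambda>i. h * X i \<omega>) \<partial>M) - \<kappa> * h ^ 3"
    if "smooth_decreasing J c f l" "smooth_decreasing J c g k" "0 \<le> h" "h \<le> 1" for f l g k h
    using covariance_step[OF X J cov c] by blast
  have "(\<integral>\<omega>. f (\<lambda>i. X i \<omega>) \<partial>M) * (\<integral>\<omega>. g (\<lambda>i. X i \<omega>) \<partial>M)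
     \<le> (\<integral>\<omega>. f (\<lambda>i. X i \<omega>) * g (\<lambda>i. X i \<omega>) \<partial>M) + \<kappa> / sqrt (real (Suc n))" for n
  proof -
    define h where "h = 1 / sqrt (real (Suc n))"
    have h: "0 \<le> h" "h \<le> 1" "h * sqrt (real (Suc n)) = 1" by (auto simp: h_def)
    have "real (Suc n) * (\<kappa> * h ^ 3) = \<kappa> / sqrt (real (Suc n))"
      by (simp add: h_def power3_eq_cube field_simps del: of_nat_Suc)
    then show ?thesis
      using covariance_iterate[OF X J _ f g, of h "\<kappa> * h ^ 3" "Suc n"] \<kappa> h by (simp del: of_nat_Suc)
  qed
  moreover have "(\<lambda>n. A + \<kappa> / sqrt (real (Suc n))) \<longlonglongrightarrow> A" for A
    by real_asymp
  ultimately show ?thesis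
    by (intro LIMSEQ_le_const[where X="\<lambda>n. (\<integral>\<omega>. f (\<lambda>i. X i \<omega>) * g (\<lambda>i. X i \<omega>) \<partial>M) + \<kappa> / sqrt (real (Suc n))"]) blast+
qed

definition logistic :: "real \<Rightarrow> real" where
  "logistic x = 1 / (1 + exp x)"

lemma logistic_bounds: "0 < logistic x" "logistic x < 1" "0 \<le> logistic x" "logistic x \<le> 1"
  by (auto simp: logistic_def add_pos_pos add_nonneg_nonneg)

lemma logistic_deriv:
  "(logistic has_real_derivative - (logistic x * (1 - logistic x))) (at x within S)"
proof -
  have "1 + exp x \<noteq> 0" using exp_gt_zero[of x] by linarith
  then show ?thesis unfolding logistic_def
    by (auto intro!: derivative_eq_intros simp: field_simps power2_eq_square)
qed

lemma mult_one_minus_le_one: "0 \<le> p \<Longrightarrow> p \<le> 1 \<Longrightarrow> \<bar>p * (1 - p)\<bar> \<le> (1::real)"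
  by (simp add: abs_mult mult_le_one)

lemma logistic_lipschitz: "\<bar>logistic (u + v) - logistic u\<bar> \<le> \<bar>v\<bar>"
proof -
  have "norm (logistic (u + v) - logistic u) \<le> 1 * norm ((u + v) - u)"
  proof (rule field_differentiable_bound[of UNIV])
    fix z :: real
    show "(logistic has_real_derivative - (logistic z * (1 - logistic z))) (at z within UNIV)"
      by (rule logistic_deriv)
    show "norm (- (logistic z * (1 - logistic z))) \<le> 1"
      unfolding real_norm_def abs_minus_cancel
      by (rule mult_one_minus_le_one) (rule logistic_bounds)+
  qed auto
  then show ?thesis by simp
qed

lemma logistic_taylor:
  "\<bar>logistic (u + v) - logistic u + logistic u * (1 - logistic u) * v\<bar> \<le> v\<^sup>2"
proof -
  define d where "d x = logistic x * (1 - logistic x)" for x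
  have dl: "\<bar>d x - d y\<bar> \<le> \<bar>x - y\<bar>" for x y
  proof -
    have "norm (d x - d y) \<le> 1 * norm (x - y)"
    proof (rule field_differentiable_bound[of UNIV])
      fix z :: real
      show "(d has_real_derivative (- (d z * (1 - 2 * logistic z)))) (at z within UNIV)"
        unfolding d_def by (auto intro!: derivative_eq_intros logistic_deriv simp: algebra_simps)
      have "\<bar>1 - 2 * logistic z\<bar> \<le> 1" using logistic_bounds[of z] by auto
      then show "norm (- (d z * (1 - 2 * logistic z))) \<le> 1"
        using mult_one_minus_le_one[of "logistic z"] logistic_bounds[of z]
        by (simp add: abs_mult d_def mult_le_one)
    qed auto
    then show ?thesis by simp
  qed
  define R where "R w = logistic (u + w) + d u * w" for w
  have "norm (R v - R 0) \<le> \<bar>v\<bar> * norm (v - 0)"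
  proof (rule field_differentiable_bound[of "{-\<bar>v\<bar>..\<bar>v\<bar>}"])
    fix w assume w: "w \<in> {-\<bar>v\<bar>..\<bar>v\<bar>}"
    have "((\<lambda>w. logistic (u + w)) has_real_derivative - d (u + w) * 1) (at w within {-\<bar>v\<bar>..\<bar>v\<bar>})"
      by (rule DERIV_chain'[of "\<lambda>w. u + w"]) (auto intro!: derivative_eq_intros logistic_deriv simp: d_def)
    then show "(R has_real_derivative (d u - d (u + w))) (at w within {-\<bar>v\<bar>..\<bar>v\<bar>})"
      unfolding R_def by (auto intro!: derivative_eq_intros)
    show "norm (d u - d (u + w)) \<le> \<bar>v\<bar>" using dl[of u "u + w"] w by auto
  qed auto
  then show ?thesis by (simp add: R_def d_def power2_eq_square abs_mult[symmetric] algebra_simps)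
qed

lemma smooth_decreasing_logistic:
  assumes \<alpha>: "\<alpha> \<ge> 0"
  shows "smooth_decreasing {j} (\<alpha> + \<alpha>\<^sup>2) (\<lambda>x. logistic (\<alpha> * x j + \<beta>))
     (\<lambda>_ x. \<alpha> * (logistic (\<alpha> * x j + \<beta>) * (1 - logistic (\<alpha> * x j + \<beta>))))"
  unfolding smooth_decreasing_def
proof (intro conjI allI ballI)
  have [measurable]: "logistic \<in> borel_measurable borel" unfolding logistic_def by measurable
  have [measurable]: "(\<lambda>x. x j) \<in> borel_measurable path_space" by simp
  show "(\<lambda>x. logistic (\<alpha> * x j + \<beta>)) \<in> borel_measurable path_space"
    "(\<lambda>x. \<alpha> * (logistic (\<alpha> * x j + \<beta>) * (1 - logistic (\<alpha> * x j + \<beta>)))) \<in> borel_measurable path_space"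
    by measurable
  fix x :: "'a \<Rightarrow> real"
  define p where "p = logistic (\<alpha> * x j + \<beta>)"
  have p: "0 \<le> p" "p \<le> 1" using logistic_bounds by (auto simp: p_def)
  show "0 \<le> logistic (\<alpha> * x j + \<beta>)" "logistic (\<alpha> * x j + \<beta>) \<le> 1" using p by (auto simp: p_def)
  have "\<alpha> * (p * (1 - p)) \<le> \<alpha> * 1" using p \<alpha> by (intro mult_left_mono mult_le_one) auto
  then show "0 \<le> \<alpha> * (logistic (\<alpha> * x j + \<beta>) * (1 - logistic (\<alpha> * x j + \<beta>)))"
    "\<alpha> * (logistic (\<alpha> * x j + \<beta>) * (1 - logistic (\<alpha> * x j + \<beta>))) \<le> \<alpha> + \<alpha>\<^sup>2"
    using p \<alpha> unfolding p_def[symmetric] by (auto simp: add_increasing2)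
  fix y :: "'a \<Rightarrow> real"
  have e: "\<alpha> * (x j + y j) + \<beta> = (\<alpha> * x j + \<beta>) + \<alpha> * y j" by (simp add: algebra_simps)
  have "\<bar>\<alpha> * y j\<bar> \<le> (\<alpha> + \<alpha>\<^sup>2) * \<bar>y j\<bar>" using \<alpha> by (simp add: abs_mult algebra_simps)
  then show "\<bar>logistic (\<alpha> * (x j + y j) + \<beta>) - logistic (\<alpha> * x j + \<beta>)\<bar> \<le> (\<alpha> + \<alpha>\<^sup>2) * (\<Sum>j\<in>{j}. \<bar>y j\<bar>)"
    unfolding e using logistic_lipschitz[of "\<alpha> * x j + \<beta>" "\<alpha> * y j"] by simp
  have "(\<alpha> * y j)\<^sup>2 \<le> (\<alpha> + \<alpha>\<^sup>2) * (y j)\<^sup>2" using \<alpha> by (simp add: power_mult_distrib algebra_simps)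
  then show "\<bar>logistic (\<alpha> * (x j + y j) + \<beta>) - logistic (\<alpha> * x j + \<beta>) +
     (\<Sum>j'\<in>{j}. \<alpha> * (logistic (\<alpha> * x j + \<beta>) * (1 - logistic (\<alpha> * x j + \<beta>))) * y j')\<bar> \<le> (\<alpha> + \<alpha>\<^sup>2) * (\<Sum>j\<in>{j}. \<bar>y j\<bar>)\<^sup>2"
    unfolding e using logistic_taylor[of "\<alpha> * x j + \<beta>" "\<alpha> * y j"] by (simp add: mult_ac)
qed

lemma smooth_decreasing_mono:
  assumes f: "smooth_decreasing J c f l" and J: "finite J'" "J \<subseteq> J'" and c: "c \<le> c'" "0 \<le> c"
  shows "smooth_decreasing J' c' f (\<lambda>j x. if j \<in> J then l j x else 0)"
  unfolding smooth_decreasing_def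
proof (intro conjI allI ballI)
  show "f \<in> borel_measurable path_space" by (rule smooth_decreasingD[OF f])
  show "(\<lambda>x. if j \<in> J then l j x else 0) \<in> borel_measurable path_space" for j
    using smooth_decreasingD(2)[OF f] by auto
  fix x :: "'a \<Rightarrow> real"
  show "0 \<le> f x" "f x \<le> 1" by (rule smooth_decreasingD[OF f])+
  show "0 \<le> (if j \<in> J then l j x else 0)" "(if j \<in> J then l j x else 0) \<le> c'" for j
    using smooth_decreasingD(5,6)[OF f, of j x] c by auto
  fix y :: "'a \<Rightarrow> real"
  have s: "(\<Sum>j\<in>J. \<bar>y j\<bar>) \<le> (\<Sum>j\<in>J'. \<bar>y j\<bar>)" by (rule sum_mono2) (use J in auto)
  have s0: "0 \<le> (\<Sum>j\<in>J. \<bar>y j\<bar>)" by (intro sum_nonneg) auto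
  have "c * (\<Sum>j\<in>J. \<bar>y j\<bar>) \<le> c' * (\<Sum>j\<in>J'. \<bar>y j\<bar>)" using c s s0 by (intro mult_mono) auto
  then show "\<bar>f (\<lambda>i. x i + y i) - f x\<bar> \<le> c' * (\<Sum>j\<in>J'. \<bar>y j\<bar>)"
    using smooth_decreasingD(7)[OF f, of x y] by linarith
  have "c * (\<Sum>j\<in>J. \<bar>y j\<bar>)\<^sup>2 \<le> c' * (\<Sum>j\<in>J'. \<bar>y j\<bar>)\<^sup>2" using c s s0 by (intro mult_mono power_mono) auto
  moreover have "(\<Sum>j\<in>J'. (if j \<in> J then l j x else 0) * y j) = (\<Sum>j\<in>J. l j x * y j)"
    using J by (intro sum.mono_neutral_cong_right) auto
  ultimately show "\<bar>f (\<lambda>i. x i + y i) - f x + (\<Sum>j\<in>J'. (if j \<in> J then l j x else 0) * y j)\<bar> \<le> c' * (\<Sum>j\<in>J'. \<bar>y j\<bar>)\<^sup>2"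
    using smooth_decreasingD(8)[OF f, of x y] by linarith
qed

lemma smooth_decreasing_mult:
  assumes f: "smooth_decreasing J c f l" and g: "smooth_decreasing J d g k" and cd: "0 \<le> c" "0 \<le> d"
  shows "smooth_decreasing J (c + d + c * d) (\<lambda>x. f x * g x) (\<lambda>j x. l j x * g x + f x * k j x)"
  unfolding smooth_decreasing_def
proof (intro conjI allI ballI)
  note fD = smooth_decreasingD[OF f] and gD = smooth_decreasingD[OF g]
  note [measurable] = fD(1,2) gD(1,2)
  show "(\<lambda>x. f x * g x) \<in> borel_measurable path_space"
    "(\<lambda>x. l j x * g x + f x * k j x) \<in> borel_measurable path_space" for j by measurable
  fix x :: "'a \<Rightarrow> real"
  show "0 \<le> f x * g x" "f x * g x \<le> 1" using fD(3,4) gD(3,4) by (auto intro!: mult_le_one)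
  show "0 \<le> l j x * g x + f x * k j x" if "j \<in> J" for j using fD(3,5) gD(3,5) that by (auto intro!: add_nonneg_nonneg)
  show "l j x * g x + f x * k j x \<le> c + d + c * d" if j: "j \<in> J" for j
  proof -
    have "l j x * g x \<le> c * 1" using fD(5,6)[OF j] gD(3,4) cd by (intro mult_mono) auto
    moreover have "f x * k j x \<le> 1 * d" using gD(5,6)[OF j] fD(3,4) cd by (intro mult_mono) auto
    moreover have "0 \<le> c * d" using cd by simp
    ultimately show ?thesis by linarith
  qed
  fix y :: "'a \<Rightarrow> real"
  define s where "s = (\<Sum>j\<in>J. \<bar>y j\<bar>)"
  have s0: "s \<ge> 0" unfolding s_def by (intro sum_nonneg) auto
  define f' g' where "f' = f (\<lambda>i. x i + y i)" and "g' = g (\<lambda>i. x i + y i)"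
  define df dg where "df = (\<Sum>j\<in>J. l j x * y j)" and "dg = (\<Sum>j\<in>J. k j x * y j)"
  have Lf: "\<bar>f' - f x\<bar> \<le> c * s" and Lg: "\<bar>g' - g x\<bar> \<le> d * s"
    using fD(7)[of x y] gD(7)[of x y] by (simp_all add: f'_def g'_def s_def)
  have Ef: "\<bar>f' - f x + df\<bar> \<le> c * s\<^sup>2" and Eg: "\<bar>g' - g x + dg\<bar> \<le> d * s\<^sup>2"
    using fD(8)[of x y] gD(8)[of x y] by (simp_all add: f'_def g'_def s_def df_def dg_def)
  have g'1: "0 \<le> g'" "g' \<le> 1" unfolding g'_def by (rule gD)+
  have "\<bar>f' * g' - f x * g x\<bar> = \<bar>(f' - f x) * g' + f x * (g' - g x)\<bar>" by (simp add: algebra_simps)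
  also have "\<dots> \<le> \<bar>f' - f x\<bar> * \<bar>g'\<bar> + \<bar>f x\<bar> * \<bar>g' - g x\<bar>"
    using abs_triangle_ineq by (simp add: abs_mult[symmetric])
  also have "\<dots> \<le> (c * s) * 1 + 1 * (d * s)"
    using Lf Lg g'1 fD(3,4)[of x] cd s0 by (intro add_mono mult_mono) auto
  also have "\<dots> \<le> (c + d + c * d) * s" using cd s0 by (simp add: algebra_simps)
  finally show "\<bar>f (\<lambda>i. x i + y i) * g (\<lambda>i. x i + y i) - f x * g x\<bar> \<le> (c + d + c * d) * (\<Sum>j\<in>J. \<bar>y j\<bar>)"
    by (simp add: f'_def g'_def s_def)
  have dfb: "\<bar>df\<bar> \<le> c * s"
  proof -
    have "\<bar>df\<bar> \<le> (\<Sum>j\<in>J. \<bar>l j x * y j\<bar>)" unfolding df_def by (rule sum_abs)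
    also have "\<dots> \<le> (\<Sum>j\<in>J. c * \<bar>y j\<bar>)"
      using fD(5,6) by (intro sum_mono) (auto simp: abs_mult intro!: mult_right_mono)
    finally show ?thesis by (simp add: s_def sum_distrib_left)
  qed
  have "\<bar>f' * g' - f x * g x + (df * g x + f x * dg)\<bar> =
     \<bar>(f' - f x + df) * g' + f x * (g' - g x + dg) - df * (g' - g x)\<bar>" by (simp add: algebra_simps)
  also have "\<dots> \<le> \<bar>f' - f x + df\<bar> * \<bar>g'\<bar> + \<bar>f x\<bar> * \<bar>g' - g x + dg\<bar> + \<bar>df\<bar> * \<bar>g' - g x\<bar>"
    unfolding abs_mult[symmetric] by linarith
  also have "\<dots> \<le> (c * s\<^sup>2) * 1 + 1 * (d * s\<^sup>2) + (c * s) * (d * s)"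
    using Ef Eg Lg dfb g'1 fD(3,4)[of x] cd s0 by (intro add_mono mult_mono) auto
  also have "\<dots> = (c + d + c * d) * s\<^sup>2" by (simp add: algebra_simps power2_eq_square)
  finally show "\<bar>f (\<lambda>i. x i + y i) * g (\<lambda>i. x i + y i) - f x * g x + (\<Sum>j\<in>J. (l j x * g x + f x * k j x) * y j)\<bar>
      \<le> (c + d + c * d) * (\<Sum>j\<in>J. \<bar>y j\<bar>)\<^sup>2"
    by (simp add: f'_def g'_def s_def df_def dg_def sum.distrib sum_distrib_left sum_distrib_right algebra_simps)
qed

lemma smooth_decreasing_prod_logistic:
  assumes "finite J" "\<alpha> \<ge> 0"
  shows "\<exists>c\<ge>0. \<exists>l. smooth_decreasing J c (\<lambda>x. \<Prod>j\<in>J. logistic (\<alpha> * x j + \<beta> j)) l"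
  using assms(1)
proof induction
  case empty
  have "smooth_decreasing {} 0 (\<lambda>x. \<Prod>j\<in>{}. logistic (\<alpha> * x j + \<beta> j)) (\<lambda>_ _. 0)"
    by (simp add: smooth_decreasing_def)
  then show ?case by blast
next
  case (insert j J)
  then obtain c l where c: "c \<ge> 0" and l: "smooth_decreasing J c (\<lambda>x. \<Prod>j\<in>J. logistic (\<alpha> * x j + \<beta> j)) l" by blast
  have fin: "finite (insert j J)" using insert.hyps by simp
  have a: "0 \<le> \<alpha> + \<alpha>\<^sup>2" using assms(2) by simp
  have "\<exists>l. smooth_decreasing (insert j J) ((\<alpha> + \<alpha>\<^sup>2) + c + (\<alpha> + \<alpha>\<^sup>2) * c)
    (\<lambda>x. logistic (\<alpha> * x j + \<beta> j) * (\<Prod>j\<in>J. logistic (\<alpha> * x j + \<beta> j))) l"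
    using smooth_decreasing_mult[OF
        smooth_decreasing_mono[OF smooth_decreasing_logistic[OF assms(2), of j "\<beta> j"] fin _ order_refl a]
        smooth_decreasing_mono[OF l fin _ order_refl c] a c] by blast
  then show ?case using insert.hyps c a by (intro exI[of _ "(\<alpha> + \<alpha>\<^sup>2) + c + (\<alpha> + \<alpha>\<^sup>2) * c"]) auto
qed

section \<open>Slepian's inequality for countable families\<close>

definition prob_below :: "'a measure \<Rightarrow> ('i \<Rightarrow> 'a \<Rightarrow> real) \<Rightarrow> 'i set \<Rightarrow> ('i \<Rightarrow> real) \<Rightarrow> real" where
  "prob_below M X D b = measure M {\<omega>\<in>space M. \<forall>i\<in>D. X i \<omega> \<le> b i}"

lemma pred_countable_Ball:
  "countable D \<Longrightarrow> (\<And>i. i \<in> D \<Longrightarrow> Measurable.pred M (P i)) \<Longrightarrow> Measurable.pred M (\<lambda>\<omega>. \<forall>i\<in>D. P i \<omega>)"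
  unfolding pred_def by (rule sets.sets_Collect_countable_All')

lemma pred_countable_Bex:
  "countable D \<Longrightarrow> (\<And>i. i \<in> D \<Longrightarrow> Measurable.pred M (P i)) \<Longrightarrow> Measurable.pred M (\<lambda>\<omega>. \<exists>i\<in>D. P i \<omega>)"
  unfolding pred_def by (rule sets.sets_Collect_countable_Ex')

text \<open>
  The offset \<open>- n\<close> is there for the point \<open>x = b\<close>: without it the limit would be \<open>1 / 2\<close> there
  rather than \<open>1\<close>.
\<close>

lemma logistic_sharpening:
  "(\<lambda>n. logistic ((real n)\<^sup>2 * x + (- (real n)\<^sup>2 * b - real n))) \<longlonglongrightarrow> (if x \<le> b then 1 else 0)"
proof -
  define d where "d = x - b"
  have e: "(real n)\<^sup>2 * x + (- (real n)\<^sup>2 * b - real n) = (real n)\<^sup>2 * d - real n" for n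
    by (simp add: d_def algebra_simps)
  have "(\<lambda>n. logistic ((real n)\<^sup>2 * d - real n)) \<longlonglongrightarrow> 1" if "d < 0"
    unfolding logistic_def using that by real_asymp
  moreover have "(\<lambda>n. logistic ((real n)\<^sup>2 * d - real n)) \<longlonglongrightarrow> 1" if "d = 0"
    unfolding logistic_def that by real_asymp
  moreover have "(\<lambda>n. logistic ((real n)\<^sup>2 * d - real n)) \<longlonglongrightarrow> 0" if "d > 0"
    unfolding logistic_def using that by real_asymp
  ultimately show ?thesis unfolding e
    by (cases "d < 0"; cases "d = 0") (auto simp: d_def)
qed

lemma prod_logistic_bounds: "0 \<le> (\<Prod>j\<in>J. logistic (u j))" "(\<Prod>j\<in>J. logistic (u j)) \<le> 1"
  using logistic_bounds by (auto intro!: prod_nonneg prod_le_1)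

lemma prod_logistic_limit:
  fixes X :: "'i \<Rightarrow> 'a \<Rightarrow> real" and b :: "'i \<Rightarrow> real"
  assumes "prob_space M" and [measurable]: "\<And>i. X i \<in> borel_measurable M" and J: "finite J1" "finite J2"
  defines "u \<equiv> \<lambda>n j x. logistic ((real n)\<^sup>2 * x + (- (real n)\<^sup>2 * b j - real n))"
  shows "(\<lambda>n. \<integral>\<omega>. (\<Prod>j\<in>J1. u n j (X j \<omega>)) * (\<Prod>j\<in>J2. u n j (X j \<omega>)) \<partial>M) \<longlonglongrightarrow> prob_below M X (J1 \<union> J2) b"
proof -
  interpret prob_space M by fact
  have [measurable]: "u n j \<in> borel_measurable borel" for n j unfolding u_def logistic_def by measurable
  let ?E = "{\<omega>\<in>space M. \<forall>i\<in>J1 \<union> J2. X i \<omega> \<le> b i}"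
  have E[measurable]: "?E \<in> sets M"
    unfolding pred_def[symmetric] using J by (intro pred_countable_Ball countable_finite; measurable)
  have lim: "(\<lambda>n. \<Prod>j\<in>J. u n j (X j \<omega>)) \<longlonglongrightarrow> (if \<forall>j\<in>J. X j \<omega> \<le> b j then 1 else 0)" if "finite J" for J \<omega>
  proof -
    have "(\<lambda>n. \<Prod>j\<in>J. u n j (X j \<omega>)) \<longlonglongrightarrow> (\<Prod>j\<in>J. if X j \<omega> \<le> b j then 1 else 0)"
      unfolding u_def by (intro tendsto_prod logistic_sharpening)
    also have "(\<Prod>j\<in>J. if X j \<omega> \<le> b j then 1 else (0::real)) = (if \<forall>j\<in>J. X j \<omega> \<le> b j then 1 else 0)"
      using that by (auto intro: prod.neutral simp: prod_zero_iff)
    finally show ?thesis .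
  qed
  have "(\<lambda>n. \<integral>\<omega>. (\<Prod>j\<in>J1. u n j (X j \<omega>)) * (\<Prod>j\<in>J2. u n j (X j \<omega>)) \<partial>M) \<longlonglongrightarrow> (\<integral>\<omega>. indicator ?E \<omega> \<partial>M)"
  proof (rule integral_dominated_convergence[where w="\<lambda>_. 1"])
    show "AE \<omega> in M. (\<lambda>n. (\<Prod>j\<in>J1. u n j (X j \<omega>)) * (\<Prod>j\<in>J2. u n j (X j \<omega>))) \<longlonglongrightarrow> indicator ?E \<omega>"
    proof (rule AE_I2)
      fix \<omega> assume "\<omega> \<in> space M"
      then have "indicator ?E \<omega> = (if \<forall>j\<in>J1. X j \<omega> \<le> b j then 1 else 0) * (if \<forall>j\<in>J2. X j \<omega> \<le> b j then 1 else (0::real))"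
        by (auto simp: indicator_def)
      then show "(\<lambda>n. (\<Prod>j\<in>J1. u n j (X j \<omega>)) * (\<Prod>j\<in>J2. u n j (X j \<omega>))) \<longlonglongrightarrow> indicator ?E \<omega>"
        using tendsto_mult[OF lim[OF J(1)] lim[OF J(2)], of \<omega> \<omega>] by simp
    qed
    show "AE \<omega> in M. norm ((\<Prod>j\<in>J1. u n j (X j \<omega>)) * (\<Prod>j\<in>J2. u n j (X j \<omega>))) \<le> 1" for n
      unfolding u_def by (intro AE_I2) (simp only: real_norm_def abs_mult abs_of_nonneg prod_logistic_bounds mult_le_one)
  qed auto
  then show ?thesis by (simp add: prob_below_def)
qed

text \<open>
  Positive association of the events that the coordinates stay below a barrier: products of steep
  logistic functions belong to the class of smooth decreasing functions and converge to the
  indicators.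
\<close>

lemma slepian_finite:
  fixes X :: "'i \<Rightarrow> 'a \<Rightarrow> real"
  assumes X: "gaussian_family M X" and J: "finite J1" "finite J2"
    and cov: "\<And>i j. (\<integral>\<omega>. X i \<omega> * X j \<omega> \<partial>M) \<ge> 0"
  shows "prob_below M X J1 b * prob_below M X J2 b \<le> prob_below M X (J1 \<union> J2) b"
proof -
  define u where "u n j x = logistic ((real n)\<^sup>2 * x + (- (real n)\<^sup>2 * b j - real n))" for n j x
  have P: "prob_space M" "\<And>i. X i \<in> borel_measurable M" using gaussian_familyD[OF X] by auto
  have "(\<integral>\<omega>. (\<Prod>j\<in>J1. u n j (X j \<omega>)) * (\<Prod>j\<in>{}. u n j (X j \<omega>)) \<partial>M) * (\<integral>\<omega>. (\<Prod>j\<in>J2. u n j (X j \<omega>)) * (\<Prod>j\<in>{}. u n j (X j \<omega>)) \<partial>M)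
     \<le> (\<integral>\<omega>. (\<Prod>j\<in>J1. u n j (X j \<omega>)) * (\<Prod>j\<in>J2. u n j (X j \<omega>)) \<partial>M)" for n
  proof -
    have n0: "0 \<le> (real n)\<^sup>2" by simp
    obtain c1 l1 where 1: "c1 \<ge> 0" "smooth_decreasing J1 c1 (\<lambda>x. \<Prod>j\<in>J1. u n j (x j)) l1"
      using smooth_decreasing_prod_logistic[OF J(1) n0, of "\<lambda>j. - (real n)\<^sup>2 * b j - real n"] unfolding u_def by blast
    obtain c2 l2 where 2: "c2 \<ge> 0" "smooth_decreasing J2 c2 (\<lambda>x. \<Prod>j\<in>J2. u n j (x j)) l2"
      using smooth_decreasing_prod_logistic[OF J(2) n0, of "\<lambda>j. - (real n)\<^sup>2 * b j - real n"] unfolding u_def by blast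
    have fin: "finite (J1 \<union> J2)" using J by simp
    have c: "0 \<le> max c1 c2" using 1 by simp
    show ?thesis
      using gaussian_association_smooth[OF X fin cov c smooth_decreasing_mono[OF 1(2) fin _ _ 1(1)] smooth_decreasing_mono[OF 2(2) fin _ _ 2(1)]]
      by simp
  qed
  moreover note prod_logistic_limit[where X=X and b=b, OF P J(1) finite.emptyI, folded u_def]
    prod_logistic_limit[where X=X and b=b, OF P J(2) finite.emptyI, folded u_def] prod_logistic_limit[where X=X and b=b, OF P J, folded u_def]
  ultimately show ?thesis
    by (intro LIMSEQ_le[OF tendsto_mult[of _ "prob_below M X (J1 \<union> {}) b" _ _ "prob_below M X (J2 \<union> {}) b", simplified]]) auto
qed

text \<open>
  Finite sets that exhaust a countable set, used to approximate countable intersections of events.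
\<close>

definition initial_part :: "'i set \<Rightarrow> nat \<Rightarrow> 'i set" where
  "initial_part D n = {j\<in>D. to_nat_on D j < n}"

lemma finite_initial_part: "countable D \<Longrightarrow> finite (initial_part D n)"
  unfolding initial_part_def
  by (rule finite_imageD[of "to_nat_on D"]) (auto intro: finite_subset[of _ "{..<n}"] inj_on_subset[OF inj_on_to_nat_on])

lemma prob_below_measurable:
  fixes X :: "'i \<Rightarrow> 'a \<Rightarrow> real" and b :: "'i \<Rightarrow> real"
  assumes [measurable]: "\<And>i. X i \<in> borel_measurable M" and "countable D"
  shows "{\<omega>\<in>space M. \<forall>i\<in>D. X i \<omega> \<le> b i} \<in> sets M"
  unfolding pred_def[symmetric] by (rule pred_countable_Ball[OF assms(2)]) measurable

lemma prob_below_countable_limit: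
  assumes "prob_space M" and X[measurable]: "\<And>i. X i \<in> borel_measurable M" and D: "countable D1" "countable D2"
  shows "(\<lambda>n. prob_below M X (initial_part D1 n \<union> initial_part D2 n) b) \<longlonglongrightarrow> prob_below M X (D1 \<union> D2) b"
proof -
  interpret prob_space M by fact
  define A where "A n = {\<omega>\<in>space M. \<forall>i\<in>initial_part D1 n \<union> initial_part D2 n. X i \<omega> \<le> b i}" for n
  have "finite (initial_part D1 n \<union> initial_part D2 n)" for n
    using finite_initial_part[OF D(1)] finite_initial_part[OF D(2)] by simp
  then have "A n \<in> sets M" for n
    unfolding A_def by (intro prob_below_measurable X countable_finite)
  moreover have "decseq A"
    unfolding A_def initial_part_def by (intro decseq_SucI) auto
  ultimately have "(\<lambda>n. measure M (A n)) \<longlonglongrightarrow> measure M (\<Inter>n. A n)"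
    by (intro finite_Lim_measure_decseq) auto
  moreover have "(\<Inter>n. A n) = {\<omega>\<in>space M. \<forall>i\<in>D1 \<union> D2. X i \<omega> \<le> b i}"
    unfolding A_def initial_part_def by auto
  ultimately show ?thesis by (simp add: prob_below_def A_def)
qed

theorem slepian_countable:
  fixes X :: "'i \<Rightarrow> 'a \<Rightarrow> real"
  assumes X: "gaussian_family M X" and D: "countable D1" "countable D2"
    and cov: "\<And>i j. (\<integral>\<omega>. X i \<omega> * X j \<omega> \<partial>M) \<ge> 0"
  shows "prob_below M X D1 b * prob_below M X D2 b \<le> prob_below M X (D1 \<union> D2) b"
proof -
  have P: "prob_space M" "\<And>i. X i \<in> borel_measurable M" using gaussian_familyD[OF X] by auto
  have "(\<lambda>n. prob_below M X (initial_part D1 n) b * prob_below M X (initial_part D2 n) b)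
      \<longlonglongrightarrow> prob_below M X D1 b * prob_below M X D2 b"
    using tendsto_mult[OF prob_below_countable_limit[where X=X and b=b, OF P D(1) D(1)] prob_below_countable_limit[where X=X and b=b, OF P D(2) D(2)]] by simp
  then show ?thesis
    using slepian_finite[OF X finite_initial_part[OF D(1)] finite_initial_part[OF D(2)] cov]
    by (intro LIMSEQ_le[OF _ prob_below_countable_limit[where X=X, OF P D]]) auto
qed

section \<open>Shifts of Gaussian families\<close>

text \<open>
  The density of \<open>\<xi> + s\<close> at \<open>t\<close> is \<open>exp (s * t - s\<^sup>2 / 2)\<close> times that of \<open>\<xi>\<close>.
\<close>

lemma std_normal_shift:
  assumes B[measurable]: "B \<in> sets borel" and s: "s \<ge> 0"
  shows "ennreal (exp (- s * L - s\<^sup>2 / 2)) * emeasure std_normal_distribution {t. t \<in> B \<and> - L \<le> t}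
     \<le> emeasure std_normal_distribution {t. t + s \<in> B}"
proof -
  have "ennreal (exp (- s * L - s\<^sup>2 / 2)) * emeasure std_normal_distribution {t. t \<in> B \<and> - L \<le> t}
      = (\<integral>\<^sup>+ t. ennreal (exp (- s * L - s\<^sup>2 / 2)) * (ennreal (std_normal_density t) * indicator {t. t \<in> B \<and> - L \<le> t} t) \<partial>lborel)"
    by (subst nn_integral_cmult) (simp_all add: emeasure_density)
  also have "\<dots> \<le> (\<integral>\<^sup>+ t. ennreal (std_normal_density (t - s)) * indicator B t \<partial>lborel)"
  proof (rule nn_integral_mono)
    fix t :: real
    have "exp (- s * L - s\<^sup>2 / 2) * std_normal_density t \<le> std_normal_density (t - s)" if "- L \<le> t"
    proof -
      have "s * (- L) \<le> s * t" using that s by (rule mult_left_mono)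
      then have "- s * L - s\<^sup>2 / 2 - t\<^sup>2 / 2 \<le> - (t - s)\<^sup>2 / 2"
        by (simp add: power2_eq_square field_simps)
      then have "exp (- s * L - s\<^sup>2 / 2) * exp (- t\<^sup>2 / 2) \<le> exp (- (t - s)\<^sup>2 / 2)"
        unfolding exp_add[symmetric] by simp
      from mult_left_mono[OF this, of "1 / sqrt (2 * pi)"] show ?thesis
        unfolding std_normal_density_def by (simp add: mult.left_commute)
    qed
    then show "ennreal (exp (- s * L - s\<^sup>2 / 2)) * (ennreal (std_normal_density t) * indicator {t. t \<in> B \<and> - L \<le> t} t)
       \<le> ennreal (std_normal_density (t - s)) * indicator B t"
      by (auto simp: indicator_def ennreal_mult[symmetric] intro!: ennreal_leI)
  qed
  also have "\<dots> = (\<integral>\<^sup>+ t. ennreal (std_normal_density t) * indicator B (t + s) \<partial>lborel)"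
    by (subst nn_integral_real_affine[where c=1 and t=s]) (auto simp: add.commute)
  also have "\<dots> = emeasure std_normal_distribution {t. t + s \<in> B}"
    by (subst emeasure_density) (auto simp: indicator_def)
  finally show ?thesis .
qed

lemma std_normal_tail:
  assumes L: "L \<ge> 0"
  shows "emeasure std_normal_distribution {t. t < - L} \<le> ennreal (exp (- L\<^sup>2 / 2))"
proof -
  interpret prob_space std_normal_distribution
    using real_dist_normal_dist by (simp add: real_distribution_def)
  have "emeasure std_normal_distribution {t. t < - L}
      = (\<integral>\<^sup>+ t. ennreal (std_normal_density t) * indicator {t. t < - L} t \<partial>lborel)"
    by (subst emeasure_density) auto
  also have "\<dots> \<le> (\<integral>\<^sup>+ t. ennreal (exp (- L\<^sup>2 / 2)) * ennreal (std_normal_density (t + L)) \<partial>lborel)"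
  proof (rule nn_integral_mono)
    fix t :: real
    have "std_normal_density t \<le> exp (- L\<^sup>2 / 2) * std_normal_density (t + L)" if "t < - L"
    proof -
      have "L * (t + L) \<le> 0" using that L by (intro mult_nonneg_nonpos) auto
      then have "- t\<^sup>2 / 2 \<le> - L\<^sup>2 / 2 - (t + L)\<^sup>2 / 2"
        by (simp add: power2_eq_square field_simps)
      then have "exp (- t\<^sup>2 / 2) \<le> exp (- L\<^sup>2 / 2) * exp (- (t + L)\<^sup>2 / 2)"
        unfolding exp_add[symmetric] by simp
      from mult_left_mono[OF this, of "1 / sqrt (2 * pi)"] show ?thesis
        unfolding std_normal_density_def by (simp add: mult.left_commute)
    qed
    then show "ennreal (std_normal_density t) * indicator {t. t < - L} t
       \<le> ennreal (exp (- L\<^sup>2 / 2)) * ennreal (std_normal_density (t + L))"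
      by (auto simp: indicator_def ennreal_mult[symmetric] intro!: ennreal_leI)
  qed
  also have "\<dots> = ennreal (exp (- L\<^sup>2 / 2)) * (\<integral>\<^sup>+ t. ennreal (std_normal_density t) \<partial>lborel)"
    by (subst nn_integral_cmult, simp, subst (2) nn_integral_real_affine[where c=1 and t=L]) (auto simp: add.commute)
  also have "(\<integral>\<^sup>+ t. ennreal (std_normal_density t) \<partial>lborel) = emeasure std_normal_distribution (space std_normal_distribution)"
    by (subst emeasure_density) auto
  finally show ?thesis by (simp only: emeasure_space_1 mult_1_right)
qed

lemma gaussian_family_linear2:
  fixes V :: "'i \<Rightarrow> 'a \<Rightarrow> real" and p q :: "'k \<Rightarrow> 'i"
  assumes V: "gaussian_family M V"
  shows "gaussian_family M (\<lambda>k \<omega>. a k * V (p k) \<omega> + c k * V (q k) \<omega>)"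
    and "(\<integral>\<omega>. (a k * V (p k) \<omega> + c k * V (q k) \<omega>) * (a k' * V (p k') \<omega> + c k' * V (q k') \<omega>) \<partial>M) =
      a k * a k' * (\<integral>\<omega>. V (p k) \<omega> * V (p k') \<omega> \<partial>M) + a k * c k' * (\<integral>\<omega>. V (p k) \<omega> * V (q k') \<omega> \<partial>M)
      + c k * a k' * (\<integral>\<omega>. V (q k) \<omega> * V (p k') \<omega> \<partial>M) + c k * c k' * (\<integral>\<omega>. V (q k) \<omega> * V (q k') \<omega> \<partial>M)"
proof -
  have "(\<Sum>i\<in>{p k, q k}. ((if i = p k then a k else 0) + (if i = q k then c k else 0)) * x i)
     = a k * x (p k) + c k * x (q k)" for k and x :: "'i \<Rightarrow> real"
    by (cases "p k = q k") (auto simp: algebra_simps)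
  then show "gaussian_family M (\<lambda>k \<omega>. a k * V (p k) \<omega> + c k * V (q k) \<omega>)"
    using gaussian_family_linear[OF V, of "\<lambda>k. {p k, q k}"
      "\<lambda>k i. (if i = p k then a k else 0) + (if i = q k then c k else 0)"] by simp
  have e: "(a k * V (p k) \<omega> + c k * V (q k) \<omega>) * (a k' * V (p k') \<omega> + c k' * V (q k') \<omega>) =
      a k * a k' * (V (p k) \<omega> * V (p k') \<omega>) + a k * c k' * (V (p k) \<omega> * V (q k') \<omega>)
      + c k * a k' * (V (q k) \<omega> * V (p k') \<omega>) + c k * c k' * (V (q k) \<omega> * V (q k') \<omega>)" for \<omega>
    by (simp add: algebra_simps)
  show "(\<integral>\<omega>. (a k * V (p k) \<omega> + c k * V (q k) \<omega>) * (a k' * V (p k') \<omega> + c k' * V (q k') \<omega>) \<partial>M) =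
      a k * a k' * (\<integral>\<omega>. V (p k) \<omega> * V (p k') \<omega> \<partial>M) + a k * c k' * (\<integral>\<omega>. V (p k) \<omega> * V (q k') \<omega> \<partial>M)
      + c k * a k' * (\<integral>\<omega>. V (q k) \<omega> * V (p k') \<omega> \<partial>M) + c k * c k' * (\<integral>\<omega>. V (q k) \<omega> * V (q k') \<omega> \<partial>M)"
    unfolding e using gaussian_family_integrable_mult[OF V] by simp
qed

text \<open>
  One-sided Cameron-Martin estimate. Decompose \<open>V i = R i + b i * V g\<close> with \<open>R\<close> independent of the
  standard normal variable \<open>V g\<close>. Adding \<open>s * b\<close> to \<open>V\<close> amounts to adding \<open>s\<close> to \<open>V g\<close>, which changes the
  density by a factor of at least \<open>exp (- s * L - s\<^sup>2 / 2)\<close> where \<open>V g \<ge> - L\<close>; the rest has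
  probability at most \<open>exp (- L\<^sup>2 / 2)\<close>.
\<close>

theorem cameron_martin_lower_bound:
  fixes V :: "'i \<Rightarrow> 'a \<Rightarrow> real" and Q :: "('i \<Rightarrow> real) \<Rightarrow> bool"
  assumes V: "gaussian_family M V" and one: "(\<integral>\<omega>. (V g \<omega>)\<^sup>2 \<partial>M) = 1"
    and Q: "Measurable.pred path_space Q" and s: "s \<ge> 0" and L: "L \<ge> 0"
  defines "b \<equiv> \<lambda>i. \<integral>\<omega>. V i \<omega> * V g \<omega> \<partial>M"
  shows "exp (- s * L - s\<^sup>2 / 2) * (measure M {\<omega>\<in>space M. Q (\<lambda>i. V i \<omega>)} - exp (- L\<^sup>2 / 2))
     \<le> measure M {\<omega>\<in>space M. Q (\<lambda>i. V i \<omega> + s * b i)}"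
proof -
  interpret M: prob_space M by (rule gaussian_familyD[OF V])
  interpret P: pair_prob_space M M ..
  note [measurable] = gaussian_familyD(2)[OF V]
  define U where "U = case_sum (\<lambda>i z. V i (fst z)) (\<lambda>j z. V j (snd z :: 'a))"
  note U = gaussian_family_pair[OF V V, folded U_def]
  define a c where "a k = (1::real)" and "c k = (case k of None \<Rightarrow> 0 | Some i \<Rightarrow> - b i)" for k :: "'i option"
  define p q where "p k = (case k of None \<Rightarrow> g | Some i \<Rightarrow> i)" and "q k = g" for k
  define p' q' where "p' k = (case k of None \<Rightarrow> Inr g | Some i \<Rightarrow> (Inl i :: 'i + 'i))" and "q' k = (Inl g :: 'i + 'i)" for k :: "'i option"
  \<comment> \<open>\<open>W1\<close> consists of \<open>V g\<close> and the residuals on \<open>M\<close>; \<open>W2\<close> takes \<open>V g\<close> from the second copy and the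
    residuals from the first. Equality of second moments is the independence of the two parts.\<close>
  define W1 where "W1 k \<omega> = a k * V (p k) \<omega> + c k * V (q k) \<omega>" for k \<omega>
  define W2 where "W2 k z = a k * U (p' k) z + c k * U (q' k) z" for k z
  have W1: "gaussian_family M W1" and W2: "gaussian_family (M \<Otimes>\<^sub>M M) W2"
    unfolding W1_def W2_def by (rule gaussian_family_linear2[OF V] gaussian_family_linear2[OF U(1)])+
  have bs: "(\<integral>\<omega>. V i \<omega> * V g \<omega> \<partial>M) = b i" "(\<integral>\<omega>. V g \<omega> * V i \<omega> \<partial>M) = b i" for i
    by (simp_all add: b_def mult.commute)
  have bg: "b g = 1" using one by (simp add: b_def power2_eq_square)
  have cov: "(\<integral>\<omega>. W1 k \<omega> * W1 k' \<omega> \<partial>M) = (\<integral>z. W2 k z * W2 k' z \<partial>(M \<Otimes>\<^sub>M M))" for k k'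
    unfolding W1_def W2_def gaussian_family_linear2(2)[OF V] gaussian_family_linear2(2)[OF U(1)]
    by (cases k; cases k') (simp_all add: a_def c_def p_def q_def p'_def q'_def U(2,3,4,5) bs bg)
  have W1s: "W1 None = V g" "W1 (Some i) \<omega> = V i \<omega> - b i * V g \<omega>" for i \<omega>
    by (auto simp: W1_def a_def c_def p_def q_def fun_eq_iff)
  have W2s: "W2 None z = V g (snd z)" "W2 (Some i) z = V i (fst z) - b i * V g (fst z)" for i z
    by (auto simp: W2_def a_def c_def p'_def q'_def U_def)
  define T where "T t x = (\<lambda>i. x (Some i) + b i * (x None + t))" for t :: real and x :: "'i option \<Rightarrow> real"
  have T[measurable]: "T t \<in> path_space \<rightarrow>\<^sub>M path_space" for t
    unfolding T_def by (rule measurable_path_map) measurable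
  have mQ[measurable]: "Measurable.pred path_space (\<lambda>x. Q (T t x))" for t
    by (rule measurable_compose[OF T Q])
  have [measurable]: "Measurable.pred path_space (\<lambda>x::'i option \<Rightarrow> real. - L \<le> x None)" by measurable
  define B where "B x = {t. Q (\<lambda>i. (V i x - b i * V g x) + b i * t)}" for x
  have B[measurable]: "B x \<in> sets borel" for x
  proof -
    have "(\<lambda>t. \<lambda>i. (V i x - b i * V g x) + b i * t) \<in> borel \<rightarrow>\<^sub>M path_space"
      by (rule measurable_path_map) measurable
    from measurable_compose[OF this Q] show ?thesis
      by (simp add: B_def pred_def)
  qed
  define e where "e = exp (- s * L - s\<^sup>2 / 2)"
  define E1 where "E1 = {z\<in>space (M \<Otimes>\<^sub>M M). Q (T s (\<lambda>k. W2 k z))}"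
  define E2 where "E2 = {z\<in>space (M \<Otimes>\<^sub>M M). Q (T 0 (\<lambda>k. W2 k z)) \<and> - L \<le> W2 None z}"
  have mW2: "(\<lambda>z k. W2 k z) \<in> M \<Otimes>\<^sub>M M \<rightarrow>\<^sub>M path_space"
    by (rule measurable_path_map) (rule gaussian_familyD[OF W2])
  have ms: "E1 \<in> sets (M \<Otimes>\<^sub>M M)" "E2 \<in> sets (M \<Otimes>\<^sub>M M)"
    unfolding E1_def E2_def
    using measurable_compose[OF mW2 mQ] gaussian_familyD(2)[OF W2, of None] by measurable
  have d: "distr M borel (V g) = std_normal_distribution"
    by (rule gaussian_family_std_normal[OF V one])
  have law: "emeasure M {y\<in>space M. V g y \<in> C} = emeasure std_normal_distribution C" if "C \<in> sets borel" for C
    unfolding d[symmetric] using that by (subst emeasure_distr) (auto intro!: arg_cong[where f="emeasure M"])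
  have "ennreal e * emeasure (M \<Otimes>\<^sub>M M) E2 = (\<integral>\<^sup>+x. ennreal e * emeasure M (Pair x -` E2) \<partial>M)"
    using ms by (subst M.emeasure_pair_measure_alt, simp, subst nn_integral_cmult) (auto intro: M.measurable_emeasure_Pair)
  also have "\<dots> \<le> (\<integral>\<^sup>+x. emeasure M (Pair x -` E1) \<partial>M)"
  proof (rule nn_integral_mono)
    fix x assume x: "x \<in> space M"
    have 1: "Pair x -` E1 = {y\<in>space M. V g y \<in> {t. t + s \<in> B x}}"
      using x by (auto simp: E1_def B_def T_def W2s space_pair_measure)
    have 2: "Pair x -` E2 = {y\<in>space M. V g y \<in> {t. t \<in> B x \<and> - L \<le> t}}"
      using x by (auto simp: E2_def B_def T_def W2s space_pair_measure)
    have "{t. t + s \<in> B x} \<in> sets borel" "{t. t \<in> B x \<and> - L \<le> t} \<in> sets borel" by measurable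
    then show "ennreal e * emeasure M (Pair x -` E2) \<le> emeasure M (Pair x -` E1)"
      unfolding 1 2 e_def using std_normal_shift[OF B[of x] s, of L] by (simp only: law)
  qed
  also have "\<dots> = emeasure (M \<Otimes>\<^sub>M M) E1"
    using ms by (subst M.emeasure_pair_measure_alt) auto
  finally have main: "e * measure (M \<Otimes>\<^sub>M M) E2 \<le> measure (M \<Otimes>\<^sub>M M) E1"
    by (simp add: P.emeasure_eq_measure ennreal_mult[symmetric] e_def)
  have E1: "measure (M \<Otimes>\<^sub>M M) E1 = measure M {\<omega>\<in>space M. Q (\<lambda>i. V i \<omega> + s * b i)}"
    unfolding E1_def using gaussian_family_prob_eq[OF W1 W2 cov mQ[of s]]
    by (simp add: T_def W1s algebra_simps)
  have E2: "measure (M \<Otimes>\<^sub>M M) E2 = measure M {\<omega>\<in>space M. Q (\<lambda>i. V i \<omega>) \<and> - L \<le> V g \<omega>}"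
  proof -
    have "Measurable.pred path_space (\<lambda>x. Q (T 0 x) \<and> - L \<le> x None)" by measurable
    from gaussian_family_prob_eq[OF W1 W2 cov this] show ?thesis
      unfolding E2_def by (simp add: T_def W1s algebra_simps)
  qed
  have mQV[measurable]: "Measurable.pred M (\<lambda>\<omega>. Q (\<lambda>i. V i \<omega>))"
    by (rule measurable_compose[OF measurable_path_map Q]) measurable
  have "measure M {\<omega>\<in>space M. Q (\<lambda>i. V i \<omega>)} \<le> measure M ({\<omega>\<in>space M. Q (\<lambda>i. V i \<omega>) \<and> - L \<le> V g \<omega>} \<union> {\<omega>\<in>space M. V g \<omega> < - L})"
    by (intro M.finite_measure_mono) auto
  also have "\<dots> \<le> measure M {\<omega>\<in>space M. Q (\<lambda>i. V i \<omega>) \<and> - L \<le> V g \<omega>} + measure M {\<omega>\<in>space M. V g \<omega> < - L}"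
    by (rule measure_Un_le) measurable
  also have "measure M {\<omega>\<in>space M. V g \<omega> < - L} \<le> exp (- L\<^sup>2 / 2)"
  proof -
    have "ennreal (measure M {\<omega>\<in>space M. V g \<omega> < - L}) \<le> ennreal (exp (- L\<^sup>2 / 2))"
      using std_normal_tail[OF L] law[of "{t. t < - L}"] by (simp add: M.emeasure_eq_measure)
    then show ?thesis by (subst (asm) ennreal_le_iff) auto
  qed
  finally have "measure M {\<omega>\<in>space M. Q (\<lambda>i. V i \<omega>)} - exp (- L\<^sup>2 / 2) \<le> measure (M \<Otimes>\<^sub>M M) E2"
    unfolding E2 by simp
  then have "e * (measure M {\<omega>\<in>space M. Q (\<lambda>i. V i \<omega>)} - exp (- L\<^sup>2 / 2)) \<le> e * measure (M \<Otimes>\<^sub>M M) E2"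
    by (intro mult_left_mono) (auto simp: e_def)
  with main show ?thesis unfolding E1 e_def by (rule order_trans[rotated])
qed

section \<open>Fernique's tail estimate\<close>

definition prob_exceed :: "'a measure \<Rightarrow> ('i \<Rightarrow> 'a \<Rightarrow> real) \<Rightarrow> 'i set \<Rightarrow> real \<Rightarrow> real" where
  "prob_exceed M V D t = measure M {\<omega>\<in>space M. \<exists>i\<in>D. \<bar>V i \<omega>\<bar> > t}"

text \<open>
  Rotating two independent copies by 45 degrees preserves their law. If the rotated difference is at
  most \<open>s\<close> and the rotated sum exceeds \<open>sqrt 2 * t + s\<close> in absolute value, then both copies exceed
  \<open>t\<close>.
\<close>

lemma fernique_step:
  fixes V :: "'i \<Rightarrow> 'a \<Rightarrow> real"
  assumes V: "gaussian_family M V" and D: "countable D"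
  shows "(1 - prob_exceed M V D s) * prob_exceed M V D (sqrt 2 * t + s) \<le> (prob_exceed M V D t)\<^sup>2"
proof -
  interpret M: prob_space M by (rule gaussian_familyD[OF V])
  interpret P: pair_prob_space M M ..
  note [measurable] = gaussian_familyD(2)[OF V]
  define U where "U = case_sum (\<lambda>i z. V i (fst z)) (\<lambda>j z. V j (snd z :: 'a))"
  note U = gaussian_family_pair[OF V V, folded U_def]
  define r where "r = 1 / sqrt 2"
  have rr: "r * r = 1 / 2" by (simp add: r_def)
  define a c where "a k = r" and "c k = (case k of Inl _ \<Rightarrow> - r | Inr _ \<Rightarrow> r)" for k :: "'i + 'i"
  define p q where "p k = (case k of Inl i \<Rightarrow> Inl i | Inr i \<Rightarrow> (Inl i :: 'i + 'i))"
    and "q k = (case k of Inl i \<Rightarrow> Inr i | Inr i \<Rightarrow> (Inr i :: 'i + 'i))"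
    for k :: "'i + 'i"
  \<comment> \<open>The rotated pair: differences at the indices \<open>Inl i\<close>, sums at \<open>Inr i\<close>.\<close>
  define W where "W k z = a k * U (p k) z + c k * U (q k) z" for k z
  have W: "gaussian_family (M \<Otimes>\<^sub>M M) W"
    unfolding W_def by (rule gaussian_family_linear2[OF U(1)])
  have cov: "(\<integral>z. U k z * U k' z \<partial>(M \<Otimes>\<^sub>M M)) = (\<integral>z. W k z * W k' z \<partial>(M \<Otimes>\<^sub>M M))" for k k'
    unfolding W_def gaussian_family_linear2(2)[OF U(1)]
    by (cases k; cases k') (simp_all add: a_def c_def p_def q_def U(2,3,4,5) rr)
  define Q where "Q x \<longleftrightarrow> (\<forall>i\<in>D. \<bar>x (Inl i)\<bar> \<le> s) \<and> (\<exists>i\<in>D. \<bar>x (Inr i)\<bar> > sqrt 2 * t + s)" for x :: "'i + 'i \<Rightarrow> real"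
  have Q: "Measurable.pred path_space Q"
  proof -
    have "Measurable.pred path_space (\<lambda>x::'i + 'i \<Rightarrow> real. \<forall>i\<in>D. \<bar>x (Inl i)\<bar> \<le> s)"
      by (rule pred_countable_Ball[OF D]) measurable
    moreover have "Measurable.pred path_space (\<lambda>x::'i + 'i \<Rightarrow> real. \<exists>i\<in>D. \<bar>x (Inr i)\<bar> > sqrt 2 * t + s)"
      by (rule pred_countable_Bex[OF D]) measurable
    ultimately show ?thesis unfolding Q_def by (intro pred_intros_logic)
  qed
  have times: "measure (M \<Otimes>\<^sub>M M) (A \<times> B) = measure M A * measure M B" if "A \<in> sets M" "B \<in> sets M" for A B
    using M.emeasure_pair_measure_Times[OF that]
    by (simp add: P.emeasure_eq_measure M.emeasure_eq_measure ennreal_mult[symmetric])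
  have [measurable]: "{\<omega>\<in>space M. \<exists>i\<in>D. \<bar>V i \<omega>\<bar> > u} \<in> sets M" for u
    unfolding pred_def[symmetric] by (rule pred_countable_Bex[OF D]) measurable
  have [measurable]: "{\<omega>\<in>space M. \<forall>i\<in>D. \<bar>V i \<omega>\<bar> \<le> u} \<in> sets M" for u
    unfolding pred_def[symmetric] by (rule pred_countable_Ball[OF D]) measurable
  have compl: "measure M {\<omega>\<in>space M. \<forall>i\<in>D. \<bar>V i \<omega>\<bar> \<le> s} = 1 - prob_exceed M V D s"
    unfolding prob_exceed_def
    by (subst M.prob_compl[symmetric]) (auto intro!: arg_cong[where f="measure M"] simp: not_less)
  have "(1 - prob_exceed M V D s) * prob_exceed M V D (sqrt 2 * t + s)
    = measure (M \<Otimes>\<^sub>M M) ({\<omega>\<in>space M. \<forall>i\<in>D. \<bar>V i \<omega>\<bar> \<le> s} \<times> {\<omega>\<in>space M. \<exists>i\<in>D. \<bar>V i \<omega>\<bar> > sqrt 2 * t + s})"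
    by (subst times) (auto simp: compl prob_exceed_def)
  also have "\<dots> = measure (M \<Otimes>\<^sub>M M) {z\<in>space (M \<Otimes>\<^sub>M M). Q (\<lambda>k. U k z)}"
    by (intro arg_cong[where f="measure (M \<Otimes>\<^sub>M M)"]) (auto simp: Q_def U_def space_pair_measure)
  also have "\<dots> = measure (M \<Otimes>\<^sub>M M) {z\<in>space (M \<Otimes>\<^sub>M M). Q (\<lambda>k. W k z)}"
    by (rule gaussian_family_prob_eq[OF U(1) W cov Q])
  also have "\<dots> \<le> measure (M \<Otimes>\<^sub>M M) ({\<omega>\<in>space M. \<exists>i\<in>D. \<bar>V i \<omega>\<bar> > t} \<times> {\<omega>\<in>space M. \<exists>i\<in>D. \<bar>V i \<omega>\<bar> > t})"
  proof (intro P.finite_measure_mono subsetI)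
    fix z assume z: "z \<in> {z\<in>space (M \<Otimes>\<^sub>M M). Q (\<lambda>k. W k z)}"
    then obtain i where i: "i \<in> D" "\<bar>W (Inr i) z\<bar> > sqrt 2 * t + s" "\<bar>W (Inl i) z\<bar> \<le> s"
      by (auto simp: Q_def)
    define x y where "x = V i (fst z)" and "y = V i (snd z)"
    have W: "sqrt 2 * W (Inr i) z = x + y" "sqrt 2 * W (Inl i) z = x - y"
      by (simp_all add: W_def a_def c_def p_def q_def U_def r_def x_def y_def field_simps)
    have "sqrt 2 * (sqrt 2 * t + s) < sqrt 2 * \<bar>W (Inr i) z\<bar>" using i by simp
    also have "\<dots> = \<bar>x + y\<bar>" unfolding W(1)[symmetric] by (simp add: abs_mult)
    finally have 1: "2 * t + sqrt 2 * s < \<bar>x + y\<bar>" by (simp add: distrib_left mult.assoc[symmetric])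
    have "\<bar>x - y\<bar> = sqrt 2 * \<bar>W (Inl i) z\<bar>" unfolding W(2)[symmetric] by (simp add: abs_mult)
    also have "\<dots> \<le> sqrt 2 * s" using i by simp
    finally have 2: "\<bar>x - y\<bar> \<le> sqrt 2 * s" .
    have "\<bar>x\<bar> > t" "\<bar>y\<bar> > t" using 1 2 by linarith+
    then show "z \<in> {\<omega>\<in>space M. \<exists>i\<in>D. \<bar>V i \<omega>\<bar> > t} \<times> {\<omega>\<in>space M. \<exists>i\<in>D. \<bar>V i \<omega>\<bar> > t}"
      using z i(1) by (cases z) (auto simp: x_def y_def space_pair_measure)
  qed auto
  also have "\<dots> = (prob_exceed M V D t)\<^sup>2"
    by (subst times) (auto simp: prob_exceed_def power2_eq_square)
  finally show ?thesis .
qed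

lemma prob_exceed_antimono:
  assumes V: "gaussian_family M V" and D: "countable D" and "s \<le> t"
  shows "prob_exceed M V D t \<le> prob_exceed M V D s"
proof -
  interpret M: prob_space M by (rule gaussian_familyD[OF V])
  note [measurable] = gaussian_familyD(2)[OF V]
  show ?thesis unfolding prob_exceed_def
  proof (rule M.finite_measure_mono)
    show "{\<omega>\<in>space M. \<exists>i\<in>D. t < \<bar>V i \<omega>\<bar>} \<subseteq> {\<omega>\<in>space M. \<exists>i\<in>D. s < \<bar>V i \<omega>\<bar>}"
      using \<open>s \<le> t\<close> le_less_trans by blast
    show "{\<omega>\<in>space M. \<exists>i\<in>D. s < \<bar>V i \<omega>\<bar>} \<in> sets M"
      unfolding pred_def[symmetric] by (rule pred_countable_Bex[OF D]) measurable
  qed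
qed

text \<open>
  The inequality of the preceding lemma squares the tail while the level at most doubles, so the tail
  at \<open>2 ^ n * (2 * s)\<close> is at most \<open>(1 / 3) ^ (2 ^ n)\<close>. The true tail is Gaussian; an exponential bound
  is enough here because it is applied at levels that grow exponentially in logarithmic time.
\<close>

theorem fernique_tail:
  fixes V :: "'i \<Rightarrow> 'a \<Rightarrow> real"
  assumes V: "gaussian_family M V" and D: "countable D" and s: "s > 0" "prob_exceed M V D s \<le> 1/4"
    and t: "t \<ge> 2 * s"
  shows "prob_exceed M V D t \<le> exp (- t / (4 * s))"
proof -
  let ?F = "prob_exceed M V D"
  have F0: "?F u \<ge> 0" for u by (simp add: prob_exceed_def)
  have step: "4 / 3 * ?F (2 * u) \<le> (4 / 3 * ?F u)\<^sup>2" if "u \<ge> 2 * s" for u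
  proof -
    have "sqrt 2 \<le> 3 / 2" by (rule real_le_lsqrt) (auto simp: power2_eq_square)
    then have "sqrt 2 * u \<le> 3 / 2 * u" using that s by (intro mult_right_mono) auto
    then have "?F (2 * u) \<le> ?F (sqrt 2 * u + s)"
      using that by (intro prob_exceed_antimono[OF V D]) linarith
    moreover have "3 / 4 * ?F (sqrt 2 * u + s) \<le> (1 - ?F s) * ?F (sqrt 2 * u + s)"
      using s F0 by (intro mult_right_mono) auto
    ultimately have "3 / 4 * ?F (2 * u) \<le> (?F u)\<^sup>2"
      using fernique_step[OF V D, of s u] by linarith
    then show ?thesis by (simp add: power2_eq_square)
  qed
  have iter: "4 / 3 * ?F (2 ^ n * (2 * s)) \<le> (1 / 3) ^ (2 ^ n)" for n
  proof (induction n)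
    case 0
    have "?F (2 * s) \<le> ?F s" using s by (intro prob_exceed_antimono[OF V D]) auto
    then show ?case using s by simp
  next
    case (Suc n)
    have "2 ^ n * (2 * s) \<ge> 1 * (2 * s)" using s by (intro mult_right_mono) auto
    then have "4 / 3 * ?F (2 * (2 ^ n * (2 * s))) \<le> (4 / 3 * ?F (2 ^ n * (2 * s)))\<^sup>2" by (intro step) simp
    also have "\<dots> \<le> ((1 / 3) ^ (2 ^ n))\<^sup>2" using Suc F0 by (intro power_mono) auto
    finally show ?case by (simp add: power_mult[symmetric] mult_ac)
  qed
  obtain m where "t < 2 ^ m * (2 * s)"
  proof -
    obtain m where "t / (2 * s) < 2 ^ m" using real_arch_pow[of 2 "t / (2 * s)"] by auto
    then show ?thesis using that s by (simp add: field_simps)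
  qed
  define n where "n = (LEAST m. t < 2 ^ m * (2 * s)) - 1"
  have L: "t < 2 ^ (LEAST m. t < 2 ^ m * (2 * s)) * (2 * s)" by (rule LeastI) fact
  have "(LEAST m. t < 2 ^ m * (2 * s)) \<noteq> 0"
  proof
    assume "(LEAST m. t < 2 ^ m * (2 * s)) = 0"
    with L t show False by simp
  qed
  then have Suc: "(LEAST m. t < 2 ^ m * (2 * s)) = Suc n" by (simp add: n_def)
  have up: "t < 2 ^ Suc n * (2 * s)" using L unfolding Suc .
  have lo: "2 ^ n * (2 * s) \<le> t"
    using not_less_Least[of n "\<lambda>m. t < 2 ^ m * (2 * s)"] unfolding Suc by simp
  have "?F t \<le> ?F (2 ^ n * (2 * s))" using lo by (rule prob_exceed_antimono[OF V D])
  also have "\<dots> \<le> 4 / 3 * ?F (2 ^ n * (2 * s))" using F0[of "2 ^ n * (2 * s)"] by simp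
  also have "\<dots> \<le> (1 / 3) ^ (2 ^ n)" by (rule iter)
  also have "\<dots> \<le> exp (- 1) ^ (2 ^ n)"
  proof (rule power_mono)
    show "1 / 3 \<le> exp (- 1 :: real)" using exp_le by (simp add: exp_minus field_simps)
  qed auto
  also have "\<dots> = exp (- (2 ^ n))" by (simp add: exp_of_nat_mult[symmetric])
  also have "\<dots> \<le> exp (- t / (4 * s))" using up s by (simp add: field_simps)
  finally show ?thesis .
qed

lemma prob_exceed_small:
  fixes V :: "'i \<Rightarrow> 'a \<Rightarrow> real"
  assumes V: "gaussian_family M V" and D: "countable D"
    and bdd: "AE \<omega> in M. \<exists>B. \<forall>i\<in>D. \<bar>V i \<omega>\<bar> \<le> B" and e: "e > 0"
  shows "\<exists>s>0. prob_exceed M V D s \<le> e"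
proof -
  interpret M: prob_space M by (rule gaussian_familyD[OF V])
  note [measurable] = gaussian_familyD(2)[OF V]
  define A where "A n = {\<omega>\<in>space M. \<exists>i\<in>D. \<bar>V i \<omega>\<bar> > real n}" for n
  have [measurable]: "A n \<in> sets M" for n
    unfolding A_def pred_def[symmetric] by (rule pred_countable_Bex[OF D]) measurable
  have "decseq A" unfolding A_def
  proof (intro decseq_SucI subsetI)
    fix n \<omega> assume "\<omega> \<in> {\<omega>\<in>space M. \<exists>i\<in>D. real (Suc n) < \<bar>V i \<omega>\<bar>}"
    then obtain i where "\<omega> \<in> space M" "i \<in> D" "real (Suc n) < \<bar>V i \<omega>\<bar>" by auto
    then show "\<omega> \<in> {\<omega>\<in>space M. \<exists>i\<in>D. real n < \<bar>V i \<omega>\<bar>}" by (auto intro!: bexI[of _ i])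
  qed
  then have "(\<lambda>n. measure M (A n)) \<longlonglongrightarrow> measure M (\<Inter>n. A n)"
    by (intro M.finite_Lim_measure_decseq) auto
  moreover have "measure M (\<Inter>n. A n) = 0"
  proof (subst M.prob_eq_0)
    show "AE \<omega> in M. \<omega> \<notin> (\<Inter>n. A n)"
      using bdd
    proof eventually_elim
      case (elim \<omega>)
      then obtain B where B: "\<And>i. i \<in> D \<Longrightarrow> \<bar>V i \<omega>\<bar> \<le> B" by blast
      obtain n where "B \<le> real n" using real_arch_simple by blast
      then have "\<omega> \<notin> A n" using B by (force simp: A_def)
      then show ?case by blast
    qed
  qed auto
  ultimately have "(\<lambda>n. measure M (A n)) \<longlonglongrightarrow> 0" by simp
  then have "eventually (\<lambda>n. measure M (A n) < e) sequentially" using e by (rule order_tendstoD)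
  then have "eventually (\<lambda>n. measure M (A n) < e \<and> n > 0) sequentially"
    using eventually_gt_at_top by (rule eventually_conj)
  then obtain n where "measure M (A n) < e" "n > 0" by (auto simp: eventually_sequentially)
  then show ?thesis by (intro exI[of _ "real n"]) (auto simp: prob_exceed_def A_def)
qed

section \<open>The cost of lowering the level of a stationary process\<close>

text \<open>
  The number of terms is at most \<open>x / 2 + 1\<close> with \<open>x = u / a\<close>, and each is at most \<open>2 / x\<close>.
\<close>

lemma sum_inverse_dyadic_window:
  fixes u a :: real
  assumes a: "a > 0"
  shows "(\<Sum>m. ennreal (1 / real (Suc m)) * indicator {real (Suc m) * a .. 2 * (real (Suc m) * a)} u) \<le> 3"
proof -
  define x where "x = u / a"
  define S where "S = {m. x / 2 \<le> real (Suc m) \<and> real (Suc m) \<le> x}"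
  have mem: "u \<in> {real (Suc m) * a .. 2 * (real (Suc m) * a)} \<longleftrightarrow> m \<in> S" for m
    using a by (auto simp: S_def x_def field_simps)
  have finS: "finite S"
    by (rule finite_subset[of _ "{..nat \<lceil>x\<rceil>}"]) (auto simp: S_def, linarith)
  have "(\<Sum>m. ennreal (1 / real (Suc m)) * indicator {real (Suc m) * a .. 2 * (real (Suc m) * a)} u)
      = (\<Sum>m\<in>S. ennreal (1 / real (Suc m)) * indicator {real (Suc m) * a .. 2 * (real (Suc m) * a)} u)"
    using mem by (intro suminf_finite finS) (auto simp: indicator_def)
  also have "\<dots> = (\<Sum>m\<in>S. ennreal (1 / real (Suc m)))"
    using mem by (intro sum.cong) (auto simp: indicator_def)
  also have "\<dots> = ennreal (\<Sum>m\<in>S. 1 / real (Suc m))" by (rule sum_ennreal) auto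
  also have "(\<Sum>m\<in>S. 1 / real (Suc m)) \<le> 3"
  proof (cases "S = {}")
    case False
    then obtain m0 where "m0 \<in> S" by blast
    then have x1: "x \<ge> 1" by (auto simp: S_def)
    have "S \<subseteq> {nat \<lceil>x / 2\<rceil> - 1 .. nat \<lfloor>x\<rfloor> - 1}"
    proof
      fix m assume "m \<in> S"
      then have "\<lceil>x / 2\<rceil> \<le> int (Suc m)" "int (Suc m) \<le> \<lfloor>x\<rfloor>"
        by (simp_all add: S_def ceiling_le_iff le_floor_iff)
      then show "m \<in> {nat \<lceil>x / 2\<rceil> - 1 .. nat \<lfloor>x\<rfloor> - 1}" by auto
    qed
    then have "card S \<le> card {nat \<lceil>x / 2\<rceil> - 1 .. nat \<lfloor>x\<rfloor> - 1}" by (intro card_mono) auto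
    then have "real (card S) \<le> x / 2 + 1"
      using x1 by simp linarith
    moreover have "1 / real (Suc m) \<le> 2 / x" if "m \<in> S" for m
      using that x1 by (auto simp: S_def field_simps)
    then have "(\<Sum>m\<in>S. 1 / real (Suc m)) \<le> of_nat (card S) * (2 / x)" by (rule sum_bounded_above)
    ultimately have "(\<Sum>m\<in>S. 1 / real (Suc m)) \<le> (x / 2 + 1) * (2 / x)"
      using x1 by (smt (verit) divide_nonneg_nonneg mult_right_mono)
    also have "\<dots> = 1 + 2 / x" using x1 by (simp add: field_simps)
    also have "\<dots> \<le> 3" using x1 by (simp add: field_simps)
    finally show ?thesis .
  qed simp
  then have "ennreal (\<Sum>m\<in>S. 1 / real (Suc m)) \<le> ennreal 3" by (rule ennreal_leI)
  finally show ?thesis by simp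
qed

text \<open>
  Integrability of \<open>r\<close> does not make \<open>r\<close> summable along a given lattice. But the sums over the
  lattices of mesh \<open>\<eta> \<in> {a..2 * a}\<close> have a finite integral over \<open>\<eta>\<close>: after the substitution
  \<open>u = m * \<eta>\<close>, the point \<open>u\<close> is counted with the weights \<open>1 / m\<close> for \<open>m\<close> between \<open>u / (2 * a)\<close> and
  \<open>u / a\<close>, and these add up to at most \<open>3\<close>. So some mesh works.
\<close>

lemma exists_summable_mesh:
  fixes r :: "real \<Rightarrow> real"
  assumes int: "integrable lborel r" and r0: "\<And>u. r u \<ge> 0" and a: "a > 0"
  obtains \<eta> where "a \<le> \<eta>" "\<eta> \<le> 2 * a" "summable (\<lambda>m. r (real (Suc m) * \<eta>))"
proof -
  have [measurable]: "r \<in> borel_measurable borel" using int by auto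
  let ?w = "\<lambda>m u. ennreal (1 / real (Suc m)) * indicator {real (Suc m) * a .. 2 * (real (Suc m) * a)} u :: ennreal"
  have one: "(\<integral>\<^sup>+\<eta>. ennreal (r (real (Suc m) * \<eta>)) * indicator {a..2*a} \<eta> \<partial>lborel)
     = (\<integral>\<^sup>+u. ennreal (r u) * ?w m u \<partial>lborel)" for m
  proof -
    have "(\<integral>\<^sup>+u. ennreal (r u) * ?w m u \<partial>lborel)
      = ennreal \<bar>real (Suc m)\<bar> * (\<integral>\<^sup>+\<eta>. ennreal (r (0 + real (Suc m) * \<eta>)) * ?w m (0 + real (Suc m) * \<eta>) \<partial>lborel)"
      by (rule nn_integral_real_affine) auto
    also have "\<dots> = (\<integral>\<^sup>+\<eta>. ennreal (real (Suc m)) * (ennreal (r (real (Suc m) * \<eta>)) * ?w m (real (Suc m) * \<eta>)) \<partial>lborel)"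
      by (subst nn_integral_cmult) auto
    also have "\<dots> = (\<integral>\<^sup>+\<eta>. ennreal (r (real (Suc m) * \<eta>)) * indicator {a..2*a} \<eta> \<partial>lborel)"
    proof (rule nn_integral_cong)
      fix \<eta> :: real
      have "real (Suc m) * \<eta> \<in> {real (Suc m) * a .. 2 * (real (Suc m) * a)} \<longleftrightarrow> \<eta> \<in> {a..2*a}"
      proof -
        have "2 * (real (Suc m) * a) = real (Suc m) * (2 * a)" by simp
        then show ?thesis by (simp only: atLeastAtMost_iff mult_le_cancel_left_pos of_nat_0_less_iff zero_less_Suc)
      qed
      then have i: "indicator {real (Suc m) * a .. 2 * (real (Suc m) * a)} (real (Suc m) * \<eta>) = (indicator {a..2*a} \<eta> :: ennreal)"
        by (simp only: indicator_def)
      have assoc: "A * (R * (B * I)) = A * B * (R * I)" for A R B I :: ennreal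
        by (simp add: mult_ac)
      have e1: "ennreal (real (Suc m)) * ennreal (1 / real (Suc m)) = 1"
        by (subst ennreal_mult[symmetric]) auto
      show "ennreal (real (Suc m)) * (ennreal (r (real (Suc m) * \<eta>)) * ?w m (real (Suc m) * \<eta>))
        = ennreal (r (real (Suc m) * \<eta>)) * indicator {a..2*a} \<eta>"
        by (simp only: i assoc e1 mult_1)
    qed
    finally show ?thesis by simp
  qed
  have "(\<integral>\<^sup>+\<eta>. (\<Sum>m. ennreal (r (real (Suc m) * \<eta>)) * indicator {a..2*a} \<eta>) \<partial>lborel)
      = (\<Sum>m. \<integral>\<^sup>+u. ennreal (r u) * ?w m u \<partial>lborel)"
    by (subst nn_integral_suminf, measurable) (simp only: one)
  also have "\<dots> = (\<integral>\<^sup>+u. (\<Sum>m. ennreal (r u) * ?w m u) \<partial>lborel)"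
    by (subst nn_integral_suminf) measurable
  also have "\<dots> \<le> (\<integral>\<^sup>+u. ennreal (r u) * 3 \<partial>lborel)"
    using sum_inverse_dyadic_window[OF a] by (intro nn_integral_mono) (simp only: ennreal_suminf_cmult mult_left_mono zero_le)
  also have "\<dots> = (\<integral>\<^sup>+u. ennreal (r u) \<partial>lborel) * 3"
    by (rule nn_integral_multc) auto
  also have "\<dots> < \<infinity>"
    using int r0 by (simp add: nn_integral_eq_integral ennreal_mult_less_top)
  finally have "(\<integral>\<^sup>+\<eta>. (\<Sum>m. ennreal (r (real (Suc m) * \<eta>)) * indicator {a..2*a} \<eta>) \<partial>lborel) \<noteq> \<infinity>" by simp
  then have ae: "AE \<eta> in lborel. (\<Sum>m. ennreal (r (real (Suc m) * \<eta>)) * indicator {a..2*a} \<eta>) \<noteq> \<infinity>"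
    by (rule nn_integral_noteq_infinite[rotated]) measurable
  have "\<exists>\<eta>\<in>{a..2*a}. (\<Sum>m. ennreal (r (real (Suc m) * \<eta>)) * indicator {a..2*a} \<eta>) \<noteq> \<infinity>"
  proof (rule ccontr)
    assume neg: "\<not> ?thesis"
    have "AE \<eta> in lborel. \<eta> \<notin> {a..2*a}" using ae by eventually_elim (use neg in auto)
    then have "{a..2*a} \<in> null_sets lborel" by (subst AE_iff_null_sets) auto
    then have "emeasure lborel {a..2*a} = 0" by blast
    then show False using a by simp
  qed
  then obtain \<eta> where \<eta>: "\<eta> \<in> {a..2*a}" "(\<Sum>m. ennreal (r (real (Suc m) * \<eta>))) \<noteq> \<infinity>"
    by (auto simp: indicator_def)
  have "summable (\<lambda>m. r (real (Suc m) * \<eta>))"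
    using \<eta>(2) r0 by (intro summable_suminf_not_top) auto
  then show ?thesis using \<eta> that by auto
qed

text \<open>
  Lowering the level by \<open>\<delta>\<close> on an interval of length \<open>N\<close> costs only a factor
  \<open>exp (- \<gamma> * N - C * \<delta>\<^sup>2 * N)\<close>, up to an error \<open>exp (- \<gamma>\<^sup>2 * N / (C * \<delta>\<^sup>2))\<close>. For small \<open>\<delta>\<close> the
  parameter \<open>\<gamma>\<close> can be taken small as well while the error decays faster than any prescribed
  exponential; hence the persistence rate is continuous in the level.

  The shift is in the direction of \<open>G\<close>, the sum of \<open>Z (k * \<eta>)\<close> over the lattice points of the interval.
  Non-negative correlations and continuity of \<open>r\<close> at \<open>0\<close> make the covariance of \<open>Z \<tau>\<close> and \<open>G\<close> at least
  \<open>r 0 / 2\<close> for every \<open>\<tau>\<close> in the interval, while summability of \<open>r\<close> along the lattice makes the variance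
  of \<open>G\<close> of order \<open>N\<close>. So a shift by \<open>\<delta>\<close> has squared Cameron-Martin norm of order \<open>\<delta>\<^sup>2 * N\<close>.
\<close>

theorem stationary_shift_bound:
  fixes Z :: "real \<Rightarrow> 'a \<Rightarrow> real" and r :: "real \<Rightarrow> real"
  assumes Z: "gaussian_family M Z" and cov: "\<And>s t. (\<integral>\<omega>. Z s \<omega> * Z t \<omega> \<partial>M) = r (t - s)"
    and nonneg: "\<And>u. r u \<ge> 0" and cont: "continuous_on UNIV r" and int: "integrable lborel r" and pos: "r 0 > 0"
  shows "\<exists>C>0. \<forall>N\<ge>1. \<forall>\<delta>>0. \<forall>\<gamma>>0. \<forall>l::real.
     exp (- \<gamma> * N - C * \<delta>\<^sup>2 * N) * (prob_below M Z (\<rat> \<inter> {0..N}) (\<lambda>_. l) - exp (- \<gamma>\<^sup>2 * N / (C * \<delta>\<^sup>2)))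
       \<le> prob_below M Z (\<rat> \<inter> {0..N}) (\<lambda>_. l - \<delta>)"
proof -
  interpret prob_space M by (rule gaussian_familyD[OF Z])
  note [measurable] = gaussian_familyD(2)[OF Z]
  have even: "r (- u) = r u" for u
  proof -
    have "(\<integral>\<omega>. Z 0 \<omega> * Z u \<omega> \<partial>M) = (\<integral>\<omega>. Z u \<omega> * Z 0 \<omega> \<partial>M)"
      by (intro Bochner_Integration.integral_cong refl mult.commute)
    then show ?thesis unfolding cov by simp
  qed
  obtain d where d: "d > 0" "\<And>u. \<bar>u\<bar> < d \<Longrightarrow> \<bar>r u - r 0\<bar> < r 0 / 2"
    using cont[unfolded continuous_on_iff, rule_format, of 0 "r 0 / 2"] pos by (auto simp: dist_real_def)
  define a where "a = d / 4"
  have a: "a > 0" using d by (simp add: a_def)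
  \<comment> \<open>The radius \<open>2 * a\<close> covers the distance from a time to the lattice point below it, as the mesh
    will be at most \<open>2 * a\<close>.\<close>
  have near: "r u \<ge> r 0 / 2" if "\<bar>u\<bar> \<le> 2 * a" for u
  proof -
    have "\<bar>u\<bar> < d" using that d(1) by (simp add: a_def)
    from d(2)[OF this] show ?thesis by linarith
  qed
  obtain \<eta> where \<eta>: "a \<le> \<eta>" "\<eta> \<le> 2 * a" and summ: "summable (\<lambda>m. r (real (Suc m) * \<eta>))"
    by (rule exists_summable_mesh[OF int nonneg a])
  have \<eta>0: "\<eta> > 0" using \<eta> a by linarith
  define \<rho> where "\<rho> m = r (real m * \<eta>)" for m
  define K where "K = (\<Sum>m. r (real (Suc m) * \<eta>))"
  have K: "(\<Sum>m<n. \<rho> (Suc m)) \<le> K" for n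
    unfolding K_def \<rho>_def by (rule sum_le_suminf[OF summ]) (use nonneg in auto)
  have K0: "K \<ge> 0" using K[of 0] by simp
  define \<kappa> where "\<kappa> = (1 / \<eta> + 2) * (r 0 + 2 * K)"
  have \<kappa>: "\<kappa> > 0" using \<eta>0 pos K0 by (simp add: \<kappa>_def add_pos_nonneg)
  define C where "C = 8 * \<kappa> / (r 0)\<^sup>2"
  have C: "C > 0" using \<kappa> pos by (simp add: C_def)
  \<comment> \<open>A row sum of the covariance matrix of the lattice values.\<close>
  have row: "(\<Sum>l\<le>n. r (real l * \<eta> - real k * \<eta>)) \<le> r 0 + 2 * K" if "k \<le> n" for k n
  proof -
    have "{..n} = {..<k} \<union> ({k} \<union> {Suc k..n})" using that by auto
    then have "(\<Sum>l\<le>n. r (real l * \<eta> - real k * \<eta>)) =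
        (\<Sum>l<k. r (real l * \<eta> - real k * \<eta>)) + (r 0 + (\<Sum>l=Suc k..n. r (real l * \<eta> - real k * \<eta>)))"
      by (simp, subst sum.union_disjoint) auto
    also have "(\<Sum>l<k. r (real l * \<eta> - real k * \<eta>)) = (\<Sum>l<k. \<rho> (Suc (k - Suc l)))"
    proof (intro sum.cong refl)
      fix l assume "l \<in> {..<k}"
      then have "real l * \<eta> - real k * \<eta> = - (real (Suc (k - Suc l)) * \<eta>)"
        by (simp add: of_nat_diff algebra_simps)
      then show "r (real l * \<eta> - real k * \<eta>) = \<rho> (Suc (k - Suc l))"
        unfolding \<rho>_def by (simp only: even)
    qed
    also have "\<dots> = (\<Sum>m<k. \<rho> (Suc m))" by (rule sum.nat_diff_reindex)
    also have "(\<Sum>l=Suc k..n. r (real l * \<eta> - real k * \<eta>)) = (\<Sum>m<n - k. \<rho> (Suc m))"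
    proof (rule sum.reindex_bij_witness[of _ "\<lambda>m. Suc (m + k)" "\<lambda>l. l - Suc k"])
      fix l assume "l \<in> {Suc k..n}"
      then show "\<rho> (Suc (l - Suc k)) = r (real l * \<eta> - real k * \<eta>)"
        by (simp add: \<rho>_def of_nat_diff algebra_simps)
    qed (use that in auto)
    finally show ?thesis using K[of k] K[of "n - k"] by linarith
  qed
  show ?thesis
  proof (intro exI[of _ C] conjI C allI impI)
    fix N \<delta> \<gamma> l :: real
    assume N: "N \<ge> 1" and \<delta>: "\<delta> > 0" and \<gamma>: "\<gamma> > 0"
    define n where "n = nat \<lceil>N / \<eta>\<rceil>"
    have n: "N / \<eta> \<le> real n" "real n \<le> N / \<eta> + 1" using N \<eta>0 by (simp_all add: n_def)
    define v where "v = (\<Sum>k\<le>n. \<Sum>l\<le>n. r (real l * \<eta> - real k * \<eta>))"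
    define \<sigma> where "\<sigma> = sqrt v"
    have v0: "v > 0"
    proof -
      have "0 < r (real 0 * \<eta> - real 0 * \<eta>)" using pos by simp
      also have "\<dots> \<le> (\<Sum>l\<le>n. r (real l * \<eta> - real 0 * \<eta>))"
        by (rule member_le_sum) (use nonneg in auto)
      also have "\<dots> \<le> v" unfolding v_def
        by (rule member_le_sum[of 0 "{..n}" "\<lambda>k. \<Sum>l\<le>n. r (real l * \<eta> - real k * \<eta>)"]) (use nonneg in \<open>auto intro: sum_nonneg\<close>)
      finally show ?thesis .
    qed
    have \<sigma>: "\<sigma> > 0" "\<sigma>\<^sup>2 = v" using v0 by (simp_all add: \<sigma>_def)
    have vle: "v \<le> \<kappa> * N"
    proof -
      have "v \<le> (\<Sum>k\<le>n. r 0 + 2 * K)" unfolding v_def by (intro sum_mono row) auto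
      also have "\<dots> = (real n + 1) * (r 0 + 2 * K)" by simp
      also have "\<dots> \<le> (N / \<eta> + 2) * (r 0 + 2 * K)" using n pos K0 by (intro mult_right_mono) auto
      also have "\<dots> \<le> (N * (1 / \<eta> + 2)) * (r 0 + 2 * K)" using N pos K0 by (intro mult_right_mono) (auto simp: distrib_left)
      finally show ?thesis by (simp add: \<kappa>_def mult_ac)
    qed
    define A where "A k = (case k of None \<Rightarrow> (\<lambda>k. real k * \<eta>) ` {..n} | Some \<tau> \<Rightarrow> {\<tau>})" for k :: "real option"
    define c where "c k = (case k of None \<Rightarrow> 1 / \<sigma> | Some \<tau> \<Rightarrow> 1)" for k :: "real option"
    define V where "V k \<omega> = (\<Sum>\<tau>\<in>A k. c k * Z \<tau> \<omega>)" for k \<omega>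
    have finA: "finite (A k)" for k by (cases k) (auto simp: A_def)
    have V: "gaussian_family M V"
      unfolding V_def by (rule gaussian_family_linear[OF Z finA])
    have inj: "inj_on (\<lambda>k. real k * \<eta>) {..n}" using \<eta>0 by (auto simp: inj_on_def)
    have VS: "V (Some \<tau>) = Z \<tau>" for \<tau> by (auto simp: V_def A_def c_def)
    have one: "(\<integral>\<omega>. (V None \<omega>)\<^sup>2 \<partial>M) = 1"
    proof -
      have "(\<integral>\<omega>. (V None \<omega>)\<^sup>2 \<partial>M) = (\<Sum>k\<le>n. \<Sum>l\<le>n. (1 / \<sigma> * (1 / \<sigma>)) * r (real l * \<eta> - real k * \<eta>))"
        unfolding V_def power2_eq_square gaussian_family_bilinear[OF Z] cov
        by (simp add: A_def c_def sum.reindex[OF inj])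
      also have "\<dots> = (1 / \<sigma> * (1 / \<sigma>)) * v" unfolding v_def by (simp only: sum_distrib_left)
      also have "\<dots> = 1" using \<sigma> v0 by (simp add: power2_eq_square[symmetric] power_divide)
      finally show ?thesis .
    qed
    define b where "b k = (\<integral>\<omega>. V k \<omega> * V None \<omega> \<partial>M)" for k
    have bge: "b (Some \<tau>) \<ge> r 0 / (2 * \<sigma>)" if \<tau>: "0 \<le> \<tau>" "\<tau> \<le> N" for \<tau>
    proof -
      have bsum: "b (Some \<tau>) = (\<Sum>k\<le>n. 1 / \<sigma> * r (real k * \<eta> - \<tau>))"
        unfolding b_def V_def gaussian_family_bilinear[OF Z] cov
        by (simp add: A_def c_def sum.reindex[OF inj])
      \<comment> \<open>The lattice point just below \<open>\<tau>\<close>; its term alone gives the bound because \<open>r\<close> is non-negative.\<close>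
      define k where "k = nat \<lfloor>\<tau> / \<eta>\<rfloor>"
      have k: "real k \<le> \<tau> / \<eta>" "\<tau> / \<eta> < real k + 1" using \<tau> \<eta>0 by (simp_all add: k_def)
      have "\<tau> / \<eta> \<le> N / \<eta>" using \<tau> \<eta>0 by (intro divide_right_mono) auto
      then have kn: "k \<le> n" using k n by linarith
      have "\<bar>real k * \<eta> - \<tau>\<bar> \<le> 2 * a" using k \<eta> \<eta>0 by (auto simp: field_simps abs_le_iff)
      then have "r 0 / 2 \<le> r (real k * \<eta> - \<tau>)" by (rule near)
      then have "r 0 / (2 * \<sigma>) \<le> 1 / \<sigma> * r (real k * \<eta> - \<tau>)"
        using \<sigma>(1) by (simp add: field_simps)
      also have "\<dots> \<le> (\<Sum>k\<le>n. 1 / \<sigma> * r (real k * \<eta> - \<tau>))"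
        by (rule member_le_sum[of k "{..n}" "\<lambda>k. 1 / \<sigma> * r (real k * \<eta> - \<tau>)"]) (use kn nonneg \<sigma> in auto)
      finally show ?thesis unfolding bsum .
    qed
    \<comment> \<open>With this factor the shift \<open>s * b\<close> is at least \<open>\<delta>\<close> on the whole interval, by \<open>bge\<close>.\<close>
    define s where "s = 2 * \<delta> * \<sigma> / r 0"
    have s: "s > 0" using \<delta> \<sigma> pos by (simp add: s_def)
    have s2: "s\<^sup>2 = 4 * \<delta>\<^sup>2 * v / (r 0)\<^sup>2" by (simp add: s_def power_mult_distrib power_divide \<sigma>)
    have s2half: "s\<^sup>2 \<le> C * \<delta>\<^sup>2 * N / 2"
    proof -
      have "4 * \<delta>\<^sup>2 * v / (r 0)\<^sup>2 \<le> 4 * \<delta>\<^sup>2 * (\<kappa> * N) / (r 0)\<^sup>2" using vle by (intro divide_right_mono mult_left_mono) auto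
      also have "\<dots> = C * \<delta>\<^sup>2 * N / 2" by (simp add: C_def)
      finally show ?thesis unfolding s2 .
    qed
    have s2le: "s\<^sup>2 / 2 \<le> C * \<delta>\<^sup>2 * N"
    proof -
      have "0 \<le> C * \<delta>\<^sup>2 * N" using C N by simp
      then show ?thesis using s2half by linarith
    qed
    \<comment> \<open>Chosen such that the linear cost \<open>s * L\<close> is exactly \<open>\<gamma> * N\<close>.\<close>
    define L where "L = \<gamma> * N / s"
    have L: "L \<ge> 0" "s * L = \<gamma> * N" using \<gamma> N s by (simp_all add: L_def)
    have L2: "\<gamma>\<^sup>2 * N / (C * \<delta>\<^sup>2) \<le> L\<^sup>2 / 2"
    proof -
      from s2half have "\<gamma>\<^sup>2 * N\<^sup>2 / (C * \<delta>\<^sup>2 * N / 2) \<le> \<gamma>\<^sup>2 * N\<^sup>2 / s\<^sup>2"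
        using s by (intro divide_left_mono) (use C \<delta> N in auto)
      moreover have "L\<^sup>2 = \<gamma>\<^sup>2 * N\<^sup>2 / s\<^sup>2" by (simp add: L_def power_divide power_mult_distrib)
      ultimately have "\<gamma>\<^sup>2 * N\<^sup>2 / (C * \<delta>\<^sup>2 * N / 2) \<le> L\<^sup>2" by (simp only:)
      then have "\<gamma>\<^sup>2 * N\<^sup>2 / (C * \<delta>\<^sup>2 * N / 2) / 2 \<le> L\<^sup>2 / 2" by (rule divide_right_mono) simp
      moreover have "\<gamma>\<^sup>2 * N\<^sup>2 / (C * \<delta>\<^sup>2 * N / 2) / 2 = \<gamma>\<^sup>2 * N / (C * \<delta>\<^sup>2)"
        using C \<delta> N by (simp add: field_simps power2_eq_square)
      ultimately show ?thesis by (simp only:)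
    qed
    define D where "D = \<rat> \<inter> {0..N}"
    have D: "countable D" by (auto simp: D_def intro: countable_Int1 countable_rat)
    define Q where "Q x \<longleftrightarrow> (\<forall>\<tau>\<in>D. x (Some \<tau>) \<le> l)" for x :: "real option \<Rightarrow> real"
    have Q: "Measurable.pred path_space Q"
      unfolding Q_def by (rule pred_countable_Ball[OF D]) measurable
    have "exp (- s * L - s\<^sup>2 / 2) * (prob_below M Z D (\<lambda>_. l) - exp (- L\<^sup>2 / 2))
      \<le> measure M {\<omega>\<in>space M. Q (\<lambda>k. V k \<omega> + s * b k)}"
      using cameron_martin_lower_bound[OF V one Q less_imp_le[OF s] L(1)]
      unfolding b_def by (simp add: Q_def VS prob_below_def)
    also have "\<dots> \<le> prob_below M Z D (\<lambda>_. l - \<delta>)"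
      unfolding prob_below_def
    proof (rule finite_measure_mono)
      show "{\<omega>\<in>space M. \<forall>i\<in>D. Z i \<omega> \<le> l - \<delta>} \<in> sets M"
        by (rule prob_below_measurable[OF _ D]) measurable
      show "{\<omega>\<in>space M. Q (\<lambda>k. V k \<omega> + s * b k)} \<subseteq> {\<omega>\<in>space M. \<forall>i\<in>D. Z i \<omega> \<le> l - \<delta>}"
      proof safe
        fix \<omega> \<tau> assume *: "Q (\<lambda>k. V k \<omega> + s * b k)" and \<tau>: "\<tau> \<in> D"
        have "s * (r 0 / (2 * \<sigma>)) \<le> s * b (Some \<tau>)"
          using \<tau> s by (intro mult_left_mono bge) (auto simp: D_def)
        moreover have "s * (r 0 / (2 * \<sigma>)) = \<delta>" using \<sigma> pos by (simp add: s_def)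
        moreover have "Z \<tau> \<omega> + s * b (Some \<tau>) \<le> l" using * \<tau> by (auto simp: Q_def VS)
        ultimately show "Z \<tau> \<omega> \<le> l - \<delta>" by linarith
      qed
    qed
    finally have main: "exp (- s * L - s\<^sup>2 / 2) * (prob_below M Z D (\<lambda>_. l) - exp (- L\<^sup>2 / 2)) \<le> prob_below M Z D (\<lambda>_. l - \<delta>)" .
    have pb: "prob_below M Z D (\<lambda>_. l - \<delta>) \<ge> 0" by (simp add: prob_below_def)
    show "exp (- \<gamma> * N - C * \<delta>\<^sup>2 * N) * (prob_below M Z (\<rat> \<inter> {0..N}) (\<lambda>_. l) - exp (- \<gamma>\<^sup>2 * N / (C * \<delta>\<^sup>2)))
       \<le> prob_below M Z (\<rat> \<inter> {0..N}) (\<lambda>_. l - \<delta>)"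
      unfolding D_def[symmetric]
    proof (cases "prob_below M Z D (\<lambda>_. l) - exp (- \<gamma>\<^sup>2 * N / (C * \<delta>\<^sup>2)) \<le> 0")
      case True
      then have "exp (- \<gamma> * N - C * \<delta>\<^sup>2 * N) * (prob_below M Z D (\<lambda>_. l) - exp (- \<gamma>\<^sup>2 * N / (C * \<delta>\<^sup>2))) \<le> 0"
        by (intro mult_nonneg_nonpos) auto
      then show "exp (- \<gamma> * N - C * \<delta>\<^sup>2 * N) * (prob_below M Z D (\<lambda>_. l) - exp (- \<gamma>\<^sup>2 * N / (C * \<delta>\<^sup>2)))
        \<le> prob_below M Z D (\<lambda>_. l - \<delta>)" using pb by linarith
    next
      case False
      have "exp (- \<gamma> * N - C * \<delta>\<^sup>2 * N) * (prob_below M Z D (\<lambda>_. l) - exp (- \<gamma>\<^sup>2 * N / (C * \<delta>\<^sup>2)))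
        \<le> exp (- s * L - s\<^sup>2 / 2) * (prob_below M Z D (\<lambda>_. l) - exp (- L\<^sup>2 / 2))"
        using False L(2) s2le L2 by (intro mult_mono) auto
      then show "exp (- \<gamma> * N - C * \<delta>\<^sup>2 * N) * (prob_below M Z D (\<lambda>_. l) - exp (- \<gamma>\<^sup>2 * N / (C * \<delta>\<^sup>2)))
        \<le> prob_below M Z D (\<lambda>_. l - \<delta>)" using main by linarith
    qed
  qed
qed

section \<open>Gaussian processes and cadlag paths\<close>

lemma gaussian_rv_centred:
  assumes "prob_space M" and G: "gaussian_rv M G" and mean: "(\<integral>\<omega>. G \<omega> \<partial>M) = 0"
  shows "integrable M (\<lambda>\<omega>. (G \<omega>)\<^sup>2)"
    and "(CLINT \<omega>|M. iexp (G \<omega>)) = complex_of_real (exp (- (\<integral>\<omega>. (G \<omega>)\<^sup>2 \<partial>M) / 2))"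
proof -
  interpret prob_space M by fact
  have [measurable]: "G \<in> borel_measurable M" using G by (simp add: gaussian_rv_def)
  obtain \<mu> where "(AE \<omega> in M. G \<omega> = \<mu>) \<or> (\<exists>\<sigma>>0. distributed M lborel G (\<lambda>x. ennreal (normal_density \<mu> \<sigma> x)))"
    using G by (auto simp: gaussian_rv_def)
  then have "integrable M (\<lambda>\<omega>. (G \<omega>)\<^sup>2) \<and> (CLINT \<omega>|M. iexp (G \<omega>)) = complex_of_real (exp (- (\<integral>\<omega>. (G \<omega>)\<^sup>2 \<partial>M) / 2))"
  proof
    assume ae: "AE \<omega> in M. G \<omega> = \<mu>"
    have "(\<integral>\<omega>. G \<omega> \<partial>M) = (\<integral>\<omega>. \<mu> \<partial>M)" using ae by (intro integral_cong_AE) auto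
    then have "\<mu> = 0" using mean by (simp add: prob_space)
    then have ae0: "AE \<omega> in M. G \<omega> = 0" using ae by simp
    have "integrable M (\<lambda>\<omega>. (G \<omega>)\<^sup>2) \<longleftrightarrow> integrable M (\<lambda>\<omega>. 0::real)"
      using ae0 by (intro integrable_cong_AE) auto
    moreover have "(\<integral>\<omega>. (G \<omega>)\<^sup>2 \<partial>M) = (\<integral>\<omega>. 0 \<partial>M)" using ae0 by (intro integral_cong_AE) auto
    moreover have "(CLINT \<omega>|M. iexp (G \<omega>)) = (CLINT \<omega>|M. 1)" using ae0 by (intro integral_cong_AE) auto
    ultimately show ?thesis by (simp add: prob_space)
  next
    assume "\<exists>\<sigma>>0. distributed M lborel G (\<lambda>x. ennreal (normal_density \<mu> \<sigma> x))"
    then obtain \<sigma> where \<sigma>: "\<sigma> > 0" and d: "distributed M lborel G (\<lambda>x. ennreal (normal_density \<mu> \<sigma> x))" by auto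
    have "\<mu> = 0" using normal_distributed_expectation[OF \<sigma> d] mean by simp
    define \<xi> where "\<xi> = (\<lambda>\<omega>. G \<omega> / \<sigma>)"
    have d1: "distributed M lborel \<xi> std_normal_density"
      using normal_standard_normal_convert[OF \<sigma>, of G \<mu>] d \<open>\<mu> = 0\<close> by (simp add: \<xi>_def)
    have \<xi>2: "integrable M (\<lambda>\<omega>. (\<xi> \<omega>)\<^sup>2)" "(\<integral>\<omega>. (\<xi> \<omega>)\<^sup>2 \<partial>M) = 1"
      using distributed_integrable[OF d1, of "\<lambda>x. x\<^sup>2"] distributed_integral[OF d1, of "\<lambda>x. x\<^sup>2"]
        integrable_std_normal_moment[of 2] integral_std_normal_moment_even[of 1]
      by (simp_all add: normal_density_nonneg fact_numeral)
    have G\<xi>: "G \<omega> = \<sigma> * \<xi> \<omega>" for \<omega> using \<sigma> by (simp add: \<xi>_def)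
    have [measurable]: "\<xi> \<in> borel_measurable M" unfolding \<xi>_def by measurable
    have "(CLINT \<omega>|M. iexp (G \<omega>)) = (CLINT x|distr M lborel \<xi>. iexp (\<sigma> * x))"
      unfolding G\<xi> by (subst integral_distr) auto
    also have "\<dots> = char std_normal_distribution \<sigma>"
      using distributed_distr_eq_density[OF d1] by (simp add: char_def)
    also have "\<dots> = complex_of_real (exp (- (\<integral>\<omega>. (G \<omega>)\<^sup>2 \<partial>M) / 2))"
      using \<xi>2 by (simp add: char_std_normal_distribution G\<xi> power_mult_distrib)
    finally show ?thesis using \<xi>2 by (simp add: G\<xi> power_mult_distrib)
  qed
  then show "integrable M (\<lambda>\<omega>. (G \<omega>)\<^sup>2)"
    and "(CLINT \<omega>|M. iexp (G \<omega>)) = complex_of_real (exp (- (\<integral>\<omega>. (G \<omega>)\<^sup>2 \<partial>M) / 2))" by auto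
qed

text \<open>
  Several indices may share a time; their coefficients are then collected.
\<close>

lemma gaussian_process_family:
  fixes f :: "'i \<Rightarrow> real"
  assumes "prob_space M" and S: "gaussian_process M S" and c: "centred M S" and f: "\<And>i. f i \<ge> 0"
  shows "gaussian_family M (\<lambda>i. S (f i))"
  unfolding gaussian_family_def
proof (intro conjI allI impI)
  show "prob_space M" by fact
  have rv: "gaussian_rv M (\<lambda>\<omega>. \<Sum>t\<in>J. a t * S t \<omega>)" if "finite J" "J \<subseteq> {0..}" for J a
    using S that by (simp add: gaussian_process_def)
  have int: "integrable M (S t)" "(\<integral>\<omega>. S t \<omega> \<partial>M) = 0" if "t \<ge> 0" for t
    using c that by (auto simp: centred_def)
  fix i
  have rv1: "gaussian_rv M (S (f i))" using rv[of "{f i}" "\<lambda>_. 1"] f[of i] by simp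
  show "S (f i) \<in> borel_measurable M" using rv1 by (simp add: gaussian_rv_def)
  show "(\<integral>\<omega>. S (f i) \<omega> \<partial>M) = 0" by (rule int[OF f])
  show "integrable M (\<lambda>\<omega>. (S (f i) \<omega>)\<^sup>2)" by (rule gaussian_rv_centred[OF assms(1) rv1 int(2)[OF f]])
next
  fix J :: "'i set" and a :: "'i \<Rightarrow> real"
  assume J: "finite J"
  have rv: "gaussian_rv M (\<lambda>\<omega>. \<Sum>t\<in>J. a t * S t \<omega>)" if "finite J" "J \<subseteq> {0..}" for J a
    using S that by (simp add: gaussian_process_def)
  have int: "integrable M (S t)" "(\<integral>\<omega>. S t \<omega> \<partial>M) = 0" if "t \<ge> 0" for t
    using c that by (auto simp: centred_def)
  define b where "b t = (\<Sum>j\<in>{j\<in>J. f j = t}. a j)" for t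
  have e: "(\<Sum>j\<in>J. a j * S (f j) \<omega>) = (\<Sum>t\<in>f ` J. b t * S t \<omega>)" for \<omega>
  proof -
    have "(\<Sum>j\<in>J. a j * S (f j) \<omega>) = (\<Sum>t\<in>f ` J. \<Sum>j\<in>{j\<in>J. f j = t}. a j * S (f j) \<omega>)"
      by (rule sum.image_gen[OF J])
    also have "\<dots> = (\<Sum>t\<in>f ` J. b t * S t \<omega>)"
      by (intro sum.cong refl) (auto simp: b_def sum_distrib_right intro!: sum.cong)
    finally show ?thesis .
  qed
  have "gaussian_rv M (\<lambda>\<omega>. \<Sum>t\<in>f ` J. b t * S t \<omega>)" using J f by (intro rv) auto
  then have "gaussian_rv M (\<lambda>\<omega>. \<Sum>j\<in>J. a j * S (f j) \<omega>)" by (simp only: e)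
  moreover have "(\<integral>\<omega>. (\<Sum>j\<in>J. a j * S (f j) \<omega>) \<partial>M) = 0"
    using int f by simp
  ultimately show "(CLINT \<omega>|M. iexp (\<Sum>j\<in>J. a j * S (f j) \<omega>)) =
        complex_of_real (exp (- (\<integral>\<omega>. (\<Sum>j\<in>J. a j * S (f j) \<omega>)\<^sup>2 \<partial>M) / 2))"
    by (rule gaussian_rv_centred(2)[OF assms(1)])
qed

lemma gaussian_prob_nonpos_ge_half:
  assumes V: "gaussian_family M V"
  shows "measure M {\<omega>\<in>space M. V i \<omega> \<le> 0} \<ge> 1 / 2"
proof -
  interpret prob_space M by (rule gaussian_familyD[OF V])
  note [measurable] = gaussian_familyD(2)[OF V]
  define W where "W k \<omega> = (\<Sum>j\<in>{k}. (-1) * V j \<omega>)" for k \<omega>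
  have W: "gaussian_family M W" unfolding W_def by (rule gaussian_family_linear[OF V]) auto
  have Q: "Measurable.pred path_space (\<lambda>x. x i \<le> 0)" by measurable
  have "measure M {\<omega>\<in>space M. V i \<omega> \<le> 0} = measure M {\<omega>\<in>space M. W i \<omega> \<le> 0}"
    by (rule gaussian_family_prob_eq[OF V W _ Q]) (simp add: W_def)
  then have "2 * measure M {\<omega>\<in>space M. V i \<omega> \<le> 0} = measure M {\<omega>\<in>space M. V i \<omega> \<le> 0} + measure M {\<omega>\<in>space M. V i \<omega> \<ge> 0}"
    by (simp add: W_def)
  also have "\<dots> \<ge> measure M ({\<omega>\<in>space M. V i \<omega> \<le> 0} \<union> {\<omega>\<in>space M. V i \<omega> \<ge> 0})"
    by (rule measure_Un_le) measurable
  also have "{\<omega>\<in>space M. V i \<omega> \<le> 0} \<union> {\<omega>\<in>space M. V i \<omega> \<ge> 0} = space M" by auto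
  finally show ?thesis by (simp add: prob_space)
qed

lemma cadlag_bounded:
  assumes f: "cadlag f" and R: "R \<ge> 0"
  shows "\<exists>B. \<forall>t\<in>{0..R}. \<bar>f t\<bar> \<le> B"
proof -
  define P where "P a b \<longleftrightarrow> (\<exists>B. \<forall>t\<in>{a..b} \<inter> {0..}. \<bar>f t\<bar> \<le> B)" for a b
  have "P 0 R"
    using R
  proof (induction rule: Bolzano)
    case (trans a b c)
    then obtain B1 B2 where "\<forall>t\<in>{a..b} \<inter> {0..}. \<bar>f t\<bar> \<le> B1" "\<forall>t\<in>{b..c} \<inter> {0..}. \<bar>f t\<bar> \<le> B2"
      by (auto simp: P_def)
    then have "\<forall>t\<in>{a..c} \<inter> {0..}. \<bar>f t\<bar> \<le> max B1 B2"
      by (auto simp: le_max_iff_disj)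
    then show ?case by (auto simp: P_def)
  next
    case (local x)
    have "(f \<longlongrightarrow> f x) (at_right x)" using f local by (simp add: cadlag_def)
    then have "eventually (\<lambda>t. dist (f t) (f x) < 1) (at_right x)" by (rule tendstoD) simp
    then obtain b where b: "b > x" "\<And>t. x < t \<Longrightarrow> t < b \<Longrightarrow> dist (f t) (f x) < 1"
      by (auto simp: eventually_at_right_field)
    obtain c l where c: "c < x" "\<And>t. c < t \<Longrightarrow> t < x \<Longrightarrow> t \<ge> 0 \<Longrightarrow> dist (f t) l < 1"
    proof (cases "x = 0")
      case True
      show ?thesis by (rule that[of "-1" 0]) (use True in auto)
    next
      case False
      then have "\<exists>l. (f \<longlongrightarrow> l) (at_left x)" using f local by (simp add: cadlag_def)
      then obtain l where "(f \<longlongrightarrow> l) (at_left x)" by blast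
      then have "eventually (\<lambda>t. dist (f t) l < 1) (at_left x)" by (rule tendstoD) simp
      then obtain c where "c < x" "\<And>t. c < t \<Longrightarrow> t < x \<Longrightarrow> dist (f t) l < 1"
        by (auto simp: eventually_at_left_field)
      then show ?thesis by (intro that[of c l]) auto
    qed
    define d where "d = min (b - x) (x - c)"
    have "P a' b'" if ab: "a' \<le> x" "x \<le> b'" "b' - a' < d" for a' b'
      unfolding P_def
    proof (intro exI[of _ "\<bar>f x\<bar> + \<bar>l\<bar> + 1"] ballI)
      fix t assume t: "t \<in> {a'..b'} \<inter> {0..}"
      consider "t = x" | "x < t" "t < b" | "c < t" "t < x"
        using t ab unfolding d_def min_def by (auto split: if_splits) linarith+
      then show "\<bar>f t\<bar> \<le> \<bar>f x\<bar> + \<bar>l\<bar> + 1"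
        using b(2)[of t] c(2)[of t] t by cases (auto simp: dist_real_def)
    qed
    then show ?case using b(1) c(1) by (intro exI[of _ d]) (auto simp: d_def)
  qed
  then show ?thesis unfolding P_def by auto
qed

lemma rational_exp_between:
  assumes "0 \<le> s" "s < t"
  shows "\<exists>\<tau>\<in>\<rat>. s < exp \<tau> \<and> exp \<tau> < (t::real)"
proof -
  define u where "u = (s + t) / 2"
  have u: "0 < u" "s < u" "u < t" using assms by (auto simp: u_def)
  obtain \<tau> where "\<tau> \<in> \<rat>" "ln u < \<tau>" "\<tau> < ln t"
    using Rats_dense_in_real[of "ln u" "ln t"] u by auto
  moreover have "u < exp \<tau>" "exp \<tau> < t" using calculation u by (metis exp_less_mono exp_ln, metis exp_less_mono exp_ln order_less_trans)
  ultimately show ?thesis using u by (intro bexI[of _ \<tau>]) auto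
qed

text \<open>
  By right-continuity the supremum over \<open>{0..T}\<close> is decided on any dense set of times together with
  \<open>T\<close>. The times \<open>exp \<tau>\<close> with rational \<open>\<tau>\<close> are mapped to each other by the scalings
  \<open>t \<mapsto> exp k * t\<close> with integer \<open>k\<close>, which makes stationarity in logarithmic time directly usable.
\<close>

lemma cadlag_le_iff_rational_exp:
  assumes f: "cadlag f" and T: "T > 0"
  shows "(\<forall>t\<in>{0..T}. f t \<le> c) \<longleftrightarrow> (\<forall>\<tau>\<in>\<rat> \<inter> {..ln T}. f (exp \<tau>) \<le> c) \<and> f T \<le> c"
proof safe
  fix \<tau> assume "\<forall>t\<in>{0..T}. f t \<le> c" "\<tau> \<le> ln T"
  then show "f (exp \<tau>) \<le> c" using T by (auto simp: ln_ge_iff)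
next
  assume "\<forall>t\<in>{0..T}. f t \<le> c" then show "f T \<le> c" using T by auto
next
  fix t assume D: "\<forall>\<tau>\<in>\<rat> \<inter> {..ln T}. f (exp \<tau>) \<le> c" and fT: "f T \<le> c" and t: "t \<in> {0..T}"
  show "f t \<le> c"
  proof (cases "t = T")
    case False
    then have tT: "t < T" using t by simp
    show ?thesis
    proof (rule ccontr)
      assume "\<not> f t \<le> c"
      then have gt: "f t > c" by simp
      have "(f \<longlongrightarrow> f t) (at_right t)" using f t by (simp add: cadlag_def)
      then have "eventually (\<lambda>u. f u > c) (at_right t)" using gt by (rule order_tendstoD)
      then obtain b where b: "b > t" "\<And>u. t < u \<Longrightarrow> u < b \<Longrightarrow> f u > c"
        by (auto simp: eventually_at_right_field)
      obtain \<tau> where \<tau>: "\<tau> \<in> \<rat>" "t < exp \<tau>" "exp \<tau> < min b T"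
        using rational_exp_between[of t "min b T"] t b tT by auto
      have "\<tau> \<le> ln T" using \<tau> T by (simp add: ln_ge_iff)
      then show False using D \<tau> b(2)[of "exp \<tau>"] by force
    qed
  qed (use fT in simp)
qed

text \<open>
  The event differs from a countable intersection of measurable events by a subset of the null set of
  paths that are not cadlag.
\<close>

lemma persistence_event:
  assumes "prob_space M" and S: "\<And>t. t \<ge> 0 \<Longrightarrow> S t \<in> borel_measurable M"
    and cad: "AE \<omega> in M. cadlag (\<lambda>t. S t \<omega>)" and T: "T > 0"
  shows "{\<omega>\<in>space M. (SUP t\<in>{0..T}. ereal (S t \<omega>)) \<le> 1} \<in> sets (completion M)"
    and "persistence_prob M S T = measure M {\<omega>\<in>space M. (\<forall>\<tau>\<in>\<rat> \<inter> {..ln T}. S (exp \<tau>) \<omega> \<le> 1) \<and> S T \<omega> \<le> 1}"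
proof -
  interpret prob_space M by fact
  define E where "E = {\<omega>\<in>space M. (SUP t\<in>{0..T}. ereal (S t \<omega>)) \<le> 1}"
  define F where "F = {\<omega>\<in>space M. (\<forall>\<tau>\<in>\<rat> \<inter> {..ln T}. S (exp \<tau>) \<omega> \<le> 1) \<and> S T \<omega> \<le> 1}"
  have [measurable]: "S (exp \<tau>) \<in> borel_measurable M" for \<tau> by (rule S) simp
  have [measurable]: "S T \<in> borel_measurable M" by (rule S) (use T in simp)
  have cD: "countable (\<rat> \<inter> {..ln T})" by (intro countable_Int1 countable_rat)
  have "Measurable.pred M (\<lambda>\<omega>. \<forall>\<tau>\<in>\<rat> \<inter> {..ln T}. S (exp \<tau>) \<omega> \<le> 1)"
    by (rule pred_countable_Ball[OF cD]) measurable
  then have F: "F \<in> sets M" unfolding F_def by measurable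
  have EF: "AE \<omega> in M. \<omega> \<in> E \<longleftrightarrow> \<omega> \<in> F"
    using cad
  proof eventually_elim
    case (elim \<omega>)
    then show ?case
      using cadlag_le_iff_rational_exp[OF elim T, of 1] by (simp add: E_def F_def SUP_le_iff one_ereal_def)
  qed
  obtain N where N: "N \<in> null_sets M" "{\<omega>\<in>space M. \<not> (\<omega> \<in> E \<longleftrightarrow> \<omega> \<in> F)} \<subseteq> N"
    using EF by (auto elim!: AE_E simp: null_sets_def)
  have Fs: "F \<subseteq> space M" "E \<subseteq> space M" by (auto simp: E_def F_def)
  have "E = (F - N) \<union> (E \<inter> N)" using N(2) Fs by auto
  then have Es: "E \<in> sets (completion M)"
    using N F by (intro sets_completionI[of E "F - N" "E \<inter> N" N]) auto
  then show "{\<omega>\<in>space M. (SUP t\<in>{0..T}. ereal (S t \<omega>)) \<le> 1} \<in> sets (completion M)" by (simp add: E_def)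
  have "measure (completion M) E = measure (completion M) F"
    using AE_completion[OF EF] Es F by (intro measure_eq_AE) auto
  then show "persistence_prob M S T = measure M {\<omega>\<in>space M. (\<forall>\<tau>\<in>\<rat> \<inter> {..ln T}. S (exp \<tau>) \<omega> \<le> 1) \<and> S T \<omega> \<le> 1}"
    using F by (simp add: persistence_prob_def E_def F_def)
qed

lemma persistence_prob_exp_nat:
  assumes "prob_space M" and S: "\<And>t. t \<ge> 0 \<Longrightarrow> S t \<in> borel_measurable M"
    and cad: "AE \<omega> in M. cadlag (\<lambda>t. S t \<omega>)"
  shows "persistence_prob M S (exp (real n)) = prob_below M (\<lambda>\<tau>. S (exp \<tau>)) (\<rat> \<inter> {..real n}) (\<lambda>_. 1)"
proof -
  have "(\<forall>\<tau>\<in>\<rat> \<inter> {..real n}. S (exp \<tau>) \<omega> \<le> 1) \<and> S (exp (real n)) \<omega> \<le> 1 \<longleftrightarrow> (\<forall>\<tau>\<in>\<rat> \<inter> {..real n}. S (exp \<tau>) \<omega> \<le> 1)" for \<omega>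
    by auto
  then show ?thesis
    using persistence_event(2)[OF assms, of "exp (real n)"] by (simp add: prob_below_def)
qed

lemma persistence_prob_antimono:
  assumes "prob_space M" and S: "\<And>t. t \<ge> 0 \<Longrightarrow> S t \<in> borel_measurable M"
    and cad: "AE \<omega> in M. cadlag (\<lambda>t. S t \<omega>)" and T: "0 < T" "T \<le> T'"
  shows "persistence_prob M S T' \<le> persistence_prob M S T"
  unfolding persistence_prob_def
proof (rule finite_measure.finite_measure_mono)
  interpret prob_space M by fact
  show "finite_measure (completion M)"
    by (rule finite_measureI) (simp add: emeasure_space_1)
  show "{\<omega>\<in>space M. (SUP t\<in>{0..T}. ereal (S t \<omega>)) \<le> 1} \<in> sets (completion M)"
    by (rule persistence_event(1)[OF assms(1-4)])
  have "(SUP t\<in>{0..T}. ereal (S t \<omega>)) \<le> (SUP t\<in>{0..T'}. ereal (S t \<omega>))" for \<omega>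
    using T by (intro SUP_subset_mono) auto
  then show "{\<omega>\<in>space M. (SUP t\<in>{0..T'}. ereal (S t \<omega>)) \<le> 1} \<subseteq> {\<omega>\<in>space M. (SUP t\<in>{0..T}. ereal (S t \<omega>)) \<le> 1}"
    by (auto intro: order_trans)
qed

lemma prob_below_antimono:
  assumes "prob_space M" and X: "\<And>i. X i \<in> borel_measurable M" and D: "countable D" "D \<subseteq> D'" and b: "\<And>i. i \<in> D \<Longrightarrow> b' i \<le> b i"
  shows "prob_below M X D' b' \<le> prob_below M X D b"
proof -
  interpret prob_space M by fact
  show ?thesis unfolding prob_below_def
  proof (rule finite_measure_mono)
    show "{\<omega>\<in>space M. \<forall>i\<in>D. X i \<omega> \<le> b i} \<in> sets M" by (rule prob_below_measurable[OF X D(1)])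
    show "{\<omega>\<in>space M. \<forall>i\<in>D'. X i \<omega> \<le> b' i} \<subseteq> {\<omega>\<in>space M. \<forall>i\<in>D. X i \<omega> \<le> b i}"
      using D(2) b by (auto intro: order_trans)
  qed
qed

section \<open>Stationarity and tails in logarithmic time\<close>

lemma gaussian_family_reindex:
  assumes V: "gaussian_family M V"
  shows "gaussian_family M (\<lambda>k. V (f k))"
proof -
  have "(\<lambda>k \<omega>. \<Sum>i\<in>{f k}. 1 * V i \<omega>) = (\<lambda>k. V (f k))" by (auto simp: fun_eq_iff)
  then show ?thesis using gaussian_family_linear[OF V, of "\<lambda>k. {f k}" "\<lambda>_ _. 1"] by simp
qed

lemma ball_rational_shift:
  "(\<forall>\<tau>\<in>\<rat> \<inter> {0..n}. P (\<tau> + real k)) \<longleftrightarrow> (\<forall>\<tau>\<in>\<rat> \<inter> {real k..real k + n}. P \<tau>)"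
proof safe
  fix \<tau> assume *: "\<forall>\<tau>\<in>\<rat> \<inter> {0..n}. P (\<tau> + real k)" "\<tau> \<in> \<rat>" "\<tau> \<in> {real k..real k + n}"
  then have "\<tau> - real k \<in> \<rat> \<inter> {0..n}" by auto
  with *(1) have "P ((\<tau> - real k) + real k)" by (rule bspec)
  then show "P \<tau>" by simp
next
  fix \<tau> assume *: "\<forall>\<tau>\<in>\<rat> \<inter> {real k..real k + n}. P \<tau>" "\<tau> \<in> \<rat>" "\<tau> \<in> {0..n}"
  then have "\<tau> + real k \<in> \<rat> \<inter> {real k..real k + n}" by auto
  with *(1) show "P (\<tau> + real k)" by (rule bspec)
qed

lemma countable_rational_Int: "countable (\<rat> \<inter> A)"
  by (intro countable_Int1 countable_rat)

lemma stationary_prob_eq: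
  fixes Z :: "real \<Rightarrow> 'a \<Rightarrow> real"
  assumes Z: "gaussian_family M Z" and cov: "\<And>s t. (\<integral>\<omega>. Z s \<omega> * Z t \<omega> \<partial>M) = r (t - s)"
  shows "prob_below M Z (\<rat> \<inter> {real k..real k + n}) (\<lambda>_. l) = prob_below M Z (\<rat> \<inter> {0..n}) (\<lambda>_. l)"
    and "prob_exceed M Z (\<rat> \<inter> {real k..real k + n}) l = prob_exceed M Z (\<rat> \<inter> {0..n}) l"
proof -
  have Z': "gaussian_family M (\<lambda>\<tau>. Z (\<tau> + real k))" by (rule gaussian_family_reindex[OF Z])
  have c: "(\<integral>\<omega>. Z s \<omega> * Z t \<omega> \<partial>M) = (\<integral>\<omega>. Z (s + real k) \<omega> * Z (t + real k) \<omega> \<partial>M)" for s t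
    by (simp add: cov)
  have Q1: "Measurable.pred path_space (\<lambda>x. \<forall>\<tau>\<in>\<rat> \<inter> {0..n}. x \<tau> \<le> l)"
    by (rule pred_countable_Ball[OF countable_rational_Int]) measurable
  have Q2: "Measurable.pred path_space (\<lambda>x. \<exists>\<tau>\<in>\<rat> \<inter> {0..n}. \<bar>x \<tau>\<bar> > l)"
    by (rule pred_countable_Bex[OF countable_rational_Int]) measurable
  show "prob_below M Z (\<rat> \<inter> {real k..real k + n}) (\<lambda>_. l) = prob_below M Z (\<rat> \<inter> {0..n}) (\<lambda>_. l)"
    using gaussian_family_prob_eq[OF Z Z' c Q1] unfolding prob_below_def
    by (simp only: ball_rational_shift[where P="\<lambda>\<tau>. Z \<tau> \<omega> \<le> l" for \<omega>])
  have "(\<exists>\<tau>\<in>\<rat> \<inter> {0..n}. \<bar>Z (\<tau> + real k) \<omega>\<bar> > l) \<longleftrightarrow> (\<exists>\<tau>\<in>\<rat> \<inter> {real k..real k + n}. \<bar>Z \<tau> \<omega>\<bar> > l)" for \<omega>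
    using ball_rational_shift[where P="\<lambda>\<tau>. \<not> \<bar>Z \<tau> \<omega>\<bar> > l" and n=n and k=k] by blast
  then show "prob_exceed M Z (\<rat> \<inter> {real k..real k + n}) l = prob_exceed M Z (\<rat> \<inter> {0..n}) l"
    using gaussian_family_prob_eq[OF Z Z' c Q2] unfolding prob_exceed_def by simp
qed

lemma prob_below_le_sum_exceed:
  fixes A B V :: "'i \<Rightarrow> 'a \<Rightarrow> real"
  assumes "prob_space M" and [measurable]: "\<And>i. B i \<in> borel_measurable M" "\<And>i. V i \<in> borel_measurable M"
    and D: "countable D" and AB: "\<And>i \<omega>. i \<in> D \<Longrightarrow> \<bar>V i \<omega>\<bar> \<le> \<delta> \<Longrightarrow> A i \<omega> \<le> a i \<Longrightarrow> B i \<omega> \<le> b i"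
  shows "prob_below M A D a \<le> prob_below M B D b + prob_exceed M V D \<delta>"
proof -
  interpret prob_space M by fact
  have m1: "{\<omega>\<in>space M. \<forall>i\<in>D. B i \<omega> \<le> b i} \<in> sets M" by (rule prob_below_measurable[OF _ D]) measurable
  have m2: "{\<omega>\<in>space M. \<exists>i\<in>D. \<bar>V i \<omega>\<bar> > \<delta>} \<in> sets M"
    unfolding pred_def[symmetric] by (rule pred_countable_Bex[OF D]) measurable
  have "prob_below M A D a \<le> measure M ({\<omega>\<in>space M. \<forall>i\<in>D. B i \<omega> \<le> b i} \<union> {\<omega>\<in>space M. \<exists>i\<in>D. \<bar>V i \<omega>\<bar> > \<delta>})"
    unfolding prob_below_def using m1 m2 AB by (intro finite_measure_mono) (auto simp: not_less)
  also have "\<dots> \<le> prob_below M B D b + prob_exceed M V D \<delta>"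
    unfolding prob_below_def prob_exceed_def by (rule measure_Un_le[OF m1 m2])
  finally show ?thesis .
qed

lemma stationary_exponential_tail:
  fixes W :: "real \<Rightarrow> 'a \<Rightarrow> real"
  assumes W: "gaussian_family M W" and cov: "\<And>s t. (\<integral>\<omega>. W s \<omega> * W t \<omega> \<partial>M) = r (t - s)"
    and bdd: "AE \<omega> in M. \<exists>B. \<forall>\<tau>\<in>\<rat> \<inter> {0..1}. \<bar>W \<tau> \<omega>\<bar> \<le> B"
  shows "\<exists>c>0. \<exists>x0>0. \<forall>k. \<forall>x\<ge>x0. prob_exceed M W (\<rat> \<inter> {real k..real k + 1}) x \<le> exp (- c * x)"
proof -
  obtain s where s: "s > 0" "prob_exceed M W (\<rat> \<inter> {0..1}) s \<le> 1/4"
    using prob_exceed_small[OF W countable_rational_Int bdd, of "1/4"] by auto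
  have "prob_exceed M W (\<rat> \<inter> {real k..real k + 1}) x \<le> exp (- (1 / (4 * s)) * x)" if "x \<ge> 2 * s" for k x
    using fernique_tail[OF W countable_rational_Int s that] by (simp add: stationary_prob_eq(2)[OF W cov])
  then show ?thesis using s(1) by (intro exI[of _ "1 / (4 * s)"] exI[of _ "2 * s"] conjI) auto
qed

text \<open>
  On the window \<open>{k..k + 1}\<close> the process \<open>V\<close> exceeds \<open>\<delta>\<close> only if the stationary process \<open>W\<close> exceeds
  \<open>\<delta> * exp (\<beta> * k)\<close>. So the exponential tail of \<open>W\<close> makes the probability doubly exponentially small
  in \<open>m\<close>.
\<close>

lemma damped_tail:
  fixes V W :: "real \<Rightarrow> 'a \<Rightarrow> real"
  assumes "prob_space M" and [measurable]: "\<And>\<tau>. V \<tau> \<in> borel_measurable M" "\<And>\<tau>. W \<tau> \<in> borel_measurable M"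
    and VW: "\<And>\<tau> \<omega>. V \<tau> \<omega> = exp (- \<beta> * \<tau>) * W \<tau> \<omega>" and \<beta>: "\<beta> > 0" and c: "c > 0"
    and tail: "\<And>k x. x \<ge> x0 \<Longrightarrow> prob_exceed M W (\<rat> \<inter> {real k..real k + 1}) x \<le> exp (- c * x)"
    and x0: "\<delta> * exp (\<beta> * real m) \<ge> x0" and \<delta>: "\<delta> > 0" and mN: "m < N"
  shows "prob_exceed M V (\<rat> \<inter> {real m..real N}) \<delta> \<le> real N * exp (- c * \<delta> * exp (\<beta> * real m))"
proof -
  interpret prob_space M by fact
  define A where "A k = {\<omega>\<in>space M. \<exists>\<tau>\<in>\<rat> \<inter> {real k..real k + 1}. \<bar>W \<tau> \<omega>\<bar> > \<delta> * exp (\<beta> * real m)}" for k :: nat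
  have A[measurable]: "A k \<in> sets M" for k
    unfolding A_def pred_def[symmetric] by (rule pred_countable_Bex[OF countable_rational_Int]) measurable
  have "{\<omega>\<in>space M. \<exists>\<tau>\<in>\<rat> \<inter> {real m..real N}. \<bar>V \<tau> \<omega>\<bar> > \<delta>} \<subseteq> (\<Union>k\<in>{m..<N}. A k)"
  proof safe
    fix \<omega> \<tau> assume \<omega>: "\<omega> \<in> space M" and \<tau>: "\<tau> \<in> \<rat>" "\<tau> \<in> {real m..real N}" and V: "\<bar>V \<tau> \<omega>\<bar> > \<delta>"
    \<comment> \<open>The right end point belongs to the last window.\<close>
    define k where "k = (if \<tau> = real N then N - 1 else nat \<lfloor>\<tau>\<rfloor>)"
    have k: "k \<in> {m..<N}" "real k \<le> \<tau>" "\<tau> \<le> real k + 1"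
    proof -
      have "m \<le> nat \<lfloor>\<tau>\<rfloor>" "\<tau> \<noteq> real N \<Longrightarrow> nat \<lfloor>\<tau>\<rfloor> < N" using \<tau> by (auto simp: le_nat_floor) linarith
      then show "k \<in> {m..<N}" using mN by (auto simp: k_def)
      show "real k \<le> \<tau>" "\<tau> \<le> real k + 1" using \<tau> mN by (auto simp: k_def of_nat_diff)
    qed
    have "\<delta> < exp (- \<beta> * \<tau>) * \<bar>W \<tau> \<omega>\<bar>" using V by (simp add: VW abs_mult)
    then have "\<delta> * exp (\<beta> * \<tau>) < exp (- \<beta> * \<tau>) * \<bar>W \<tau> \<omega>\<bar> * exp (\<beta> * \<tau>)" by simp
    also have "\<dots> = \<bar>W \<tau> \<omega>\<bar>" by (simp add: exp_minus field_simps)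
    finally have "\<delta> * exp (\<beta> * \<tau>) < \<bar>W \<tau> \<omega>\<bar>" .
    moreover have "\<delta> * exp (\<beta> * real m) \<le> \<delta> * exp (\<beta> * \<tau>)" using \<delta> \<beta> \<tau> by simp
    ultimately have "\<delta> * exp (\<beta> * real m) < \<bar>W \<tau> \<omega>\<bar>" by linarith
    then have "\<omega> \<in> A k" using \<omega> \<tau> k by (auto simp: A_def)
    then show "\<omega> \<in> (\<Union>k\<in>{m..<N}. A k)" using k by blast
  qed
  then have "prob_exceed M V (\<rat> \<inter> {real m..real N}) \<delta> \<le> measure M (\<Union>k\<in>{m..<N}. A k)"
    unfolding prob_exceed_def by (intro finite_measure_mono) auto
  also have "\<dots> \<le> (\<Sum>k\<in>{m..<N}. measure M (A k))" by (intro measure_UNION_le) auto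
  also have "\<dots> \<le> (\<Sum>k\<in>{m..<N}. exp (- c * (\<delta> * exp (\<beta> * real m))))"
    using tail[OF x0] by (intro sum_mono) (simp add: A_def prob_exceed_def)
  also have "\<dots> = real (N - m) * exp (- c * \<delta> * exp (\<beta> * real m))" by (simp add: mult.assoc)
  also have "\<dots> \<le> real N * exp (- c * \<delta> * exp (\<beta> * real m))" by (intro mult_right_mono) auto
  finally show ?thesis .
qed

section \<open>Subadditive sequences\<close>

text \<open>
  Fekete's lemma.
\<close>

lemma subadditive_limit:
  fixes f :: "nat \<Rightarrow> real"
  assumes sub: "\<And>m n. f (m + n) \<le> f m + f n" and nonneg: "\<And>n. f n \<ge> 0"
  shows "\<exists>\<theta>\<ge>0. (\<lambda>n. f n / real n) \<longlonglongrightarrow> \<theta>"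
proof -
  define \<theta> where "\<theta> = (INF n\<in>{1..}. f n / real n)"
  have bdd: "bdd_below ((\<lambda>n. f n / real n) ` {1..})"
    using nonneg by (intro bdd_belowI2[of _ 0]) auto
  have \<theta>0: "\<theta> \<ge> 0" unfolding \<theta>_def using nonneg by (intro cINF_greatest) auto
  have lower: "\<theta> \<le> f n / real n" if "n \<ge> 1" for n
    unfolding \<theta>_def using that by (intro cINF_lower bdd) auto
  have mult: "f (q * k) \<le> real q * f k" if "q \<ge> 1" for q k
    using that
  proof (induction q rule: dec_induct)
    case (step q)
    have "f (Suc q * k) \<le> f k + f (q * k)" using sub[of k "q * k"] by simp
    then show ?case using step by (simp add: algebra_simps)
  qed simp
  have "(\<lambda>n. f n / real n) \<longlonglongrightarrow> \<theta>"
  proof (rule LIMSEQ_I)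
    fix e :: real assume e: "e > 0"
    have "(INF n\<in>{1..}. f n / real n) < \<theta> + e / 2" using e by (simp add: \<theta>_def)
    then obtain k where k: "k \<ge> 1" "f k / real k < \<theta> + e / 2"
      using bdd by (subst (asm) cINF_less_iff) auto
    define B where "B = (\<Sum>s<k. f s) + f k"
    have B: "f s \<le> B" if "s < k" for s
      using member_le_sum[of s "{..<k}" f] that nonneg by (auto simp: B_def intro: add_increasing2)
    have upper: "f n / real n < \<theta> + e / 2 + B / real n" if n: "n \<ge> k" for n
    proof -
      have n0: "real n > 0" using n k by simp
      have q: "n div k \<ge> 1" using n k by (simp add: div_greater_zero_iff Suc_le_eq)
      have "f n \<le> f (n div k * k) + f (n mod k)" using sub[of "n div k * k" "n mod k"] by simp
      also have "\<dots> \<le> real (n div k) * f k + B"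
        using mult[OF q, of k] B[of "n mod k"] k by simp
      also have "real (n div k) * f k = (real (n div k) * real k) * (f k / real k)" using k by simp
      also have "\<dots> \<le> real n * (f k / real k)"
      proof (rule mult_right_mono)
        show "real (n div k) * real k \<le> real n"
          unfolding of_nat_mult[symmetric] of_nat_le_iff by (rule div_times_less_eq_dividend)
      qed (use nonneg in auto)
      finally have "f n \<le> real n * (f k / real k) + B" by simp
      also have "\<dots> < real n * (\<theta> + e / 2) + B"
        by (intro add_strict_right_mono mult_strict_left_mono k(2) n0)
      finally have "f n / real n < (real n * (\<theta> + e / 2) + B) / real n" using n0 by (rule divide_strict_right_mono)
      also have "\<dots> = \<theta> + e / 2 + B / real n" using n0 by (simp add: add_divide_distrib)
      finally show ?thesis .
    qed
    obtain n1 :: nat where n1: "2 * B / e < real n1" using reals_Archimedean2 by blast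
    show "\<exists>no. \<forall>n\<ge>no. norm (f n / real n - \<theta>) < e"
    proof (intro exI[of _ "max (Suc n1) k"] allI impI)
      fix n assume n: "max (Suc n1) k \<le> n"
      then have "2 * B / e < real n" using n1 by simp
      then have "B / real n < e / 2" using e n by (simp add: field_simps)
      moreover have "f n / real n < \<theta> + e / 2 + B / real n" using upper[of n] n by simp
      ultimately have "f n / real n < \<theta> + e" by linarith
      then show "norm (f n / real n - \<theta>) < e" using lower[of n] n e by (simp add: abs_less_iff)
    qed
  qed
  then show ?thesis using \<theta>0 by auto
qed

section \<open>Persistence probabilities are positive\<close>

text \<open>
  Positivity is a local matter: by Slepian's inequality, the events for two adjacent intervals have an
  intersection of positive probability when each of them has positive probability. Around a time \<open>x\<close>,
  the process stays below \<open>1\<close> on a short interval to the right with positive probability, since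
  \<open>S x \<le> 0\<close> has probability at least \<open>1 / 2\<close> and paths are right-continuous. To the left, the same
  holds with the left limit in place of \<open>S x\<close>: with probability at least \<open>1 / 2\<close> the path is
  non-positive at infinitely many times of a sequence increasing to \<open>x\<close>.
\<close>

lemma persistence_positive:
  assumes "prob_space M" and S: "gaussian_process M S" "centred M S"
    and cad: "AE \<omega> in M. cadlag (\<lambda>t. S t \<omega>)"
    and cov: "\<And>s t. s \<ge> 0 \<Longrightarrow> t \<ge> 0 \<Longrightarrow> (\<integral>\<omega>. S s \<omega> * S t \<omega> \<partial>M) \<ge> 0"
  shows "prob_below M (\<lambda>\<tau>. S (exp \<tau>)) (\<rat> \<inter> {..u}) (\<lambda>_. 1) > 0"
proof -
  interpret prob_space M by fact
  define U where "U = (\<lambda>\<tau>. S (exp \<tau>))"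
  have U: "gaussian_family M U" unfolding U_def by (rule gaussian_process_family[OF assms(1) S]) simp
  have Ucov: "(\<integral>\<omega>. U i \<omega> * U j \<omega> \<partial>M) \<ge> 0" for i j unfolding U_def by (rule cov) auto
  note mU[measurable] = gaussian_familyD(2)[OF U]
  have Sm[measurable]: "S t \<in> borel_measurable M" and half: "measure M {\<omega>\<in>space M. S t \<omega> \<le> 0} \<ge> 1 / 2" if "t \<ge> 0" for t
  proof -
    have "gaussian_family M (\<lambda>_::unit. S t)" by (rule gaussian_process_family[OF assms(1) S that])
    from gaussian_familyD(2)[OF this] gaussian_prob_nonpos_ge_half[OF this]
    show "S t \<in> borel_measurable M" "measure M {\<omega>\<in>space M. S t \<omega> \<le> 0} \<ge> 1 / 2" by auto
  qed
  define D where "D a b = \<rat> \<inter> {\<tau>. a \<le> exp \<tau> \<and> exp \<tau> \<le> b}" for a b :: real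
  have cD: "countable (D a b)" for a b unfolding D_def by (rule countable_rational_Int)
  define P where "P a b \<longleftrightarrow> prob_below M U (D a b) (\<lambda>_. 1) > 0" for a b
  have mset: "{\<omega>\<in>space M. \<forall>\<tau>\<in>\<rat> \<inter> A. U \<tau> \<omega> \<le> 1} \<in> sets M" for A
    by (rule prob_below_measurable[OF mU countable_rational_Int])
  have "P 0 (exp u)"
    using exp_ge_zero[of u]
  proof (induction rule: Bolzano)
    case (trans a b c)
    have "D a c = D a b \<union> D b c" using trans by (auto simp: D_def)
    then have "prob_below M U (D a b) (\<lambda>_. 1) * prob_below M U (D b c) (\<lambda>_. 1) \<le> prob_below M U (D a c) (\<lambda>_. 1)"
      using slepian_countable[OF U cD[of a b] cD[of b c] Ucov, of "\<lambda>_. 1"] by simp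
    then show ?case using trans(1,2) unfolding P_def by (metis less_le_trans mult_pos_pos)
  next
    case (local x)
    define Rt where "Rt n = {\<omega>\<in>space M. \<forall>\<tau>\<in>\<rat> \<inter> {\<tau>. x \<le> exp \<tau> \<and> exp \<tau> \<le> x + 1 / real (Suc n)}. U \<tau> \<omega> \<le> 1}" for n
    define Lt where "Lt n = {\<omega>\<in>space M. \<forall>\<tau>\<in>\<rat> \<inter> {\<tau>. x - 1 / real (Suc n) \<le> exp \<tau> \<and> exp \<tau> < x}. U \<tau> \<omega> \<le> 1}" for n
    have RLs: "Rt n \<in> sets M" "Lt n \<in> sets M" for n unfolding Rt_def Lt_def by (rule mset)+
    have "\<exists>n. measure M (Rt n) > 0"
    proof (rule ccontr)
      assume "\<not> ?thesis"
      then have z: "measure M (Rt n) = 0" for n by (metis measure_nonneg order_less_le)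
      have "(\<Union>n. Rt n) \<in> null_sets M"
        using z RLs by (intro null_sets_UN) (auto simp: null_sets_def emeasure_eq_measure)
      then have "AE \<omega> in M. \<omega> \<notin> (\<Union>n. Rt n)" by (rule AE_not_in)
      then have "AE \<omega> in M. \<not> S x \<omega> \<le> 0"
        using cad AE_space
      proof eventually_elim
        case (elim \<omega>)
        show ?case
        proof
          assume "S x \<omega> \<le> 0"
          then have "S x \<omega> < 1" by simp
          moreover have "((\<lambda>t. S t \<omega>) \<longlongrightarrow> S x \<omega>) (at_right x)" using elim(2) local by (simp add: cadlag_def)
          ultimately have "eventually (\<lambda>t. S t \<omega> < 1) (at_right x)" by (simp add: order_tendstoD)
          then obtain b where b: "b > x" "\<And>t. x < t \<Longrightarrow> t < b \<Longrightarrow> S t \<omega> < 1"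
            by (auto simp: eventually_at_right_field)
          obtain n where n: "1 / real (Suc n) < b - x" using reals_Archimedean[of "b - x"] b(1) by (auto simp: inverse_eq_divide)
          have "\<omega> \<in> Rt n" unfolding Rt_def
          proof safe
            fix \<tau> assume "x \<le> exp \<tau>" "exp \<tau> \<le> x + 1 / real (Suc n)"
            then show "U \<tau> \<omega> \<le> 1" using b(2)[of "exp \<tau>"] n \<open>S x \<omega> < 1\<close>
              by (cases "exp \<tau> = x") (auto simp: U_def)
          qed (use elim in auto)
          then show False using elim(1) by blast
        qed
      qed
      then have "measure M {\<omega>\<in>space M. S x \<omega> \<le> 0} = 0"
        using Sm[of x] local by (subst prob_eq_0) auto
      then show False using half[of x] local by simp
    qed
    then obtain n1 where n1: "measure M (Rt n1) > 0" by blast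
    have "\<exists>n. measure M (Lt n) > 0"
    proof (cases "x = 0")
      case True
      have "Lt 0 = space M" by (auto simp: Lt_def True)
      then show ?thesis by (intro exI[of _ 0]) (simp add: prob_space)
    next
      case False
      then have x: "x > 0" using local by simp
      \<comment> \<open>Times increasing strictly to \<open>x\<close>; the shift by \<open>2\<close> keeps them positive.\<close>
      define t where "t k = x - x / real (k + 2)" for k
      have t: "0 \<le> t k" "t k < x" for k using x by (auto simp: t_def field_simps)
      have tl: "t \<longlonglongrightarrow> x" unfolding t_def by real_asymp
      define A where "A k = {\<omega>\<in>space M. S (t k) \<omega> \<le> 0}" for k
      have A: "A k \<in> sets M" for k unfolding A_def using Sm[OF t(1)] by measurable
      define B where "B = (\<Inter>m. \<Union>k\<in>{m..}. A k)"
      have "(\<lambda>m. measure M (\<Union>k\<in>{m..}. A k)) \<longlonglongrightarrow> measure M B"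
        unfolding B_def
      proof (rule finite_Lim_measure_decseq)
        show "decseq (\<lambda>m. \<Union>k\<in>{m..}. A k)" by (intro antimonoI UN_mono) auto
      qed (use A in auto)
      moreover have "measure M (\<Union>k\<in>{m..}. A k) \<ge> 1 / 2" for m
      proof -
        have "measure M (A m) \<le> measure M (\<Union>k\<in>{m..}. A k)" using A by (intro finite_measure_mono) auto
        then show ?thesis using half[OF t(1), of m] by (simp add: A_def)
      qed
      ultimately have Bhalf: "measure M B \<ge> 1 / 2" by (intro LIMSEQ_le_const) auto
      show ?thesis
      proof (rule ccontr)
        assume "\<not> ?thesis"
        then have z: "measure M (Lt n) = 0" for n by (metis measure_nonneg order_less_le)
        have "(\<Union>n. Lt n) \<in> null_sets M"
          using z RLs by (intro null_sets_UN) (auto simp: null_sets_def emeasure_eq_measure)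
        then have "AE \<omega> in M. \<omega> \<notin> (\<Union>n. Lt n)" by (rule AE_not_in)
        then have "AE \<omega> in M. \<omega> \<notin> B"
          using cad AE_space
        proof eventually_elim
          case (elim \<omega>)
          show ?case
          proof
            assume "\<omega> \<in> B"
            then have inf: "\<exists>k\<ge>m. S (t k) \<omega> \<le> 0" for m by (auto simp: B_def A_def)
            obtain l where l: "((\<lambda>t. S t \<omega>) \<longlongrightarrow> l) (at_left x)" using elim(2) x unfolding cadlag_def by blast
            have "filterlim t (at_left x) sequentially"
              unfolding filterlim_at using tl t by (auto simp: less_imp_neq)
            then have lt: "(\<lambda>k. S (t k) \<omega>) \<longlonglongrightarrow> l" using l by (rule filterlim_compose[rotated])
            have "l < 1"
            proof (rule ccontr)
              assume "\<not> l < 1"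
              then have "eventually (\<lambda>k. S (t k) \<omega> > 0) sequentially" using lt by (intro order_tendstoD(1)) auto
              then obtain m where "\<And>k. k \<ge> m \<Longrightarrow> S (t k) \<omega> > 0" by (auto simp: eventually_sequentially)
              then show False using inf[of m] by force
            qed
            with l have "eventually (\<lambda>t. S t \<omega> < 1) (at_left x)" by (rule order_tendstoD)
            then obtain b where b: "b < x" "\<And>t. b < t \<Longrightarrow> t < x \<Longrightarrow> S t \<omega> < 1"
              by (auto simp: eventually_at_left_field)
            obtain n where n: "1 / real (Suc n) < x - b" using reals_Archimedean[of "x - b"] b(1) by (auto simp: inverse_eq_divide)
            have "\<omega> \<in> Lt n" unfolding Lt_def
            proof safe
              fix \<tau> assume "x - 1 / real (Suc n) \<le> exp \<tau>" "exp \<tau> < x"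
              then show "U \<tau> \<omega> \<le> 1" using b(2)[of "exp \<tau>"] n by (auto simp: U_def)
            qed (use elim in auto)
            then show False using elim(1) by blast
          qed
        qed
        then have "measure M B = 0" using A by (subst prob_eq_0) (auto simp: B_def)
        then show False using Bhalf by simp
      qed
    qed
    then obtain n2 where n2: "measure M (Lt n2) > 0" by blast
    define d where "d = min (1 / real (Suc n1)) (1 / real (Suc n2))"
    have d: "d > 0" by (simp add: d_def)
    have "P a b" if ab: "a \<le> x" "x \<le> b" "b - a < d" for a b
    proof -
      define D1 where "D1 = \<rat> \<inter> {\<tau>. x \<le> exp \<tau> \<and> exp \<tau> \<le> x + 1 / real (Suc n1)}"
      define D2 where "D2 = \<rat> \<inter> {\<tau>. x - 1 / real (Suc n2) \<le> exp \<tau> \<and> exp \<tau> < x}"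
      have cd: "countable D1" "countable D2" unfolding D1_def D2_def by (rule countable_rational_Int)+
      have "0 < prob_below M U D1 (\<lambda>_. 1) * prob_below M U D2 (\<lambda>_. 1)"
        using n1 n2 by (simp add: prob_below_def Rt_def Lt_def D1_def D2_def)
      also have "\<dots> \<le> prob_below M U (D1 \<union> D2) (\<lambda>_. 1)" by (rule slepian_countable[OF U cd Ucov])
      also have "\<dots> \<le> prob_below M U (D a b) (\<lambda>_. 1)"
      proof (rule prob_below_antimono[OF assms(1) mU cD])
        have "b \<le> x + 1 / real (Suc n1)" "x - 1 / real (Suc n2) \<le> a" using ab by (auto simp: d_def)
        then show "D a b \<subseteq> D1 \<union> D2" unfolding D_def D1_def D2_def by auto
      qed auto
      finally show ?thesis by (simp add: P_def)
    qed
    then show ?case using d by blast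
  qed
  moreover have "D 0 (exp u) = \<rat> \<inter> {..u}" by (auto simp: D_def)
  ultimately show ?thesis by (simp add: P_def U_def)
qed

section \<open>The persistence rate of a stationary process\<close>

text \<open>
  This describes the Lamperti transform of \<open>X\<close> in logarithmic time.
\<close>

locale stationary_gaussian =
  fixes M :: "'a measure" and Z :: "real \<Rightarrow> 'a \<Rightarrow> real" and r :: "real \<Rightarrow> real"
  assumes Z: "gaussian_family M Z" and cov: "\<And>s t. (\<integral>\<omega>. Z s \<omega> * Z t \<omega> \<partial>M) = r (t - s)"
    and r_nonneg: "\<And>u. r u \<ge> 0" and r_cont: "continuous_on UNIV r" and r_int: "integrable lborel r" and r_pos: "r 0 > 0"
    and bounded: "AE \<omega> in M. \<exists>B. \<forall>\<tau>\<in>\<rat> \<inter> {0..1}. \<bar>Z \<tau> \<omega>\<bar> \<le> B"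
begin

sublocale prob_space M by (rule gaussian_familyD[OF Z])

lemma mZ: "Z \<tau> \<in> borel_measurable M" by (rule gaussian_familyD[OF Z])

lemma cov_nonneg: "(\<integral>\<omega>. Z s \<omega> * Z t \<omega> \<partial>M) \<ge> 0" by (simp add: cov r_nonneg)

definition below :: "real \<Rightarrow> nat \<Rightarrow> real" where
  "below l n = prob_below M Z (\<rat> \<inter> {0..real n}) (\<lambda>_. l)"

text \<open>
  The parameters of the shift estimate are chosen such that the error decays with a prescribed rate
  \<open>B\<close> and the cost is at most \<open>exp (2 * \<gamma> * n)\<close>.
\<close>

lemma level_shift:
  assumes "\<gamma> > 0" "B > 0"
  shows "\<exists>\<delta>>0. \<forall>n\<ge>1. \<forall>l. below l n \<le> exp (2 * \<gamma> * real n) * below (l - \<delta>) n + exp (- B * real n)"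
proof -
  obtain C where C: "C > 0" and shift: "\<And>N \<delta> \<gamma> l. N \<ge> 1 \<Longrightarrow> \<delta> > 0 \<Longrightarrow> \<gamma> > 0 \<Longrightarrow>
     exp (- \<gamma> * N - C * \<delta>\<^sup>2 * N) * (prob_below M Z (\<rat> \<inter> {0..N}) (\<lambda>_. l) - exp (- \<gamma>\<^sup>2 * N / (C * \<delta>\<^sup>2)))
       \<le> prob_below M Z (\<rat> \<inter> {0..N}) (\<lambda>_. l - \<delta>)"
    using stationary_shift_bound[OF Z cov r_nonneg r_cont r_int r_pos] by blast
  \<comment> \<open>The intended value of \<open>C * \<delta>\<^sup>2\<close>.\<close>
  define e where "e = min \<gamma> (\<gamma>\<^sup>2 / B)"
  have e: "e > 0" "e \<le> \<gamma>" "e \<le> \<gamma>\<^sup>2 / B" using assms by (auto simp: e_def)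
  define \<delta> where "\<delta> = sqrt (e / C)"
  have \<delta>: "\<delta> > 0" "C * \<delta>\<^sup>2 = e" using e C by (auto simp: \<delta>_def)
  have "below l n \<le> exp (2 * \<gamma> * real n) * below (l - \<delta>) n + exp (- B * real n)" if n: "n \<ge> 1" for n l
  proof -
    define p where "p = below l n"
    define p' where "p' = below (l - \<delta>) n"
    have p': "p' \<ge> 0" by (simp add: p'_def below_def prob_below_def)
    have s: "exp (- \<gamma> * real n - e * real n) * (p - exp (- \<gamma>\<^sup>2 * real n / e)) \<le> p'"
      using shift[of "real n" \<delta> \<gamma> l] n \<delta> assms(1) by (simp add: p_def p'_def below_def)
    have Be: "B * e \<le> \<gamma>\<^sup>2" using e assms by (simp add: field_simps)
    have "B * real n \<le> \<gamma>\<^sup>2 * real n / e"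
      using mult_right_mono[OF Be, of "real n"] e by (simp add: field_simps)
    then have e2: "exp (- \<gamma>\<^sup>2 * real n / e) \<le> exp (- B * real n)" by simp
    have "p - exp (- \<gamma>\<^sup>2 * real n / e) = exp (\<gamma> * real n + e * real n) * (exp (- \<gamma> * real n - e * real n) * (p - exp (- \<gamma>\<^sup>2 * real n / e)))"
      by (simp add: mult.assoc[symmetric] exp_add[symmetric])
    also have "\<dots> \<le> exp (\<gamma> * real n + e * real n) * p'" using s by (intro mult_left_mono) auto
    also have "\<dots> \<le> exp (2 * \<gamma> * real n) * p'"
    proof (rule mult_right_mono[OF _ p'])
      have "e * real n \<le> \<gamma> * real n" using e by (intro mult_right_mono) auto
      then show "exp (\<gamma> * real n + e * real n) \<le> exp (2 * \<gamma> * real n)" by simp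
    qed
    finally show ?thesis using e2 unfolding p_def p'_def by linarith
  qed
  then show ?thesis using \<delta>(1) by blast
qed

lemma below_minus_one_pos: "below (-1) 1 > 0"
proof -
  obtain s where s: "s > 0" "prob_exceed M Z (\<rat> \<inter> {0..1}) s \<le> 1/4"
    using prob_exceed_small[OF Z countable_rational_Int bounded, of "1/4"] by auto
  have m: "{\<omega>\<in>space M. \<forall>\<tau>\<in>\<rat> \<inter> {0..1}. Z \<tau> \<omega> \<le> s} \<in> sets M" by (rule prob_below_measurable[OF mZ countable_rational_Int])
  have m2: "{\<omega>\<in>space M. \<exists>\<tau>\<in>\<rat> \<inter> {0..1}. \<bar>Z \<tau> \<omega>\<bar> > s} \<in> sets M"
    unfolding pred_def[symmetric] by (rule pred_countable_Bex[OF countable_rational_Int]) (use mZ in measurable)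
  have "measure M (space M) \<le> measure M ({\<omega>\<in>space M. \<forall>\<tau>\<in>\<rat> \<inter> {0..1}. Z \<tau> \<omega> \<le> s} \<union> {\<omega>\<in>space M. \<exists>\<tau>\<in>\<rat> \<inter> {0..1}. \<bar>Z \<tau> \<omega>\<bar> > s})"
    using m m2 by (intro finite_measure_mono) (auto simp: not_less abs_le_iff)
  also have "\<dots> \<le> below s 1 + prob_exceed M Z (\<rat> \<inter> {0..1}) s"
    unfolding below_def prob_below_def prob_exceed_def using measure_Un_le[OF m m2] by simp
  finally have ps: "below s 1 \<ge> 3 / 4" using s by (simp add: prob_space)
  obtain C where C: "C > 0" and shift: "\<And>N \<delta> \<gamma> l. N \<ge> 1 \<Longrightarrow> \<delta> > 0 \<Longrightarrow> \<gamma> > 0 \<Longrightarrow>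
     exp (- \<gamma> * N - C * \<delta>\<^sup>2 * N) * (prob_below M Z (\<rat> \<inter> {0..N}) (\<lambda>_. l) - exp (- \<gamma>\<^sup>2 * N / (C * \<delta>\<^sup>2)))
       \<le> prob_below M Z (\<rat> \<inter> {0..N}) (\<lambda>_. l - \<delta>)"
    using stationary_shift_bound[OF Z cov r_nonneg r_cont r_int r_pos] by blast
  \<comment> \<open>A shift by \<open>s + 1\<close> brings the level \<open>s\<close>, where the probability is at least \<open>3 / 4\<close>, down to \<open>- 1\<close>;
    with this \<open>\<gamma>\<close> the error is \<open>exp (- 1) < 3 / 4\<close>.\<close>
  define \<gamma> where "\<gamma> = sqrt C * (s + 1)"
  have \<gamma>: "\<gamma> > 0" "\<gamma>\<^sup>2 / (C * (s + 1)\<^sup>2) = 1" using C s by (auto simp: \<gamma>_def power_mult_distrib)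
  have "exp (- 1 :: real) \<le> 1 / 2" using exp_ge_add_one_self[of 1] by (simp add: exp_minus field_simps)
  then have "0 < exp (- \<gamma> * 1 - C * (s + 1)\<^sup>2 * 1) * (below s 1 - exp (- \<gamma>\<^sup>2 * 1 / (C * (s + 1)\<^sup>2)))"
    using ps \<gamma> by simp
  also have "\<dots> \<le> below (-1) 1" using shift[of 1 "s + 1" \<gamma> s] s \<gamma> by (simp add: below_def)
  finally show ?thesis .
qed

lemma below_mono: "l \<le> l' \<Longrightarrow> n' \<le> n \<Longrightarrow> below l n \<le> below l' n'"
  unfolding below_def by (rule prob_below_antimono[OF prob_space_axioms mZ countable_rational_Int]) auto

lemma below_add: "below l m * below l n \<le> below l (m + n)"
proof -
  have "\<rat> \<inter> {0..real (m + n)} = \<rat> \<inter> {0..real m} \<union> \<rat> \<inter> {real m..real m + real n}" by auto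
  then show ?thesis
    using slepian_countable[OF Z countable_rational_Int[of "{0..real m}"] countable_rational_Int[of "{real m..real m + real n}"] cov_nonneg, of "\<lambda>_. l"]
    unfolding below_def by (simp add: stationary_prob_eq(1)[OF Z cov])
qed

lemma below_zero_pos: "below 0 n > 0"
proof -
  have 1: "below 0 1 > 0" using below_minus_one_pos below_mono[of "-1" 0 1 1] by simp
  have "below 0 (Suc n) > 0" for n
  proof (induction n)
    case (Suc n)
    then have "0 < below 0 (Suc n) * below 0 1" using 1 by simp
    also have "\<dots> \<le> below 0 (Suc n + 1)" by (rule below_add)
    finally show ?case by simp
  qed (use 1 in simp)
  then have "below 0 (Suc n) > 0" .
  also have "below 0 (Suc n) \<le> below 0 n" by (rule below_mono) auto
  finally show ?thesis .
qed

text \<open>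
  Slepian's inequality and stationarity make the persistence probability supermultiplicative in the
  length of the interval.
\<close>

lemma persistence_rate: "\<exists>\<theta>\<ge>0. (\<lambda>n. ln (below 0 n) / real n) \<longlonglongrightarrow> - \<theta>"
proof -
  have le1: "below 0 n \<le> 1" for n by (simp add: below_def prob_below_def)
  have "\<exists>\<theta>\<ge>0. (\<lambda>n. - ln (below 0 n) / real n) \<longlonglongrightarrow> \<theta>"
  proof (rule subadditive_limit)
    fix m n
    have "ln (below 0 m * below 0 n) \<le> ln (below 0 (m + n))"
      using below_add[of 0 m n] below_zero_pos by (subst ln_le_cancel_iff) auto
    then show "- ln (below 0 (m + n)) \<le> - ln (below 0 m) + - ln (below 0 n)"
      by (simp add: ln_mult_pos[OF below_zero_pos below_zero_pos])
  next
    show "0 \<le> - ln (below 0 n)" for n using le1[of n] below_zero_pos[of n] by (simp add: ln_le_zero_iff)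
  qed
  then obtain \<theta> where "\<theta> \<ge> 0" "(\<lambda>n. - ln (below 0 n) / real n) \<longlonglongrightarrow> \<theta>" by blast
  then show ?thesis using tendsto_minus[of "\<lambda>n. - ln (below 0 n) / real n" \<theta>] by auto
qed

end

section \<open>Persistence of a perturbed stationary process\<close>

text \<open>
  Logarithmic time is cut at about \<open>sqrt N\<close>: this is negligible against \<open>N\<close>, but late enough for the
  perturbation to exceed a fixed \<open>\<delta>\<close> only with superexponentially small probability.
\<close>

definition split_point :: "nat \<Rightarrow> nat" where
  "split_point N = nat \<lceil>sqrt (real N)\<rceil>"

lemma split_point_bounds: "sqrt (real N) \<le> real (split_point N)" "real (split_point N) \<le> sqrt (real N) + 1"
proof -
  have "0 \<le> sqrt (real N)" by simp
  then have "0 \<le> \<lceil>sqrt (real N)\<rceil>" by linarith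
  then show "sqrt (real N) \<le> real (split_point N)" "real (split_point N) \<le> sqrt (real N) + 1"
    unfolding split_point_def by (simp_all add: of_nat_nat)
qed

lemma split_point_limits:
  "(\<lambda>N. real (split_point N) / real N) \<longlonglongrightarrow> 0"
  "eventually (\<lambda>N. split_point N < N) sequentially"
  "(\<lambda>N. real (N - split_point N) / real N) \<longlonglongrightarrow> 1"
  "filterlim (\<lambda>N. N - split_point N) at_top sequentially"
  "filterlim (\<lambda>N. real (split_point N)) at_top sequentially"
proof -
  show l1: "(\<lambda>N. real (split_point N) / real N) \<longlonglongrightarrow> 0"
  proof (rule tendsto_sandwich[where f="\<lambda>_. 0" and h="\<lambda>N. (sqrt (real N) + 1) / real N"])
    show "(\<lambda>N. (sqrt (real N) + 1) / real N) \<longlonglongrightarrow> 0" by real_asymp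
    show "eventually (\<lambda>N. real (split_point N) / real N \<le> (sqrt (real N) + 1) / real N) sequentially"
      using split_point_bounds by (intro always_eventually allI divide_right_mono) auto
  qed auto
  then have "eventually (\<lambda>N. real (split_point N) / real N < 1 / 2) sequentially" by (rule order_tendstoD) simp
  then have half: "eventually (\<lambda>N. 2 * split_point N < N) sequentially"
    using eventually_gt_at_top[of 0]
  proof eventually_elim
    case (elim N)
    then have "2 * real (split_point N) < real N" by (simp add: field_simps)
    then show ?case by linarith
  qed
  then show ev: "eventually (\<lambda>N. split_point N < N) sequentially" by eventually_elim simp
  have "(\<lambda>N. 1 - real (split_point N) / real N) \<longlonglongrightarrow> 1 - 0" by (intro tendsto_intros l1)
  moreover have "eventually (\<lambda>N. 1 - real (split_point N) / real N = real (N - split_point N) / real N) sequentially"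
    using ev by eventually_elim (simp add: of_nat_diff field_simps)
  ultimately show "(\<lambda>N. real (N - split_point N) / real N) \<longlonglongrightarrow> 1" by (simp add: tendsto_cong)
  show "filterlim (\<lambda>N. N - split_point N) at_top sequentially"
    unfolding filterlim_at_top
  proof
    fix k
    show "eventually (\<lambda>N. k \<le> N - split_point N) sequentially"
      using half eventually_ge_at_top[of "2 * k"] by eventually_elim linarith
  qed
  have "filterlim (\<lambda>N. sqrt (real N)) at_top sequentially" by real_asymp
  then show "filterlim (\<lambda>N. real (split_point N)) at_top sequentially"
    by (rule filterlim_at_top_mono) (use split_point_bounds in auto)
qed

text \<open>
  Here \<open>Z\<close>, \<open>V\<close>, \<open>U\<close> are \<open>X\<close>, \<open>Y\<close> and \<open>X + Y\<close> in logarithmic time, all scaled with the index \<open>H\<close> of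
  \<open>X\<close>; so \<open>V\<close> is a stationary process damped by \<open>exp (- \<beta> * \<tau>)\<close> with \<open>\<beta> = H - K\<close>, and the level \<open>1\<close> of
  the original problem becomes \<open>exp (- H * \<tau>)\<close>.
\<close>

locale perturbed_stationary = stationary_gaussian +
  fixes U V :: "real \<Rightarrow> 'a \<Rightarrow> real" and H \<beta> c x0 :: real
  assumes UV: "\<And>\<tau> \<omega>. U \<tau> \<omega> = Z \<tau> \<omega> + V \<tau> \<omega>"
    and U: "gaussian_family M U" and U_cov: "\<And>s t. (\<integral>\<omega>. U s \<omega> * U t \<omega> \<partial>M) \<ge> 0"
    and mV: "\<And>\<tau>. V \<tau> \<in> borel_measurable M"
    and H: "H > 0" and \<beta>: "\<beta> > 0" and c: "c > 0"
    and tail: "\<And>\<delta> m N. \<delta> > 0 \<Longrightarrow> m < N \<Longrightarrow> \<delta> * exp (\<beta> * real m) \<ge> x0 \<Longrightarrow>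
       prob_exceed M V (\<rat> \<inter> {real m..real N}) \<delta> \<le> real N * exp (- c * \<delta> * exp (\<beta> * real m))"
begin

lemma mU: "U \<tau> \<in> borel_measurable M" by (rule gaussian_familyD[OF U])

definition survive :: "nat \<Rightarrow> real" where
  "survive N = prob_below M U (\<rat> \<inter> {..real N}) (\<lambda>\<tau>. exp (- H * \<tau>))"

definition nonpos :: "nat \<Rightarrow> nat \<Rightarrow> real" where
  "nonpos m N = prob_below M U (\<rat> \<inter> {real m..real N}) (\<lambda>_. 0)"

lemma survive_split:
  assumes "m \<le> N"
  shows "survive m * nonpos m N \<le> survive N"
proof -
  have "nonpos m N \<le> prob_below M U (\<rat> \<inter> {real m..real N}) (\<lambda>\<tau>. exp (- H * \<tau>))"
    unfolding nonpos_def by (rule prob_below_antimono[OF prob_space_axioms mU countable_rational_Int]) auto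
  then have "survive m * nonpos m N \<le> survive m * prob_below M U (\<rat> \<inter> {real m..real N}) (\<lambda>\<tau>. exp (- H * \<tau>))"
    by (intro mult_left_mono) (auto simp: survive_def prob_below_def)
  also have "\<dots> \<le> prob_below M U (\<rat> \<inter> {..real m} \<union> \<rat> \<inter> {real m..real N}) (\<lambda>\<tau>. exp (- H * \<tau>))"
    unfolding survive_def by (rule slepian_countable[OF U countable_rational_Int countable_rational_Int U_cov])
  also have "\<rat> \<inter> {..real m} \<union> \<rat> \<inter> {real m..real N} = \<rat> \<inter> {..real N}" using assms by auto
  finally show ?thesis by (simp add: survive_def)
qed

lemma window_shift: "m \<le> N \<Longrightarrow> prob_below M Z (\<rat> \<inter> {real m..real N}) (\<lambda>_. l) = below l (N - m)"
  using stationary_prob_eq(1)[OF Z cov, of m "real (N - m)" l] by (simp add: below_def of_nat_diff)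

lemma nonpos_lower:
  assumes "m \<le> N" "\<delta> > 0"
  shows "below (- \<delta>) (N - m) \<le> nonpos m N + prob_exceed M V (\<rat> \<inter> {real m..real N}) \<delta>"
  unfolding window_shift[OF assms(1), symmetric] nonpos_def
  by (rule prob_below_le_sum_exceed[OF prob_space_axioms mU mV countable_rational_Int]) (auto simp: UV)

lemma survive_upper:
  assumes "m \<le> N" "\<delta> > 0" "exp (- H * real m) \<le> \<delta> / 2"
  shows "survive N \<le> below \<delta> (N - m) + prob_exceed M V (\<rat> \<inter> {real m..real N}) (\<delta> / 2)"
proof -
  have "survive N \<le> prob_below M U (\<rat> \<inter> {real m..real N}) (\<lambda>\<tau>. exp (- H * \<tau>))"
    unfolding survive_def by (rule prob_below_antimono[OF prob_space_axioms mU countable_rational_Int]) auto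
  also have "\<dots> \<le> prob_below M Z (\<rat> \<inter> {real m..real N}) (\<lambda>_. \<delta>) + prob_exceed M V (\<rat> \<inter> {real m..real N}) (\<delta> / 2)"
  proof (rule prob_below_le_sum_exceed[OF prob_space_axioms mZ mV countable_rational_Int])
    fix \<tau> \<omega> assume \<tau>: "\<tau> \<in> \<rat> \<inter> {real m..real N}" and V: "\<bar>V \<tau> \<omega>\<bar> \<le> \<delta> / 2" and Ule: "U \<tau> \<omega> \<le> exp (- H * \<tau>)"
    have "H * real m \<le> H * \<tau>" using \<tau> H by (intro mult_left_mono) auto
    then have "exp (- H * \<tau>) \<le> exp (- H * real m)" by simp
    then show "Z \<tau> \<omega> \<le> \<delta>" using V Ule assms(3) unfolding UV by linarith
  qed
  finally show ?thesis unfolding window_shift[OF assms(1)] .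
qed

lemma tail_at_split_point:
  assumes \<delta>: "\<delta> > 0"
  shows "eventually (\<lambda>N. prob_exceed M V (\<rat> \<inter> {real (split_point N)..real N}) \<delta> \<le> exp (- B * real N)) sequentially"
proof -
  have "eventually (\<lambda>N. \<delta> * exp (\<beta> * sqrt (real N)) \<ge> x0) sequentially"
  proof -
    have "filterlim (\<lambda>N. \<delta> * exp (\<beta> * sqrt (real N))) at_top sequentially" using \<delta> \<beta> by real_asymp
    then show ?thesis by (simp add: filterlim_at_top)
  qed
  moreover have "eventually (\<lambda>N. real N * exp (- c * \<delta> * exp (\<beta> * sqrt (real N))) \<le> exp (- B * real N)) sequentially"
  proof -
    have cd: "c * \<delta> > 0" using c \<delta> by simp
    have "filterlim (\<lambda>N. ln (real N) - (c * \<delta>) * exp (\<beta> * sqrt (real N)) + B * real N) at_bot sequentially"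
      using cd \<beta> by real_asymp
    then have "eventually (\<lambda>N. ln (real N) - (c * \<delta>) * exp (\<beta> * sqrt (real N)) + B * real N \<le> 0) sequentially"
      by (simp add: filterlim_at_bot)
    then show ?thesis using eventually_gt_at_top[of 0]
    proof eventually_elim
      case (elim N)
      then have "exp (ln (real N) - (c * \<delta>) * exp (\<beta> * sqrt (real N))) \<le> exp (- B * real N)" by simp
      moreover have "exp (ln (real N) - (c * \<delta>) * exp (\<beta> * sqrt (real N))) = real N * exp (- c * \<delta> * exp (\<beta> * sqrt (real N)))"
        using elim by (simp add: exp_diff exp_minus field_simps)
      ultimately show ?case by simp
    qed
  qed
  ultimately show ?thesis using split_point_limits(2)
  proof eventually_elim
    case (elim N)
    have le: "exp (\<beta> * sqrt (real N)) \<le> exp (\<beta> * real (split_point N))"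
      using \<beta> split_point_bounds(1)[of N] by simp
    have "\<delta> * exp (\<beta> * sqrt (real N)) \<le> \<delta> * exp (\<beta> * real (split_point N))" using \<delta> le by (intro mult_left_mono) auto
    then have "prob_exceed M V (\<rat> \<inter> {real (split_point N)..real N}) \<delta> \<le> real N * exp (- c * \<delta> * exp (\<beta> * real (split_point N)))"
      using elim by (intro tail \<delta>) auto
    also have "\<dots> \<le> real N * exp (- c * \<delta> * exp (\<beta> * sqrt (real N)))"
    proof (intro mult_left_mono)
      have "(c * \<delta>) * exp (\<beta> * sqrt (real N)) \<le> (c * \<delta>) * exp (\<beta> * real (split_point N))"
        using le c \<delta> by (intro mult_left_mono) auto
      then show "exp (- c * \<delta> * exp (\<beta> * real (split_point N))) \<le> exp (- c * \<delta> * exp (\<beta> * sqrt (real N)))" by simp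
    qed auto
    also have "\<dots> \<le> exp (- B * real N)" using elim by simp
    finally show ?case .
  qed
qed

text \<open>
  Once \<open>V\<close> is unlikely to exceed \<open>1\<close> on a window of length \<open>1\<close>, the sum \<open>U\<close> is non-positive on the window
  with a probability bounded away from \<open>0\<close>, because \<open>Z \<le> - 1\<close> has positive probability there. Slepian's
  inequality multiplies these bounds. Survival up to the split point thus costs only \<open>exp (- O(sqrt N))\<close>.
\<close>

lemma survive_geometric_lower:
  assumes pos: "\<And>N. survive N > 0"
  shows "\<exists>a>0. \<exists>b>0. b \<le> 1 \<and> (\<forall>\<^sub>F m in sequentially. survive m \<ge> a * b ^ m)"
proof -
  define p where "p = below (-1) 1"
  have p: "p > 0" "p \<le> 1" using below_minus_one_pos by (auto simp: p_def below_def prob_below_def)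
  have "eventually (\<lambda>k::nat. exp (\<beta> * real k) \<ge> x0) sequentially"
  proof -
    have "filterlim (\<lambda>k::nat. exp (\<beta> * real k)) at_top sequentially" using \<beta> by real_asymp
    then show ?thesis by (simp add: filterlim_at_top)
  qed
  moreover have "eventually (\<lambda>k::nat. real (Suc k) * exp (- c * exp (\<beta> * real k)) \<le> p / 2) sequentially"
  proof -
    have "(\<lambda>k::nat. real (Suc k) * exp (- c * exp (\<beta> * real k))) \<longlonglongrightarrow> 0" using c \<beta> by real_asymp
    then have "eventually (\<lambda>k::nat. real (Suc k) * exp (- c * exp (\<beta> * real k)) < p / 2) sequentially"
      using p by (intro order_tendstoD) auto
    then show ?thesis by eventually_elim simp
  qed
  ultimately have "eventually (\<lambda>k. nonpos k (Suc k) \<ge> p / 2) sequentially"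
  proof eventually_elim
    case (elim k)
    have "prob_exceed M V (\<rat> \<inter> {real k..real (Suc k)}) 1 \<le> real (Suc k) * exp (- c * 1 * exp (\<beta> * real k))"
      using elim by (intro tail) auto
    then show ?case using nonpos_lower[of k "Suc k" 1] elim by (simp add: p_def)
  qed
  then obtain k0 where k0: "\<And>k. k \<ge> k0 \<Longrightarrow> nonpos k (Suc k) \<ge> p / 2" by (auto simp: eventually_sequentially)
  have "survive k0 * (p / 2) ^ m \<le> survive m" if "m \<ge> k0" for m
    using that
  proof (induction m rule: dec_induct)
    case base
    have "survive k0 * (p / 2) ^ k0 \<le> survive k0 * 1"
      using p pos[of k0] by (intro mult_left_mono power_le_one) auto
    then show ?case by simp
  next
    case (step m)
    have "survive k0 * (p / 2) ^ Suc m = (survive k0 * (p / 2) ^ m) * (p / 2)" by simp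
    also have "\<dots> \<le> survive m * nonpos m (Suc m)"
      using step k0[of m] p pos[of m] pos[of k0] by (intro mult_mono) auto
    also have "\<dots> \<le> survive (Suc m)" by (rule survive_split) simp
    finally show ?case .
  qed
  then have "eventually (\<lambda>m. survive m \<ge> survive k0 * (p / 2) ^ m) sequentially"
    by (auto simp: eventually_sequentially)
  then show ?thesis using p pos[of k0] by (intro exI[of _ "survive k0"] conjI exI[of _ "p / 2"]) auto
qed

lemma below_zero_bounds:
  assumes lim: "(\<lambda>n. ln (below 0 n) / real n) \<longlonglongrightarrow> - \<theta>" and \<gamma>: "\<gamma> > 0"
  shows "eventually (\<lambda>n. exp ((- \<theta> - \<gamma>) * real n) \<le> below 0 n \<and> below 0 n \<le> exp ((- \<theta> + \<gamma>) * real n)) sequentially"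
proof -
  have "eventually (\<lambda>n. ln (below 0 n) / real n > - \<theta> - \<gamma>) sequentially"
    "eventually (\<lambda>n. ln (below 0 n) / real n < - \<theta> + \<gamma>) sequentially"
    using order_tendstoD[OF lim] \<gamma> by auto
  then show ?thesis using eventually_gt_at_top[of 0]
  proof eventually_elim
    case (elim n)
    then have "(- \<theta> - \<gamma>) * real n \<le> ln (below 0 n)" "ln (below 0 n) \<le> (- \<theta> + \<gamma>) * real n"
      by (simp_all add: field_simps)
    then show ?case using below_zero_pos[of n] by (simp add: ln_ge_iff) (metis exp_le_cancel_iff exp_ln)
  qed
qed

text \<open>
  Discard the times before the split point. Afterwards \<open>U\<close> below its barrier forces \<open>Z \<le> \<delta>\<close> up to a
  negligible event, and the level \<open>\<delta>\<close> is lowered to \<open>0\<close> by the shift estimate.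
\<close>

theorem survive_rate_upper:
  assumes pos: "\<And>N. survive N > 0" and lim: "(\<lambda>n. ln (below 0 n) / real n) \<longlonglongrightarrow> - \<theta>"
    and \<theta>: "\<theta> \<ge> 0" and \<gamma>: "\<gamma> > 0"
  shows "eventually (\<lambda>N. ln (survive N) / real N \<le> ln 3 / real N + (3 * \<gamma> - \<theta>) * (real (N - split_point N) / real N)) sequentially"
proof -
  define B where "B = \<theta> + 1"
  have B: "B > 0" using \<theta> by (simp add: B_def)
  obtain \<delta> where \<delta>: "\<delta> > 0" and shift: "\<And>n l. n \<ge> 1 \<Longrightarrow> below l n \<le> exp (2 * \<gamma> * real n) * below (l - \<delta>) n + exp (- B * real n)"
    using level_shift[OF \<gamma> B] by blast
  have "eventually (\<lambda>N. exp (- H * real (split_point N)) \<le> \<delta> / 2) sequentially"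
  proof -
    have "((\<lambda>x. exp (- H * x)) \<longlongrightarrow> 0) at_top" using H by real_asymp
    then have "(\<lambda>N. exp (- H * real (split_point N))) \<longlonglongrightarrow> 0"
      using split_point_limits(5) by (rule filterlim_compose)
    then have "eventually (\<lambda>N. exp (- H * real (split_point N)) < \<delta> / 2) sequentially"
      using \<delta> by (intro order_tendstoD) auto
    then show ?thesis by eventually_elim simp
  qed
  moreover have "eventually (\<lambda>N. prob_exceed M V (\<rat> \<inter> {real (split_point N)..real N}) (\<delta> / 2) \<le> exp (- B * real N)) sequentially"
    by (rule tail_at_split_point) (use \<delta> in simp)
  moreover have "eventually (\<lambda>N. below 0 (N - split_point N) \<le> exp ((- \<theta> + \<gamma>) * real (N - split_point N))) sequentially"
    using filterlim_iff[THEN iffD1, OF split_point_limits(4), rule_format, OF below_zero_bounds[OF lim \<gamma>]]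
    by eventually_elim simp
  ultimately show ?thesis using split_point_limits(2)
  proof eventually_elim
    case (elim N)
    define n where "n = N - split_point N"
    have n: "n \<ge> 1" "n \<le> N" using elim by (auto simp: n_def)
    have "survive N \<le> below \<delta> n + exp (- B * real N)"
      using survive_upper[of "split_point N" N \<delta>] elim \<delta> by (simp add: n_def)
    also have "below \<delta> n \<le> exp (2 * \<gamma> * real n) * below 0 n + exp (- B * real n)"
      using shift[OF n(1), of \<delta>] by simp
    also have "exp (2 * \<gamma> * real n) * below 0 n \<le> exp (2 * \<gamma> * real n) * exp ((- \<theta> + \<gamma>) * real n)"
      using elim by (intro mult_left_mono) (auto simp: n_def)
    also have "\<dots> = exp ((3 * \<gamma> - \<theta>) * real n)" by (simp add: exp_add[symmetric] algebra_simps)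
    also have "exp (- B * real N) \<le> exp (- B * real n)" using n B by simp
    also have "exp (- B * real n) \<le> exp ((3 * \<gamma> - \<theta>) * real n)"
      using \<gamma> by (subst exp_le_cancel_iff, intro mult_right_mono) (auto simp: B_def)
    finally have "survive N \<le> 3 * exp ((3 * \<gamma> - \<theta>) * real n)" by simp
    then have "ln (survive N) \<le> ln (3 * exp ((3 * \<gamma> - \<theta>) * real n))"
      using pos[of N] by (subst ln_le_cancel_iff) auto
    also have "\<dots> = ln 3 + (3 * \<gamma> - \<theta>) * real n" by (simp add: ln_mult)
    finally have "ln (survive N) / real N \<le> (ln 3 + (3 * \<gamma> - \<theta>) * real n) / real N"
      by (intro divide_right_mono) auto
    then show ?case by (simp add: n_def add_divide_distrib)
  qed
qed

text \<open>
  By Slepian's inequality it suffices to survive up to the split point and to have \<open>U \<le> 0\<close> afterwards.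
  The latter follows from \<open>Z \<le> - \<delta>\<close> up to a negligible event, and this is comparable to \<open>Z \<le> 0\<close> by
  the shift estimate. The bound \<open>\<gamma> \<le> 1 / 4\<close> keeps the error rate \<open>\<theta> + 1\<close> faster than the
  main rate \<open>\<theta> + 3 * \<gamma>\<close>.
\<close>

theorem survive_rate_lower:
  assumes pos: "\<And>N. survive N > 0" and lim: "(\<lambda>n. ln (below 0 n) / real n) \<longlonglongrightarrow> - \<theta>"
    and \<theta>: "\<theta> \<ge> 0" and \<gamma>: "\<gamma> > 0" "\<gamma> \<le> 1 / 4"
  shows "\<exists>a b. eventually (\<lambda>N. ln (survive N) / real N \<ge>
     a / real N + b * (real (split_point N) / real N) - (\<theta> + 3 * \<gamma>) * (real (N - split_point N) / real N)) sequentially"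
proof -
  define B where "B = \<theta> + 1"
  have B: "B > 0" using \<theta> by (simp add: B_def)
  obtain \<delta> where \<delta>: "\<delta> > 0" and shift: "\<And>n l. n \<ge> 1 \<Longrightarrow> below l n \<le> exp (2 * \<gamma> * real n) * below (l - \<delta>) n + exp (- B * real n)"
    using level_shift[OF \<gamma>(1) B] by blast
  obtain a b where ab: "a > 0" "b > 0" "b \<le> 1" and geo: "eventually (\<lambda>m. survive m \<ge> a * b ^ m) sequentially"
    using survive_geometric_lower[OF pos] by blast
  have "filterlim split_point at_top sequentially"
    using split_point_limits(5) by (simp add: filterlim_sequentially_iff_filterlim_real)
  then have "eventually (\<lambda>N. survive (split_point N) \<ge> a * b ^ split_point N) sequentially"
    using geo by (rule eventually_compose_filterlim[rotated])
  moreover have "eventually (\<lambda>N. prob_exceed M V (\<rat> \<inter> {real (split_point N)..real N}) \<delta> \<le> exp (- B * real N)) sequentially"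
    by (rule tail_at_split_point) (use \<delta> in simp)
  moreover have "eventually (\<lambda>N. exp ((- \<theta> - \<gamma>) * real (N - split_point N)) \<le> below 0 (N - split_point N)) sequentially"
    using filterlim_iff[THEN iffD1, OF split_point_limits(4), rule_format, OF below_zero_bounds[OF lim \<gamma>(1)]]
    by eventually_elim simp
  moreover have "eventually (\<lambda>N. N - split_point N \<ge> 8) sequentially"
    using split_point_limits(4) by (simp add: filterlim_at_top)
  ultimately have "eventually (\<lambda>N. ln (survive N) / real N \<ge>
     (ln a + ln (1/2)) / real N + ln b * (real (split_point N) / real N) - (\<theta> + 3 * \<gamma>) * (real (N - split_point N) / real N)) sequentially"
    using split_point_limits(2)
  proof eventually_elim
    case (elim N)
    define n where "n = N - split_point N"
    have n: "n \<ge> 8" "n \<le> N" using elim by (auto simp: n_def)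
    define E where "E = exp ((- \<theta> - 3 * \<gamma>) * real n)"
    have quarter: "exp (- B * real n) \<le> E / 4"
    proof -
      have "exp (- 2 :: real) \<le> 1 / 4"
      proof -
        have "2 \<le> exp (1 :: real)" using exp_ge_add_one_self[of 1] by simp
        then have "2 * 2 \<le> exp 1 * exp (1 :: real)" by (intro mult_mono) auto
        also have "\<dots> = exp 2" by (simp add: exp_add[symmetric])
        finally show ?thesis by (simp add: exp_minus field_simps)
      qed
      moreover have "exp (- (1 - 3 * \<gamma>) * real n) \<le> exp (- 2)"
      proof -
        have "1 / 4 * 8 \<le> (1 - 3 * \<gamma>) * real n" using \<gamma> n by (intro mult_mono) auto
        then show ?thesis unfolding exp_le_cancel_iff by (simp add: algebra_simps)
      qed
      ultimately have "exp (- (1 - 3 * \<gamma>) * real n) \<le> 1 / 4" by (rule order_trans[rotated])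
      then have "E * exp (- (1 - 3 * \<gamma>) * real n) \<le> E * (1 / 4)"
        by (rule mult_left_mono) (simp add: E_def)
      then show ?thesis by (simp add: E_def B_def exp_add[symmetric] algebra_simps)
    qed
    have "E = exp (- 2 * \<gamma> * real n) * exp ((- \<theta> - \<gamma>) * real n)"
      by (simp add: E_def exp_add[symmetric] algebra_simps)
    also have "\<dots> \<le> exp (- 2 * \<gamma> * real n) * below 0 n"
      using elim by (intro mult_left_mono) (auto simp: n_def)
    also have "\<dots> \<le> exp (- 2 * \<gamma> * real n) * (exp (2 * \<gamma> * real n) * below (- \<delta>) n + exp (- B * real n))"
      using shift[of n 0] n by (intro mult_left_mono) auto
    also have "\<dots> = below (- \<delta>) n + exp (- 2 * \<gamma> * real n) * exp (- B * real n)"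
      by (simp add: distrib_left mult.assoc[symmetric] exp_add[symmetric])
    also have "exp (- 2 * \<gamma> * real n) * exp (- B * real n) \<le> 1 * (E / 4)"
      using \<gamma> by (intro mult_mono quarter) auto
    also have "below (- \<delta>) n \<le> nonpos (split_point N) N + exp (- B * real N)"
      using nonpos_lower[of "split_point N" N \<delta>] elim \<delta> by (simp add: n_def)
    also have "exp (- B * real N) \<le> exp (- B * real n)" using n B by simp
    also note quarter
    finally have np: "E / 2 \<le> nonpos (split_point N) N" by simp
    have "(a * b ^ split_point N) * (E / 2) \<le> survive (split_point N) * nonpos (split_point N) N"
      using elim np ab pos[of "split_point N"] by (intro mult_mono) (auto simp: E_def)
    also have "\<dots> \<le> survive N" by (rule survive_split) (use elim in simp)
    finally have "(a * b ^ split_point N) * (E / 2) \<le> survive N" .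
    then have "ln ((a * b ^ split_point N) * (E * (1/2))) \<le> ln (survive N)"
      using ab pos[of N] by (subst ln_le_cancel_iff) (auto simp: E_def)
    also have "ln ((a * b ^ split_point N) * (E * (1/2))) = ln a + real (split_point N) * ln b + ((- \<theta> - 3 * \<gamma>) * real n + ln (1/2))"
    proof -
      have "ln ((a * b ^ split_point N) * (E * (1/2))) = ln (a * b ^ split_point N) + ln (E * (1/2))"
        using ab by (intro ln_mult_pos) (auto simp: E_def)
      moreover have "ln (a * b ^ split_point N) = ln a + real (split_point N) * ln b"
        using ab by (subst ln_mult_pos) (auto simp: ln_realpow)
      moreover have "ln (E * (1/2)) = (- \<theta> - 3 * \<gamma>) * real n + ln (1/2)"
        by (subst ln_mult_pos) (auto simp: E_def)
      ultimately show ?thesis by simp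
    qed
    finally have "(ln a + real (split_point N) * ln b + ((- \<theta> - 3 * \<gamma>) * real n + ln (1/2))) / real N \<le> ln (survive N) / real N"
      by (intro divide_right_mono) auto
    moreover have "(ln a + real (split_point N) * ln b + ((- \<theta> - 3 * \<gamma>) * real n + ln (1/2))) / real N =
      (ln a + ln (1/2)) / real N + ln b * (real (split_point N) / real N) - (\<theta> + 3 * \<gamma>) * (real n / real N)"
      by (simp add: add_divide_distrib diff_divide_distrib algebra_simps del: ln_div)
    ultimately show ?case by (simp only: n_def)
  qed
  then show ?thesis by blast
qed

theorem survive_rate:
  assumes pos: "\<And>N. survive N > 0" and lim: "(\<lambda>n. ln (below 0 n) / real n) \<longlonglongrightarrow> - \<theta>" and \<theta>: "\<theta> \<ge> 0"
  shows "(\<lambda>N. ln (survive N) / real N) \<longlonglongrightarrow> - \<theta>"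
proof (rule order_tendstoI)
  have inv: "(\<lambda>N. a / real N) \<longlonglongrightarrow> 0" for a :: real by real_asymp
  fix x assume x: "- \<theta> < x"
  define \<gamma> where "\<gamma> = (x + \<theta>) / 4"
  have \<gamma>: "\<gamma> > 0" using x by (simp add: \<gamma>_def)
  have "(\<lambda>N. ln 3 / real N + (3 * \<gamma> - \<theta>) * (real (N - split_point N) / real N)) \<longlonglongrightarrow> 0 + (3 * \<gamma> - \<theta>) * 1"
    by (intro tendsto_intros inv split_point_limits)
  moreover have "0 + (3 * \<gamma> - \<theta>) * 1 < x" using x by (simp add: \<gamma>_def field_simps)
  ultimately have "eventually (\<lambda>N. ln 3 / real N + (3 * \<gamma> - \<theta>) * (real (N - split_point N) / real N) < x) sequentially"
    by (rule order_tendstoD)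
  then show "eventually (\<lambda>N. ln (survive N) / real N < x) sequentially"
    using survive_rate_upper[OF pos lim \<theta> \<gamma>] by eventually_elim simp
next
  have inv: "(\<lambda>N. a / real N) \<longlonglongrightarrow> 0" for a :: real by real_asymp
  fix x assume x: "x < - \<theta>"
  define \<gamma> where "\<gamma> = min (1/4) ((- \<theta> - x) / 4)"
  have \<gamma>: "\<gamma> > 0" "\<gamma> \<le> 1/4" using x unfolding \<gamma>_def by auto
  have \<gamma>x: "\<gamma> \<le> (- \<theta> - x) / 4" unfolding \<gamma>_def by (rule min.cobounded2)
  obtain a b where ev: "eventually (\<lambda>N. ln (survive N) / real N \<ge>
     a / real N + b * (real (split_point N) / real N) - (\<theta> + 3 * \<gamma>) * (real (N - split_point N) / real N)) sequentially"
    using survive_rate_lower[OF pos lim \<theta> \<gamma>] by blast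
  have "(\<lambda>N. a / real N + b * (real (split_point N) / real N) - (\<theta> + 3 * \<gamma>) * (real (N - split_point N) / real N))
     \<longlonglongrightarrow> 0 + b * 0 - (\<theta> + 3 * \<gamma>) * 1"
    by (intro tendsto_intros inv split_point_limits)
  moreover have "x < 0 + b * 0 - (\<theta> + 3 * \<gamma>) * 1" using x \<gamma>x by (simp add: field_simps)
  ultimately have "eventually (\<lambda>N. x < a / real N + b * (real (split_point N) / real N) - (\<theta> + 3 * \<gamma>) * (real (N - split_point N) / real N)) sequentially"
    by (rule order_tendstoD)
  then show "eventually (\<lambda>N. x < ln (survive N) / real N) sequentially"
    using ev by eventually_elim simp
qed

end

section \<open>The Lamperti transform and the persistence exponent\<close>

lemma self_similar_second_moment:
  assumes "prob_space M" and X: "\<And>t. t \<ge> 0 \<Longrightarrow> X t \<in> borel_measurable M"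
    and ss: "self_similar M H X" and c: "c > 0" and st: "s \<ge> 0" "t \<ge> 0"
  shows "(\<integral>\<omega>. X (c * s) \<omega> * X (c * t) \<omega> \<partial>M) = (c powr H)\<^sup>2 * (\<integral>\<omega>. X s \<omega> * X t \<omega> \<partial>M)"
proof -
  define J where "J = {s, t}"
  have J: "finite J" "J \<subseteq> {0..}" "s \<in> J" "t \<in> J" using st by (auto simp: J_def)
  have J0: "u \<ge> 0" if "u \<in> J" for u using J(2) that by auto
  have d: "distr M (\<Pi>\<^sub>M t\<in>J. borel) (\<lambda>\<omega>. \<lambda>u\<in>J. X (c * u) \<omega>) = distr M (\<Pi>\<^sub>M t\<in>J. borel) (\<lambda>\<omega>. \<lambda>u\<in>J. c powr H * X u \<omega>)"
    using ss c J by (simp add: self_similar_def same_fdd_def)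
  have m1: "(\<lambda>\<omega>. \<lambda>u\<in>J. X (c * u) \<omega>) \<in> M \<rightarrow>\<^sub>M (\<Pi>\<^sub>M t\<in>J. borel)"
    using X c J0 by (intro measurable_restrict) auto
  have m2: "(\<lambda>\<omega>. \<lambda>u\<in>J. c powr H * X u \<omega>) \<in> M \<rightarrow>\<^sub>M (\<Pi>\<^sub>M t\<in>J. borel)"
    using X c J0 by (intro measurable_restrict borel_measurable_times) auto
  have f: "(\<lambda>x. x s * x t) \<in> borel_measurable (\<Pi>\<^sub>M t\<in>J. borel :: real measure)"
    using J by (intro borel_measurable_times measurable_component_singleton) auto
  have "(\<integral>\<omega>. X (c * s) \<omega> * X (c * t) \<omega> \<partial>M) = (\<integral>x. x s * x t \<partial>distr M (\<Pi>\<^sub>M t\<in>J. borel) (\<lambda>\<omega>. \<lambda>u\<in>J. X (c * u) \<omega>))"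
    by (subst integral_distr[OF m1 f]) (use J in simp)
  also have "\<dots> = (\<integral>\<omega>. (c powr H)\<^sup>2 * (X s \<omega> * X t \<omega>) \<partial>M)"
    unfolding d by (subst integral_distr[OF m2 f]) (use J in \<open>simp add: power2_eq_square mult_ac\<close>)
  finally show ?thesis by simp
qed

lemma lamperti_gaussian_family:
  assumes "prob_space M" "gaussian_process M X" "centred M X"
  shows "gaussian_family M (lamperti H X)"
proof -
  have "gaussian_family M (\<lambda>\<tau>. X (exp \<tau>))" by (rule gaussian_process_family[OF assms]) simp
  from gaussian_family_linear[OF this, of "\<lambda>\<tau>. {\<tau>}" "\<lambda>\<tau> _. exp (- \<tau> * H)"]
  show ?thesis by (simp add: lamperti_def[abs_def])
qed

lemma gaussian_process_measurable:
  assumes "gaussian_process M X" "t \<ge> 0"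
  shows "X t \<in> borel_measurable M"
proof -
  have "gaussian_rv M (\<lambda>\<omega>. \<Sum>u\<in>{t}. 1 * X u \<omega>)"
    using assms unfolding gaussian_process_def by (elim allE[of _ "{t}"] allE[of _ "\<lambda>_. 1"]) auto
  then show ?thesis by (simp add: gaussian_rv_def)
qed

lemma covariance_centred:
  "centred M X \<Longrightarrow> s \<ge> 0 \<Longrightarrow> t \<ge> 0 \<Longrightarrow> covariance M (X s) (X t) = (\<integral>\<omega>. X s \<omega> * X t \<omega> \<partial>M)"
  by (simp add: covariance_def centred_def)

lemma covariance_lamperti:
  assumes "centred M X"
  shows "covariance M (X 1) (lamperti H X \<tau>) = exp (- \<tau> * H) * (\<integral>\<omega>. X 1 \<omega> * X (exp \<tau>) \<omega> \<partial>M)"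
proof -
  have "(\<integral>\<omega>. X 1 \<omega> \<partial>M) = 0" "(\<integral>\<omega>. X (exp \<tau>) \<omega> \<partial>M) = 0" using assms by (auto simp: centred_def)
  moreover have "lamperti H X \<tau> = (\<lambda>\<omega>. exp (- \<tau> * H) * X (exp \<tau>) \<omega>)" by (simp add: lamperti_def fun_eq_iff)
  ultimately have "covariance M (X 1) (lamperti H X \<tau>) = (\<integral>\<omega>. exp (- \<tau> * H) * (X 1 \<omega> * X (exp \<tau>) \<omega>) \<partial>M)"
    by (simp add: covariance_def mult.left_commute)
  then show ?thesis by simp
qed

lemma lamperti_stationary:
  assumes "prob_space M" and X: "gaussian_process M X" "centred M X" and ss: "self_similar M H X"
  shows "(\<integral>\<omega>. lamperti H X s \<omega> * lamperti H X t \<omega> \<partial>M) = covariance M (X 1) (lamperti H X (t - s))"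
proof -
  have "(\<integral>\<omega>. X (exp s * 1) \<omega> * X (exp s * exp (t - s)) \<omega> \<partial>M) = (exp s powr H)\<^sup>2 * (\<integral>\<omega>. X 1 \<omega> * X (exp (t - s)) \<omega> \<partial>M)"
    by (rule self_similar_second_moment[OF assms(1) gaussian_process_measurable[OF X(1)] ss]) auto
  moreover have "exp s * exp (t - s) = exp t" by (simp add: exp_add[symmetric])
  moreover have "(exp s powr H)\<^sup>2 = exp (2 * s * H)" by (simp add: powr_def exp_of_nat_mult[symmetric] mult_ac)
  ultimately have m: "(\<integral>\<omega>. X (exp s) \<omega> * X (exp t) \<omega> \<partial>M) = exp (2 * s * H) * (\<integral>\<omega>. X 1 \<omega> * X (exp (t - s)) \<omega> \<partial>M)" by simp
  have "lamperti H X s \<omega> * lamperti H X t \<omega> = exp (- (s + t) * H) * (X (exp s) \<omega> * X (exp t) \<omega>)" for \<omega>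
    by (simp add: lamperti_def exp_add[symmetric] algebra_simps mult_exp_exp)
  then have "(\<integral>\<omega>. lamperti H X s \<omega> * lamperti H X t \<omega> \<partial>M) = exp (- (s + t) * H) * (exp (2 * s * H) * (\<integral>\<omega>. X 1 \<omega> * X (exp (t - s)) \<omega> \<partial>M))"
    by (simp add: m)
  also have "exp (- (s + t) * H) * (exp (2 * s * H) * y) = exp (- (t - s) * H) * y" for y
    by (simp add: mult.assoc[symmetric] exp_add[symmetric]) (simp add: algebra_simps)
  finally show ?thesis by (simp add: covariance_lamperti[OF X(2)])
qed

lemma lamperti_bounded:
  assumes "AE \<omega> in M. cadlag (\<lambda>t. X t \<omega>)" and H: "H > 0"
  shows "AE \<omega> in M. \<exists>B. \<forall>\<tau>\<in>\<rat> \<inter> {0..1}. \<bar>lamperti H X \<tau> \<omega>\<bar> \<le> B"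
  using assms(1)
proof eventually_elim
  case (elim \<omega>)
  obtain B where B: "\<forall>t\<in>{0..exp 1}. \<bar>X t \<omega>\<bar> \<le> B" using cadlag_bounded[OF elim, of "exp 1"] by auto
  have "\<bar>lamperti H X \<tau> \<omega>\<bar> \<le> B" if \<tau>: "0 \<le> \<tau>" "\<tau> \<le> 1" for \<tau>
  proof -
    have "\<bar>lamperti H X \<tau> \<omega>\<bar> = exp (- \<tau> * H) * \<bar>X (exp \<tau>) \<omega>\<bar>" by (simp add: lamperti_def abs_mult)
    also have "\<dots> \<le> 1 * B" using \<tau> H B by (intro mult_mono) auto
    finally show ?thesis by simp
  qed
  then show ?case by (intro exI[of _ B]) auto
qed

text \<open>
  Passing from \<open>T\<close> to the powers of \<open>exp 1\<close> around it does not change logarithms to leading order.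
\<close>

lemma floor_ln_limits:
  "filterlim (\<lambda>T::real. nat \<lfloor>ln T\<rfloor>) at_top at_top"
  "((\<lambda>T::real. real (nat \<lfloor>ln T\<rfloor>) / ln T) \<longlongrightarrow> 1) at_top"
  "((\<lambda>T::real. real (Suc (nat \<lfloor>ln T\<rfloor>)) / ln T) \<longlongrightarrow> 1) at_top"
proof -
  have big: "eventually (\<lambda>T::real. ln T \<ge> c) at_top" for c
    using ln_at_top by (simp add: filterlim_at_top)
  show "filterlim (\<lambda>T::real. nat \<lfloor>ln T\<rfloor>) at_top at_top"
    unfolding filterlim_at_top
  proof
    fix k :: nat
    show "eventually (\<lambda>T::real. k \<le> nat \<lfloor>ln T\<rfloor>) at_top"
      using big[of "real k"] by eventually_elim (simp add: le_nat_floor)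
  qed
  have lim: "((\<lambda>T::real. 1 - 1 / ln T) \<longlongrightarrow> 1) at_top" "((\<lambda>T::real. 1 + 1 / ln T) \<longlongrightarrow> 1) at_top" by real_asymp+
  have bounds: "eventually (\<lambda>T::real. 1 - 1 / ln T \<le> real (nat \<lfloor>ln T\<rfloor>) / ln T \<and> real (nat \<lfloor>ln T\<rfloor>) / ln T \<le> 1
     \<and> 1 \<le> real (Suc (nat \<lfloor>ln T\<rfloor>)) / ln T \<and> real (Suc (nat \<lfloor>ln T\<rfloor>)) / ln T \<le> 1 + 1 / ln T) at_top"
    using big[of 1]
  proof eventually_elim
    case (elim T)
    define n where "n = nat \<lfloor>ln T\<rfloor>"
    have f: "real n \<le> ln T" "ln T \<le> real n + 1" using elim unfolding n_def by linarith+
    have "1 - 1 / ln T = (ln T - 1) / ln T" "1 + 1 / ln T = (ln T + 1) / ln T" using elim by (auto simp: field_simps)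
    then show ?case using f elim unfolding n_def[symmetric] by (auto intro!: divide_right_mono simp: le_divide_eq divide_le_eq)
  qed
  show "((\<lambda>T::real. real (nat \<lfloor>ln T\<rfloor>) / ln T) \<longlongrightarrow> 1) at_top"
    by (rule tendsto_sandwich[OF _ _ lim(1) tendsto_const]) (use bounds in \<open>auto elim!: eventually_mono\<close>)
  show "((\<lambda>T::real. real (Suc (nat \<lfloor>ln T\<rfloor>)) / ln T) \<longlongrightarrow> 1) at_top"
    by (rule tendsto_sandwich[OF _ _ tendsto_const lim(2)]) (use bounds in \<open>auto elim!: eventually_mono\<close>)
qed

text \<open>
  For monotone \<open>p\<close> the times \<open>exp n\<close> suffice, since consecutive ones have asymptotically equal
  logarithms.
\<close>

lemma power_decay_from_exponential_times:
  fixes p :: "real \<Rightarrow> real"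
  assumes anti: "\<And>T T'. 0 < T \<Longrightarrow> T \<le> T' \<Longrightarrow> p T' \<le> p T" and pos: "\<And>n::nat. p (exp (real n)) > 0"
    and lim: "(\<lambda>n::nat. ln (p (exp (real n))) / real n) \<longlonglongrightarrow> - \<theta>"
  shows "power_decay p \<theta>"
proof -
  define N where "N T = nat \<lfloor>ln T\<rfloor>" for T :: real
  have bracket: "eventually (\<lambda>T. ln T \<ge> 1 \<and> p (exp (real (Suc (N T)))) \<le> p T \<and> p T \<le> p (exp (real (N T)))) at_top"
  proof -
    have "eventually (\<lambda>T::real. ln T \<ge> 1) at_top" using ln_at_top by (simp add: filterlim_at_top)
    then show ?thesis using eventually_gt_at_top[of 0]
    proof eventually_elim
      case (elim T)
      have f: "real (N T) \<le> ln T" "ln T \<le> real (Suc (N T))" using elim unfolding N_def by linarith+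
      then have "exp (real (N T)) \<le> T" "T \<le> exp (real (Suc (N T)))"
        using elim by (metis exp_le_cancel_iff exp_ln)+
      then show ?case using anti elim by auto
    qed
  qed
  have posT: "eventually (\<lambda>T. p T > 0) at_top"
    using bracket by eventually_elim (use pos in \<open>metis less_le_trans\<close>)
  have N: "filterlim N at_top at_top" unfolding N_def by (rule floor_ln_limits)
  have lim1: "((\<lambda>T. ln (p (exp (real (N T)))) / real (N T)) \<longlongrightarrow> - \<theta>) at_top"
    by (rule filterlim_compose[OF lim N])
  have limS: "(\<lambda>n::nat. ln (p (exp (real (Suc n)))) / real (Suc n)) \<longlonglongrightarrow> - \<theta>" by (rule LIMSEQ_Suc[OF lim])
  have lim2: "((\<lambda>T. ln (p (exp (real (Suc (N T))))) / real (Suc (N T))) \<longlongrightarrow> - \<theta>) at_top"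
    by (rule filterlim_compose[OF limS N])
  have up: "((\<lambda>T. ln (p (exp (real (N T)))) / real (N T) * (real (N T) / ln T)) \<longlongrightarrow> - \<theta> * 1) at_top"
    unfolding N_def by (rule tendsto_mult[OF lim1[unfolded N_def] floor_ln_limits(2)])
  have lo: "((\<lambda>T. ln (p (exp (real (Suc (N T))))) / real (Suc (N T)) * (real (Suc (N T)) / ln T)) \<longlongrightarrow> - \<theta> * 1) at_top"
    unfolding N_def by (rule tendsto_mult[OF lim2[unfolded N_def] floor_ln_limits(3)])
  have "((\<lambda>T. ln (p T) / ln T) \<longlongrightarrow> - \<theta> * 1) at_top"
  proof (rule tendsto_sandwich[OF _ _ lo up])
    show "eventually (\<lambda>T. ln (p (exp (real (Suc (N T))))) / real (Suc (N T)) * (real (Suc (N T)) / ln T) \<le> ln (p T) / ln T) at_top"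
      using bracket posT
    proof eventually_elim
      case (elim T)
      have "ln (p (exp (real (Suc (N T))))) \<le> ln (p T)" using elim pos[of "Suc (N T)"] by (subst ln_le_cancel_iff) auto
      then have "ln (p (exp (real (Suc (N T))))) / ln T \<le> ln (p T) / ln T" using elim by (intro divide_right_mono) auto
      then show ?case by (simp del: of_nat_Suc)
    qed
    show "eventually (\<lambda>T. ln (p T) / ln T \<le> ln (p (exp (real (N T)))) / real (N T) * (real (N T) / ln T)) at_top"
      using bracket posT
    proof eventually_elim
      case (elim T)
      have "N T \<noteq> 0" using elim unfolding N_def by linarith
      have "ln (p T) \<le> ln (p (exp (real (N T))))" using elim pos by (subst ln_le_cancel_iff) auto
      then have "ln (p T) / ln T \<le> ln (p (exp (real (N T)))) / ln T" using elim by (intro divide_right_mono) auto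
      then show ?case using \<open>N T \<noteq> 0\<close> by simp
    qed
  qed
  then show ?thesis using posT by (simp add: power_decay_def)
qed

lemma lamperti_stationary_gaussian:
  assumes "prob_space M"
    and X: "gaussian_process M X" "centred M X"
    and "AE \<omega> in M. cadlag (\<lambda>t. X t \<omega>)"
    and ss: "self_similar M H X"
    and cov: "\<And>s t. 0 \<le> s \<Longrightarrow> 0 \<le> t \<Longrightarrow> covariance M (X s) (X t) \<ge> 0"
    and "continuous_on UNIV (\<lambda>\<tau>. covariance M (X 1) (lamperti H X \<tau>))"
    and "integrable lborel (\<lambda>\<tau>. covariance M (X 1) (lamperti H X \<tau>))"
    and nz: "\<exists>\<tau>. covariance M (X 1) (lamperti H X \<tau>) \<noteq> 0"
  shows "stationary_gaussian M (lamperti H X) (\<lambda>\<tau>. covariance M (X 1) (lamperti H X \<tau>))"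
proof
  have H: "H > 0" using ss by (simp add: self_similar_def)
  show "gaussian_family M (lamperti H X)" by (rule lamperti_gaussian_family[OF assms(1) X])
  show "(\<integral>\<omega>. lamperti H X s \<omega> * lamperti H X t \<omega> \<partial>M) = covariance M (X 1) (lamperti H X (t - s))" for s t
    by (rule lamperti_stationary[OF assms(1) X ss])
  show "0 \<le> covariance M (X 1) (lamperti H X u)" for u
    unfolding covariance_lamperti[OF X(2)] using cov[of 1 "exp u"] by (simp add: covariance_centred[OF X(2)])
  show "0 < covariance M (X 1) (lamperti H X 0)"
  proof (rule ccontr)
    interpret prob_space M by fact
    have G: "gaussian_family M (\<lambda>t. X (exp t))" by (rule gaussian_process_family[OF assms(1) X]) simp
    note [measurable] = gaussian_familyD(2)[OF G]
    have [measurable]: "X 1 \<in> borel_measurable M" by (rule gaussian_process_measurable[OF X(1)]) simp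
    have sq: "integrable M (\<lambda>\<omega>. (X 1 \<omega>)\<^sup>2)" using gaussian_familyD(3)[OF G, of 0] by simp
    assume "\<not> 0 < covariance M (X 1) (lamperti H X 0)"
    then have "(\<integral>\<omega>. (X 1 \<omega>)\<^sup>2 \<partial>M) \<le> 0" unfolding covariance_lamperti[OF X(2)] by (simp add: power2_eq_square)
    moreover have "(\<integral>\<omega>. (X 1 \<omega>)\<^sup>2 \<partial>M) \<ge> 0" by simp
    ultimately have "(\<integral>\<omega>. (X 1 \<omega>)\<^sup>2 \<partial>M) = 0" by linarith
    then have "AE \<omega> in M. X 1 \<omega> = 0" using integral_nonneg_eq_0_iff_AE[OF sq] by simp
    then have "(\<integral>\<omega>. X 1 \<omega> * X (exp \<tau>) \<omega> \<partial>M) = 0" for \<tau>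
      by (intro integral_eq_zero_AE) auto
    then show False using nz by (simp add: covariance_lamperti[OF X(2)])
  qed
  show "AE \<omega> in M. \<exists>B. \<forall>\<tau>\<in>\<rat> \<inter> {0..1}. \<bar>lamperti H X \<tau> \<omega>\<bar> \<le> B" by (rule lamperti_bounded) fact+
qed fact+

text \<open>
  The exponent on the right is the persistence rate of the Lamperti transform of \<open>X\<close> and does not depend
  on \<open>Y\<close>. The case \<open>Y = 0\<close> identifies it with the persistence exponent of \<open>X\<close>.
\<close>

lemma persistence_perturbed:
  assumes "prob_space M" and "0 < K" and KH: "K < H"
    and X: "gaussian_process M X" "centred M X"
    and Y: "gaussian_process M Y" "centred M Y"
    and S: "gaussian_process M (\<lambda>t \<omega>. X t \<omega> + Y t \<omega>)"
    and cX: "AE \<omega> in M. cadlag (\<lambda>t. X t \<omega>)" and cY: "AE \<omega> in M. cadlag (\<lambda>t. Y t \<omega>)"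
    and sY: "self_similar M K Y"
    and covS: "\<And>s t. 0 \<le> s \<Longrightarrow> 0 \<le> t \<Longrightarrow>
           covariance M (\<lambda>\<omega>. X s \<omega> + Y s \<omega>) (\<lambda>\<omega>. X t \<omega> + Y t \<omega>) \<ge> 0"
    and st: "stationary_gaussian M (lamperti H X) r"
    and \<theta>: "\<theta> \<ge> 0" "(\<lambda>n. ln (stationary_gaussian.below M (lamperti H X) 0 n) / real n) \<longlonglongrightarrow> - \<theta>"
  shows "power_decay (persistence_prob M (\<lambda>t \<omega>. X t \<omega> + Y t \<omega>)) \<theta>"
proof -
  interpret stationary_gaussian M "lamperti H X" r by (rule st)
  define S' where "S' t \<omega> = X t \<omega> + Y t \<omega>" for t \<omega>
  have S': "gaussian_process M S'" using S by (simp add: S'_def[abs_def])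
  have cS: "centred M S'" using X(2) Y(2) by (simp add: centred_def S'_def[abs_def])
  have covS': "(\<integral>\<omega>. S' s \<omega> * S' t \<omega> \<partial>M) \<ge> 0" if "s \<ge> 0" "t \<ge> 0" for s t
  proof -
    have "covariance M (S' s) (S' t) \<ge> 0" using covS[OF that] by (simp add: S'_def[abs_def])
    then show ?thesis using covariance_centred[OF cS that] by simp
  qed
  have cadS: "AE \<omega> in M. cadlag (\<lambda>t. S' t \<omega>)"
    using cX cY
  proof eventually_elim
    case (elim \<omega>)
    show ?case unfolding cadlag_def S'_def
    proof (intro conjI allI impI)
      fix t :: real assume "t \<ge> 0"
      then show "((\<lambda>t. X t \<omega> + Y t \<omega>) \<longlongrightarrow> X t \<omega> + Y t \<omega>) (at_right t)"
        using elim by (intro tendsto_add) (auto simp: cadlag_def)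
    next
      fix t :: real assume "t > 0"
      then obtain l l' where "((\<lambda>t. X t \<omega>) \<longlongrightarrow> l) (at_left t)" "((\<lambda>t. Y t \<omega>) \<longlongrightarrow> l') (at_left t)"
        using elim unfolding cadlag_def by blast
      then have "((\<lambda>t. X t \<omega> + Y t \<omega>) \<longlongrightarrow> l + l') (at_left t)" by (rule tendsto_add)
      then show "\<exists>l. ((\<lambda>t. X t \<omega> + Y t \<omega>) \<longlongrightarrow> l) (at_left t)" by blast
    qed
  qed
  define W where "W = lamperti K Y"
  have W: "gaussian_family M W" unfolding W_def by (rule lamperti_gaussian_family[OF assms(1) Y])
  have Wcov: "(\<integral>\<omega>. W s \<omega> * W t \<omega> \<partial>M) = covariance M (Y 1) (lamperti K Y (t - s))" for s t
    unfolding W_def by (rule lamperti_stationary[OF assms(1) Y sY])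
  obtain c x0 where c: "c > 0" and tail: "\<And>k x. x \<ge> x0 \<Longrightarrow> prob_exceed M W (\<rat> \<inter> {real k..real k + 1}) x \<le> exp (- c * x)"
    using stationary_exponential_tail[OF W Wcov lamperti_bounded[OF cY assms(2), folded W_def]] by blast
  define V where "V \<tau> \<omega> = exp (- \<tau> * H) * Y (exp \<tau>) \<omega>" for \<tau> \<omega>
  have VW: "V \<tau> \<omega> = exp (- (H - K) * \<tau>) * W \<tau> \<omega>" for \<tau> \<omega>
    unfolding V_def W_def lamperti_def
    by (simp add: mult.assoc[symmetric] exp_add[symmetric]) (simp add: algebra_simps)
  have mY[measurable]: "Y (exp \<tau>) \<in> borel_measurable M" for \<tau> by (rule gaussian_process_measurable[OF Y(1)]) simp
  have mV: "V \<tau> \<in> borel_measurable M" for \<tau> unfolding V_def[abs_def] by measurable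
  have mW: "W \<tau> \<in> borel_measurable M" for \<tau> by (rule gaussian_familyD[OF W])
  have H: "H > 0" using KH assms(2) by simp
  interpret perturbed_stationary M "lamperti H X" r "lamperti H S'" V H "H - K" c x0
  proof
    show "lamperti H S' \<tau> \<omega> = lamperti H X \<tau> \<omega> + V \<tau> \<omega>" for \<tau> \<omega>
      by (simp add: lamperti_def S'_def V_def distrib_left)
    show "gaussian_family M (lamperti H S')" by (rule lamperti_gaussian_family[OF assms(1) S' cS])
    show "0 \<le> (\<integral>\<omega>. lamperti H S' s \<omega> * lamperti H S' t \<omega> \<partial>M)" for s t
    proof -
      have "lamperti H S' s \<omega> * lamperti H S' t \<omega> = (exp (- s * H) * exp (- t * H)) * (S' (exp s) \<omega> * S' (exp t) \<omega>)" for \<omega>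
        by (simp add: lamperti_def)
      then show ?thesis using covS'[of "exp s" "exp t"] by simp
    qed
    show "prob_exceed M V (\<rat> \<inter> {real m..real N}) \<delta> \<le> real N * exp (- c * \<delta> * exp ((H - K) * real m))"
      if "\<delta> > 0" "m < N" "\<delta> * exp ((H - K) * real m) \<ge> x0" for \<delta> m N
      by (rule damped_tail[OF assms(1) mV mW VW _ c tail that(3,1,2)]) (use KH in auto)
  qed (use mV H KH c in auto)
  have mS: "S' t \<in> borel_measurable M" if "t \<ge> 0" for t by (rule gaussian_process_measurable[OF S' that])
  have surv: "survive n = prob_below M (\<lambda>\<tau>. S' (exp \<tau>)) (\<rat> \<inter> {..real n}) (\<lambda>_. 1)" for n
  proof -
    have "lamperti H S' \<tau> \<omega> \<le> exp (- H * \<tau>) \<longleftrightarrow> S' (exp \<tau>) \<omega> \<le> 1" for \<tau> \<omega>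
      using mult_le_cancel_left_pos[of "exp (- \<tau> * H)" "S' (exp \<tau>) \<omega>" 1] by (simp add: lamperti_def mult.commute)
    then show ?thesis by (simp add: survive_def prob_below_def)
  qed
  have pos: "survive n > 0" for n
    unfolding surv by (rule persistence_positive[OF assms(1) S' cS cadS covS'])
  have pp: "persistence_prob M S' (exp (real n)) = survive n" for n
    unfolding surv by (rule persistence_prob_exp_nat[OF assms(1) mS cadS])
  have "power_decay (persistence_prob M S') \<theta>"
  proof (rule power_decay_from_exponential_times)
    show "persistence_prob M S' T' \<le> persistence_prob M S' T" if "0 < T" "T \<le> T'" for T T'
      by (rule persistence_prob_antimono[OF assms(1) mS cadS that])
    show "persistence_prob M S' (exp (real n)) > 0" for n unfolding pp by (rule pos)
    show "(\<lambda>n. ln (persistence_prob M S' (exp (real n))) / real n) \<longlonglongrightarrow> - \<theta>"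
      unfolding pp by (rule survive_rate[OF pos \<theta>(2,1)])
  qed
  then show ?thesis by (simp add: S'_def[abs_def])
qed

theorem theorem1:
  fixes M :: "'a measure" and X Y :: "real \<Rightarrow> 'a \<Rightarrow> real" and H K :: real
  assumes "prob_space M"
    and "0 < K" and "K < H"
    and "gaussian_process M X" and "centred M X"
    and "gaussian_process M Y" and "centred M Y"
    and "gaussian_process M (\<lambda>t \<omega>. X t \<omega> + Y t \<omega>)"
    and "AE \<omega> in M. cadlag (\<lambda>t. X t \<omega>)"
    and "AE \<omega> in M. cadlag (\<lambda>t. Y t \<omega>)"
    and "self_similar M H X"
    and "self_similar M K Y"
    and "\<And>s t. 0 \<le> s \<Longrightarrow> 0 \<le> t \<Longrightarrow> covariance M (X s) (X t) \<ge> 0"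
    and "\<And>s t. 0 \<le> s \<Longrightarrow> 0 \<le> t \<Longrightarrow>
           covariance M (\<lambda>\<omega>. X s \<omega> + Y s \<omega>) (\<lambda>\<omega>. X t \<omega> + Y t \<omega>) \<ge> 0"
    and "continuous_on UNIV (\<lambda>\<tau>. covariance M (X 1) (lamperti H X \<tau>))"
    and "integrable lborel (\<lambda>\<tau>. covariance M (X 1) (lamperti H X \<tau>))"
    and "\<exists>\<tau>. covariance M (X 1) (lamperti H X \<tau>) \<noteq> 0"
  shows "power_decay (persistence_prob M X) (persistence_exponent M X) \<and>
         power_decay (persistence_prob M (\<lambda>t \<omega>. X t \<omega> + Y t \<omega>)) (persistence_exponent M X)"
proof -
  have st: "stationary_gaussian M (lamperti H X) (\<lambda>\<tau>. covariance M (X 1) (lamperti H X \<tau>))"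
    by (rule lamperti_stationary_gaussian) fact+
  obtain \<theta> where \<theta>: "\<theta> \<ge> 0" "(\<lambda>n. ln (stationary_gaussian.below M (lamperti H X) 0 n) / real n) \<longlonglongrightarrow> - \<theta>"
    using stationary_gaussian.persistence_rate[OF st] by blast
  have XY: "power_decay (persistence_prob M (\<lambda>t \<omega>. X t \<omega> + Y t \<omega>)) \<theta>"
    by (rule persistence_perturbed[OF assms(1-10) assms(12) assms(14) st \<theta>])
  have X: "power_decay (persistence_prob M X) \<theta>"
  proof -
    have "power_decay (persistence_prob M (\<lambda>t \<omega>. X t \<omega> + (\<lambda>_ _. 0) t \<omega>)) \<theta>"
    proof (rule persistence_perturbed[OF assms(1-5) _ _ _ assms(9) _ _ _ st \<theta>])
      show "gaussian_process M (\<lambda>_ _. 0)" by (auto simp: gaussian_process_def gaussian_rv_def)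
      show "centred M (\<lambda>_ _. 0)" by (simp add: centred_def)
      show "gaussian_process M (\<lambda>t \<omega>. X t \<omega> + (\<lambda>_ _. 0) t \<omega>)" using assms(4) by simp
      show "AE \<omega> in M. cadlag (\<lambda>t. (\<lambda>_ _. 0) t \<omega>)" by (simp add: cadlag_def) (auto intro: exI[of _ 0])
      show "self_similar M K (\<lambda>_ _. 0)" using assms(2) by (simp add: self_similar_def same_fdd_def)
      show "0 \<le> covariance M (\<lambda>\<omega>. X s \<omega> + (\<lambda>_ _. 0) s \<omega>) (\<lambda>\<omega>. X t \<omega> + (\<lambda>_ _. 0) t \<omega>)" if "0 \<le> s" "0 \<le> t" for s t
        using assms(13)[OF that] by simp
    qed
    then show ?thesis by simp
  qed
  have "persistence_exponent M X = \<theta>"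
  proof -
    have "((\<lambda>T. ln (persistence_prob M X T) / ln T) \<longlongrightarrow> - \<theta>) at_top" using X by (simp add: power_decay_def)
    then have "Lim at_top (\<lambda>T. ln (persistence_prob M X T) / ln T) = - \<theta>" by (intro tendsto_Lim) auto
    then show ?thesis by (simp add: persistence_exponent_def)
  qed
  then show ?thesis using X XY by simp
qed

end
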